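(* Let $\mathcal{A}$ be an abelian category with a generator, small direct sums and exact small products, and let $S$ be an inverse sequence in $\mathcal{A}$. If $\lim^1 S=0$ and $\lambda$ is a limit ordinal of countable cofinality, then $S$ is $\lambda$-complete.
   Context: A generator of $\mathcal{A}$ is an object $G$ such that the functor $\mathcal{A}(G,-)$ is faithful. An inverse sequence $S$ in $\mathcal{A}$ consists of objects $S_i$ and morphisms $f_i:S_{i+1}\to S_i$, $i\in\omega=\{0,1,2,\dots\}$, i.e. it is a functor $\omega^{\mathrm{op}}\to\mathcal{A}$. Inverse sequences form an abelian category $\mathcal{A}^{\omega^{\mathrm{op}}}$, in which kernels, cokernels, images and limits are computed componentwise. $\lim^1 S$ (the first right derived functor of the limit) is the cokernel of $1-F:\prod_i S_i\to\prod_i S_i$, where $\mathrm{pr}_jF=f_j\,\mathrm{pr}_{j+1}$. $I(S)\rightarrowtail S$ is the inverse sequence of images $I(S)_i=\mathrm{Im}(f_i:S_{i+1}\to S_i)$. For ordinals: $I^0(S)=S$, $I^{\alpha+1}(S)=I(I^\alpha(S))$, and $I^\lambda(S)=\lim_{\alpha<\lambda}I^\alpha(S)$ for a (nonzero) limit ordinal $\lambda$ (a limit in $\mathcal{A}^{\omega^{\mathrm{op}}}$). The canonical maps $I^\alpha(S)\to S$ are monomorphisms; put $S^\alpha=\mathrm{Coker}(I^\alpha(S)\rightarrowtail S)$. For a limit ordinal $\lambda$ put $\widehat S^\lambda=\lim_{\beta<\lambda}S^\beta$ (a limit in $\mathcal{A}^{\omega^{\mathrm{op}}}$). $S$ is called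 $\lambda$-complete if the natural map $S\to\widehat S^\lambda$, induced by the projections $S\to S^\beta$, is an epimorphism. *)

theory Defs
  imports "HOL-Algebra.Group" "HOL-Library.Equipollence" "HOL-Library.Countable_Set"
begin

section \<open>Smallness\<close>

text \<open>
  A type \<open>'u\<close> plays the role of a Grothendieck universe, up to bijection: a set (of any type) is
  small if it has strictly smaller cardinality than \<open>'u\<close>. Index sets of small products and sums
  can then be taken to be small subsets of \<open>'u\<close>, since every small set is in bijection with one.
\<close>

definition small :: "'u itself \<Rightarrow> 'a set \<Rightarrow> bool" where
  "small U X \<longleftrightarrow> X \<prec> (UNIV :: 'u set)"

text \<open>These conditions say that the cardinality of \<open>'u\<close> is an uncountable strongly inaccessible cardinal.\<close>

definition grothendieck_universe :: "'u itself \<Rightarrow> bool" where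
  "grothendieck_universe U \<longleftrightarrow>
     small U (UNIV :: nat set) \<and>
     (\<forall>X :: 'u set. small U X \<longrightarrow> small U (Pow X)) \<and>
     (\<forall>(I :: 'u set) (X :: 'u \<Rightarrow> 'u set).
        small U I \<longrightarrow> (\<forall>i\<in>I. small U (X i)) \<longrightarrow> small U (\<Union>i\<in>I. X i))"


section \<open>Preadditive categories\<close>

text \<open>
  \<open>Zero X Y\<close> is the zero morphism \<open>X \<rightarrow> Y\<close>. Composition \<open>g \<cdot> f\<close> and addition are only meaningful
  for composable, respectively parallel, arrows.
\<close>

record ('o, 'm) precat =
  Obj :: "'o set"
  Arr :: "'m set"
  Dom :: "'m \<Rightarrow> 'o"
  Cod :: "'m \<Rightarrow> 'o"
  Id :: "'o \<Rightarrow> 'm"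
  Comp :: "'m \<Rightarrow> 'm \<Rightarrow> 'm"  (infixl \<open>\<cdot>\<index>\<close> 70)
  Zero :: "'o \<Rightarrow> 'o \<Rightarrow> 'm"
  Add :: "'m \<Rightarrow> 'm \<Rightarrow> 'm"  (infixl \<open>\<boxplus>\<index>\<close> 65)

definition Hom :: "('o, 'm) precat \<Rightarrow> 'o \<Rightarrow> 'o \<Rightarrow> 'm set" where
  "Hom C X Y = {f \<in> Arr C. Dom C f = X \<and> Cod C f = Y}"

definition hom_group :: "('o, 'm) precat \<Rightarrow> 'o \<Rightarrow> 'o \<Rightarrow> 'm monoid" where
  "hom_group C X Y = \<lparr>carrier = Hom C X Y, mult = Add C, one = Zero C X Y\<rparr>"

locale category =
  fixes C :: "('o, 'm) precat" (structure)
  assumes Dom_Obj: "f \<in> Arr C \<Longrightarrow> Dom C f \<in> Obj C"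
    and Cod_Obj: "f \<in> Arr C \<Longrightarrow> Cod C f \<in> Obj C"
    and Id_Hom: "X \<in> Obj C \<Longrightarrow> Id C X \<in> Hom C X X"
    and Comp_Hom: "\<lbrakk>f \<in> Hom C X Y; g \<in> Hom C Y Z\<rbrakk> \<Longrightarrow> g \<cdot> f \<in> Hom C X Z"
    and Comp_Id: "f \<in> Hom C X Y \<Longrightarrow> f \<cdot> Id C X = f"
    and Id_Comp: "f \<in> Hom C X Y \<Longrightarrow> Id C Y \<cdot> f = f"
    and Comp_assoc:
      "\<lbrakk>f \<in> Hom C W X; g \<in> Hom C X Y; h \<in> Hom C Y Z\<rbrakk> \<Longrightarrow> h \<cdot> (g \<cdot> f) = (h \<cdot> g) \<cdot> f"

locale preadditive_category = category +
  assumes hom_comm_group: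
      "\<lbrakk>X \<in> Obj C; Y \<in> Obj C\<rbrakk> \<Longrightarrow> comm_group (hom_group C X Y)"
    and Comp_Add_left:
      "\<lbrakk>f \<in> Hom C X Y; g \<in> Hom C Y Z; h \<in> Hom C Y Z\<rbrakk> \<Longrightarrow> (g \<boxplus> h) \<cdot> f = g \<cdot> f \<boxplus> h \<cdot> f"
    and Comp_Add_right:
      "\<lbrakk>f \<in> Hom C X Y; g \<in> Hom C X Y; h \<in> Hom C Y Z\<rbrakk> \<Longrightarrow> h \<cdot> (f \<boxplus> g) = h \<cdot> f \<boxplus> h \<cdot> g"

definition monic :: "('o, 'm) precat \<Rightarrow> 'm \<Rightarrow> bool" where
  "monic C f \<longleftrightarrow> f \<in> Arr C \<and>
     (\<forall>W. \<forall>g\<in>Hom C W (Dom C f). \<forall>h\<in>Hom C W (Dom C f). f \<cdot>\<^bsub>C\<^esub> g = f \<cdot>\<^bsub>C\<^esub> h \<longrightarrow> g = h)"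

definition epic :: "('o, 'm) precat \<Rightarrow> 'm \<Rightarrow> bool" where
  "epic C f \<longleftrightarrow> f \<in> Arr C \<and>
     (\<forall>Z. \<forall>g\<in>Hom C (Cod C f) Z. \<forall>h\<in>Hom C (Cod C f) Z. g \<cdot>\<^bsub>C\<^esub> f = h \<cdot>\<^bsub>C\<^esub> f \<longrightarrow> g = h)"

definition zero_object :: "('o, 'm) precat \<Rightarrow> 'o \<Rightarrow> bool" where
  "zero_object C Z \<longleftrightarrow> Z \<in> Obj C \<and>
     (\<forall>X\<in>Obj C. (\<exists>!f. f \<in> Hom C X Z) \<and> (\<exists>!f. f \<in> Hom C Z X))"

definition is_kernel :: "('o, 'm) precat \<Rightarrow> 'm \<Rightarrow> 'm \<Rightarrow> bool" where
  "is_kernel C f k \<longleftrightarrow>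
     f \<in> Arr C \<and> k \<in> Hom C (Dom C k) (Dom C f) \<and> f \<cdot>\<^bsub>C\<^esub> k = Zero C (Dom C k) (Cod C f) \<and>
     (\<forall>W. \<forall>g\<in>Hom C W (Dom C f). f \<cdot>\<^bsub>C\<^esub> g = Zero C W (Cod C f) \<longrightarrow>
        (\<exists>!u. u \<in> Hom C W (Dom C k) \<and> k \<cdot>\<^bsub>C\<^esub> u = g))"

definition is_cokernel :: "('o, 'm) precat \<Rightarrow> 'm \<Rightarrow> 'm \<Rightarrow> bool" where
  "is_cokernel C f q \<longleftrightarrow>
     f \<in> Arr C \<and> q \<in> Hom C (Cod C f) (Cod C q) \<and> q \<cdot>\<^bsub>C\<^esub> f = Zero C (Dom C f) (Cod C q) \<and>
     (\<forall>Z. \<forall>g\<in>Hom C (Cod C f) Z. g \<cdot>\<^bsub>C\<^esub> f = Zero C (Dom C f) Z \<longrightarrow>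
        (\<exists>!u. u \<in> Hom C (Cod C q) Z \<and> u \<cdot>\<^bsub>C\<^esub> q = g))"

definition has_biproduct :: "('o, 'm) precat \<Rightarrow> 'o \<Rightarrow> 'o \<Rightarrow> bool" where
  "has_biproduct C X Y \<longleftrightarrow>
     (\<exists>B\<in>Obj C. \<exists>i\<in>Hom C X B. \<exists>j\<in>Hom C Y B. \<exists>p\<in>Hom C B X. \<exists>q\<in>Hom C B Y.
        p \<cdot>\<^bsub>C\<^esub> i = Id C X \<and> q \<cdot>\<^bsub>C\<^esub> j = Id C Y \<and>
        q \<cdot>\<^bsub>C\<^esub> i = Zero C X Y \<and> p \<cdot>\<^bsub>C\<^esub> j = Zero C Y X \<and>
        i \<cdot>\<^bsub>C\<^esub> p \<boxplus>\<^bsub>C\<^esub> j \<cdot>\<^bsub>C\<^esub> q = Id C B)"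

locale abelian_category = preadditive_category +
  assumes ex_zero_object: "\<exists>Z. zero_object C Z"
    and ex_biproduct: "\<lbrakk>X \<in> Obj C; Y \<in> Obj C\<rbrakk> \<Longrightarrow> has_biproduct C X Y"
    and ex_kernel: "f \<in> Arr C \<Longrightarrow> \<exists>k. is_kernel C f k"
    and ex_cokernel: "f \<in> Arr C \<Longrightarrow> \<exists>q. is_cokernel C f q"
    and mono_normal: "monic C f \<Longrightarrow> \<exists>g. is_kernel C g f"
    and epi_normal: "epic C f \<Longrightarrow> \<exists>g. is_cokernel C g f"

definition short_exact :: "('o, 'm) precat \<Rightarrow> 'm \<Rightarrow> 'm \<Rightarrow> bool" where
  "short_exact C f g \<longleftrightarrow> is_kernel C g f \<and> is_cokernel C f g"

definition locally_small :: "'u itself \<Rightarrow> ('o, 'm) precat \<Rightarrow> bool" where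
  "locally_small U C \<longleftrightarrow> (\<forall>X\<in>Obj C. \<forall>Y\<in>Obj C. small U (Hom C X Y))"

text \<open>\<open>G\<close> is a generator if the functor \<open>Hom(G, -)\<close> is faithful.\<close>

definition generator :: "('o, 'm) precat \<Rightarrow> 'o \<Rightarrow> bool" where
  "generator C G \<longleftrightarrow> G \<in> Obj C \<and>
     (\<forall>X\<in>Obj C. \<forall>Y\<in>Obj C. inj_on (\<lambda>f. \<lambda>h\<in>Hom C G X. f \<cdot>\<^bsub>C\<^esub> h) (Hom C X Y))"


section \<open>Products, direct sums and limits\<close>

definition is_product ::
    "('o, 'm) precat \<Rightarrow> 'i set \<Rightarrow> ('i \<Rightarrow> 'o) \<Rightarrow> 'o \<Rightarrow> ('i \<Rightarrow> 'm) \<Rightarrow> bool" where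
  "is_product C I X P p \<longleftrightarrow>
     P \<in> Obj C \<and> (\<forall>i\<in>I. p i \<in> Hom C P (X i)) \<and>
     (\<forall>W\<in>Obj C. \<forall>f. (\<forall>i\<in>I. f i \<in> Hom C W (X i)) \<longrightarrow>
        (\<exists>!u. u \<in> Hom C W P \<and> (\<forall>i\<in>I. p i \<cdot>\<^bsub>C\<^esub> u = f i)))"

definition is_direct_sum ::
    "('o, 'm) precat \<Rightarrow> 'i set \<Rightarrow> ('i \<Rightarrow> 'o) \<Rightarrow> 'o \<Rightarrow> ('i \<Rightarrow> 'm) \<Rightarrow> bool" where
  "is_direct_sum C I X D j \<longleftrightarrow>
     D \<in> Obj C \<and> (\<forall>i\<in>I. j i \<in> Hom C (X i) D) \<and>
     (\<forall>Z\<in>Obj C. \<forall>f. (\<forall>i\<in>I. f i \<in> Hom C (X i) Z) \<longrightarrow>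
        (\<exists>!u. u \<in> Hom C D Z \<and> (\<forall>i\<in>I. u \<cdot>\<^bsub>C\<^esub> j i = f i)))"

definition has_small_direct_sums :: "'u itself \<Rightarrow> ('o, 'm) precat \<Rightarrow> bool" where
  "has_small_direct_sums U C \<longleftrightarrow>
     (\<forall>(I :: 'u set) X. small U I \<longrightarrow> (\<forall>i\<in>I. X i \<in> Obj C) \<longrightarrow> (\<exists>D j. is_direct_sum C I X D j))"

definition has_small_products :: "'u itself \<Rightarrow> ('o, 'm) precat \<Rightarrow> bool" where
  "has_small_products U C \<longleftrightarrow>
     (\<forall>(I :: 'u set) X. small U I \<longrightarrow> (\<forall>i\<in>I. X i \<in> Obj C) \<longrightarrow> (\<exists>P p. is_product C I X P p))"

text \<open>
  Exactness of the product functors: \<open>u\<close> and \<open>v\<close> are the products of the families \<open>f\<close> and \<open>g\<close>.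
\<close>

definition small_products_exact :: "'u itself \<Rightarrow> ('o, 'm) precat \<Rightarrow> bool" where
  "small_products_exact U C \<longleftrightarrow>
     (\<forall>(I :: 'u set) f g P p Q q R r u v.
        small U I \<longrightarrow> (\<forall>i\<in>I. short_exact C (f i) (g i)) \<longrightarrow>
        is_product C I (\<lambda>i. Dom C (f i)) P p \<longrightarrow>
        is_product C I (\<lambda>i. Cod C (f i)) Q q \<longrightarrow>
        is_product C I (\<lambda>i. Cod C (g i)) R r \<longrightarrow>
        u \<in> Hom C P Q \<longrightarrow> (\<forall>i\<in>I. q i \<cdot>\<^bsub>C\<^esub> u = f i \<cdot>\<^bsub>C\<^esub> p i) \<longrightarrow>
        v \<in> Hom C Q R \<longrightarrow> (\<forall>i\<in>I. r i \<cdot>\<^bsub>C\<^esub> v = g i \<cdot>\<^bsub>C\<^esub> q i) \<longrightarrow>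
        short_exact C u v)"

definition has_exact_small_products :: "'u itself \<Rightarrow> ('o, 'm) precat \<Rightarrow> bool" where
  "has_exact_small_products U C \<longleftrightarrow> has_small_products U C \<and> small_products_exact U C"

text \<open>
  Limit \<open>(L, p)\<close> of the diagram indexed by the opposite of the ordered set \<open>J\<close> with objects \<open>X \<beta>\<close>
  and transition maps \<open>t \<beta> \<gamma> : X \<gamma> \<rightarrow> X \<beta>\<close> for \<open>\<beta> \<le> \<gamma>\<close>.
\<close>

definition is_cone ::
    "('o, 'm) precat \<Rightarrow> 'w::order set \<Rightarrow> ('w \<Rightarrow> 'o) \<Rightarrow> ('w \<Rightarrow> 'w \<Rightarrow> 'm) \<Rightarrow> 'o \<Rightarrow> ('w \<Rightarrow> 'm) \<Rightarrow> bool" where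
  "is_cone C J X t L p \<longleftrightarrow>
     L \<in> Obj C \<and> (\<forall>\<beta>\<in>J. p \<beta> \<in> Hom C L (X \<beta>)) \<and>
     (\<forall>\<beta>\<in>J. \<forall>\<gamma>\<in>J. \<beta> \<le> \<gamma> \<longrightarrow> t \<beta> \<gamma> \<cdot>\<^bsub>C\<^esub> p \<gamma> = p \<beta>)"

definition is_limit ::
    "('o, 'm) precat \<Rightarrow> 'w::order set \<Rightarrow> ('w \<Rightarrow> 'o) \<Rightarrow> ('w \<Rightarrow> 'w \<Rightarrow> 'm) \<Rightarrow> 'o \<Rightarrow> ('w \<Rightarrow> 'm) \<Rightarrow> bool" where
  "is_limit C J X t L p \<longleftrightarrow> is_cone C J X t L p \<and>
     (\<forall>M q. is_cone C J X t M q \<longrightarrow> (\<exists>!u. u \<in> Hom C M L \<and> (\<forall>\<beta>\<in>J. p \<beta> \<cdot>\<^bsub>C\<^esub> u = q \<beta>)))"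


section \<open>The category of inverse sequences\<close>

record ('o, 'm) invseq =
  ob :: "nat \<Rightarrow> 'o"
  bond :: "nat \<Rightarrow> 'm"

record ('o, 'm) invseq_arr =
  src :: "('o, 'm) invseq"
  tgt :: "('o, 'm) invseq"
  cmp :: "nat \<Rightarrow> 'm"

definition inverse_sequence :: "('o, 'm) precat \<Rightarrow> ('o, 'm) invseq \<Rightarrow> bool" where
  "inverse_sequence C S \<longleftrightarrow>
     (\<forall>i. ob S i \<in> Obj C \<and> bond S i \<in> Hom C (ob S (Suc i)) (ob S i))"

definition invseq_cat ::
    "('o, 'm) precat \<Rightarrow> (('o, 'm) invseq, ('o, 'm) invseq_arr) precat" where
  "invseq_cat C =
     \<lparr>Obj = {S. inverse_sequence C S},
      Arr = {\<phi>. inverse_sequence C (src \<phi>) \<and> inverse_sequence C (tgt \<phi>) \<and>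
               (\<forall>i. cmp \<phi> i \<in> Hom C (ob (src \<phi>) i) (ob (tgt \<phi>) i) \<and>
                    bond (tgt \<phi>) i \<cdot>\<^bsub>C\<^esub> cmp \<phi> (Suc i) = cmp \<phi> i \<cdot>\<^bsub>C\<^esub> bond (src \<phi>) i)},
      Dom = src,
      Cod = tgt,
      Id = (\<lambda>S. \<lparr>src = S, tgt = S, cmp = (\<lambda>i. Id C (ob S i))\<rparr>),
      Comp = (\<lambda>\<psi> \<phi>. \<lparr>src = src \<phi>, tgt = tgt \<psi>, cmp = (\<lambda>i. cmp \<psi> i \<cdot>\<^bsub>C\<^esub> cmp \<phi> i)\<rparr>),
      Zero = (\<lambda>S T. \<lparr>src = S, tgt = T, cmp = (\<lambda>i. Zero C (ob S i) (ob T i))\<rparr>),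
      Add = (\<lambda>\<phi> \<psi>. \<lparr>src = src \<phi>, tgt = tgt \<phi>, cmp = (\<lambda>i. cmp \<phi> i \<boxplus>\<^bsub>C\<^esub> cmp \<psi> i)\<rparr>)\<rparr>"

text \<open>
  \<open>lim1 C S\<close> is the cokernel object of \<open>1 - F\<close> on a chosen product \<open>P\<close> of the objects of \<open>S\<close>.
\<close>

definition shift_map ::
    "('o, 'm) precat \<Rightarrow> ('o, 'm) invseq \<Rightarrow> 'o \<Rightarrow> (nat \<Rightarrow> 'm) \<Rightarrow> 'm" where
  "shift_map C S P p =
     (THE F. F \<in> Hom C P P \<and> (\<forall>j. p j \<cdot>\<^bsub>C\<^esub> F = bond S j \<cdot>\<^bsub>C\<^esub> p (Suc j)))"

definition lim1 :: "('o, 'm) precat \<Rightarrow> ('o, 'm) invseq \<Rightarrow> 'o" where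
  "lim1 C S =
     (let (P, p) = (SOME (P, p). is_product C UNIV (ob S) P p);
          d = Id C P \<boxplus>\<^bsub>C\<^esub> inv\<^bsub>hom_group C P P\<^esub> (shift_map C S P p)
      in Cod C (SOME q. is_cokernel C d q))"


section \<open>Transfinite iterated images\<close>

text \<open>The image of \<open>f\<close>, as a monomorphism into its codomain.\<close>

definition is_image :: "('o, 'm) precat \<Rightarrow> 'm \<Rightarrow> 'm \<Rightarrow> bool" where
  "is_image C f m \<longleftrightarrow> (\<exists>q. is_cokernel C f q \<and> is_kernel C q m)"

definition im :: "('o, 'm) precat \<Rightarrow> 'm \<Rightarrow> 'm" where
  "im C f = (SOME m. is_image C f m)"

text \<open>The inclusion \<open>I(S) \<rightarrow> S\<close>, so that \<open>I(S)\<close> is its source; the bonding maps of \<open>I(S)\<close> are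
  the restrictions of those of \<open>S\<close>.\<close>

definition image_incl :: "('o, 'm) precat \<Rightarrow> ('o, 'm) invseq \<Rightarrow> ('o, 'm) invseq_arr" where
  "image_incl C S =
     \<lparr>src = \<lparr>ob = (\<lambda>i. Dom C (im C (bond S i))),
             bond = (\<lambda>i. THE g. g \<in> Hom C (Dom C (im C (bond S (Suc i)))) (Dom C (im C (bond S i))) \<and>
                                im C (bond S i) \<cdot>\<^bsub>C\<^esub> g = bond S i \<cdot>\<^bsub>C\<^esub> im C (bond S (Suc i)))\<rparr>,
      tgt = S,
      cmp = (\<lambda>i. im C (bond S i))\<rparr>"

text \<open>
  An element \<open>\<alpha>\<close> of a well-ordered type stands for the ordinal that is the order type of
  \<open>{..<\<alpha>}\<close>. Every ordinal arises in this way.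
\<close>

definition is_zero :: "'w::wellorder \<Rightarrow> bool" where
  "is_zero \<alpha> \<longleftrightarrow> (\<forall>\<beta>. \<alpha> \<le> \<beta>)"

definition is_succ_of :: "'w::wellorder \<Rightarrow> 'w \<Rightarrow> bool" where
  "is_succ_of \<alpha> \<beta> \<longleftrightarrow> \<beta> < \<alpha> \<and> (\<forall>\<gamma>. \<beta> < \<gamma> \<longrightarrow> \<alpha> \<le> \<gamma>)"

definition limit_ordinal :: "'w::wellorder \<Rightarrow> bool" where
  "limit_ordinal \<alpha> \<longleftrightarrow> \<not> is_zero \<alpha> \<and> (\<nexists>\<beta>. is_succ_of \<alpha> \<beta>)"

definition countable_cofinality :: "'w::wellorder \<Rightarrow> bool" where
  "countable_cofinality \<alpha> \<longleftrightarrow> (\<exists>D. D \<subseteq> {..<\<alpha>} \<and> countable D \<and> (\<forall>\<beta><\<alpha>. \<exists>\<gamma>\<in>D. \<beta> \<le> \<gamma>))"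

text \<open>
  \<open>factor_through C m n\<close> is the arrow \<open>u\<close> with \<open>m u = n\<close>, and \<open>factor_over C q r\<close> the arrow \<open>u\<close> with
  \<open>u q = r\<close>. They are unique if they exist and \<open>m\<close> is mono, respectively \<open>q\<close> is epi.
\<close>

definition factor_through :: "('o, 'm) precat \<Rightarrow> 'm \<Rightarrow> 'm \<Rightarrow> 'm" where
  "factor_through C m n = (THE u. u \<in> Hom C (Dom C n) (Dom C m) \<and> m \<cdot>\<^bsub>C\<^esub> u = n)"

definition factor_over :: "('o, 'm) precat \<Rightarrow> 'm \<Rightarrow> 'm \<Rightarrow> 'm" where
  "factor_over C q r = (THE u. u \<in> Hom C (Cod C q) (Cod C r) \<and> u \<cdot>\<^bsub>C\<^esub> q = r)"

text \<open>
  \<open>iter_image C S \<alpha>\<close> is the canonical map \<open>I\<^sup>\<alpha>(S) \<rightarrow> S\<close>, so that \<open>I\<^sup>\<alpha>(S)\<close> is its source. Since these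
  maps are monomorphisms, the transition maps \<open>I\<^sup>\<gamma>(S) \<rightarrow> I\<^sup>\<beta>(S)\<close> for \<open>\<beta> \<le> \<gamma>\<close> are the unique ones
  over \<open>S\<close>. At a limit the canonical map is the projection to \<open>I\<^sup>0(S) = S\<close>. The \<open>undefined\<close> branch
  of \<open>M\<close> is never used; it only serves to exhibit the recursion as well-founded.
\<close>

function iter_image ::
    "('o, 'm) precat \<Rightarrow> ('o, 'm) invseq \<Rightarrow> 'w::wellorder \<Rightarrow> ('o, 'm) invseq_arr" where
  "iter_image C S \<alpha> =
     (let M = (\<lambda>\<beta>. if \<beta> < \<alpha> then iter_image C S \<beta> else undefined) in
      if is_zero \<alpha> then Id (invseq_cat C) S
      else if \<exists>\<beta>. is_succ_of \<alpha> \<beta> then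
        (let m = M (THE \<beta>. is_succ_of \<alpha> \<beta>) in m \<cdot>\<^bsub>invseq_cat C\<^esub> image_incl C (src m))
      else
        (let (L, p) = (SOME (L, p). is_limit (invseq_cat C) {..<\<alpha>} (\<lambda>\<beta>. src (M \<beta>))
                                     (\<lambda>\<beta> \<gamma>. factor_through (invseq_cat C) (M \<beta>) (M \<gamma>)) L p)
         in p (THE \<zeta>. is_zero \<zeta>)))"
  by pat_completeness auto
termination
  by (relation "inv_image {(\<beta> :: 'w::wellorder, \<alpha>). \<beta> < \<alpha>} (\<lambda>(C, S, \<alpha>). \<alpha>)") (auto simp: wf)

declare iter_image.simps [simp del]


section \<open>Completeness\<close>

text \<open>The projection \<open>S \<rightarrow> S\<^sup>\<alpha>\<close>, so that \<open>S\<^sup>\<alpha>\<close> is its target.\<close>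

definition quot_map ::
    "('o, 'm) precat \<Rightarrow> ('o, 'm) invseq \<Rightarrow> 'w::wellorder \<Rightarrow> ('o, 'm) invseq_arr" where
  "quot_map C S \<alpha> = (SOME q. is_cokernel (invseq_cat C) (iter_image C S \<alpha>) q)"

text \<open>The transition maps \<open>S\<^sup>\<gamma> \<rightarrow> S\<^sup>\<beta>\<close> for \<open>\<beta> \<le> \<gamma>\<close> are the unique ones under \<open>S\<close>.\<close>

definition completion ::
    "('o, 'm) precat \<Rightarrow> ('o, 'm) invseq \<Rightarrow> 'w::wellorder \<Rightarrow>
     ('o, 'm) invseq \<times> ('w \<Rightarrow> ('o, 'm) invseq_arr)" where
  "completion C S \<alpha> =
     (SOME (L, p). is_limit (invseq_cat C) {..<\<alpha>} (\<lambda>\<beta>. tgt (quot_map C S \<beta>))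
                     (\<lambda>\<beta> \<gamma>. factor_over (invseq_cat C) (quot_map C S \<gamma>) (quot_map C S \<beta>)) L p)"

definition completion_map ::
    "('o, 'm) precat \<Rightarrow> ('o, 'm) invseq \<Rightarrow> 'w::wellorder \<Rightarrow> ('o, 'm) invseq_arr" where
  "completion_map C S \<alpha> =
     (let (L, p) = completion C S \<alpha>
      in THE u. u \<in> Hom (invseq_cat C) S L \<and>
                (\<forall>\<beta><\<alpha>. p \<beta> \<cdot>\<^bsub>invseq_cat C\<^esub> u = quot_map C S \<beta>))"

definition complete :: "('o, 'm) precat \<Rightarrow> ('o, 'm) invseq \<Rightarrow> 'w::wellorder \<Rightarrow> bool" where
  "complete C S \<alpha> \<longleftrightarrow> epic (invseq_cat C) (completion_map C S \<alpha>)"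

end

theory Submission
  imports Defs
begin

text \<open>
  Say that \<open>x : W \<rightarrow> S\<^sub>i\<close> lies in \<open>I\<^sup>\<alpha>(S)\<close> if it factors through \<open>I\<^sup>\<alpha>(S)\<^sub>i \<rightarrow> S\<^sub>i\<close>. If
  \<open>y\<^sub>n - f\<^sub>n y\<^sub>n\<^sub>+\<^sub>1\<close> lies in \<open>I\<^sup>\<alpha>(S)\<close> for all large \<open>n\<close>, then so does \<open>y\<^sub>n\<close>, by transfinite induction
  on \<open>\<alpha>\<close>: at \<open>\<alpha> = \<beta> + 1\<close> the induction hypothesis puts \<open>y\<^sub>n\<^sub>+\<^sub>1\<close> in \<open>I\<^sup>\<beta>(S)\<close>, hence \<open>f\<^sub>n y\<^sub>n\<^sub>+\<^sub>1\<close> in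
  \<open>I\<^sup>\<alpha>(S)\<close>.

  Let \<open>\<gamma>\<^sub>n\<close> be nondecreasing and cofinal in \<open>\<lambda>\<close> and \<open>\<beta>\<^sub>n = \<gamma>\<^sub>n + n\<close>. Exactness of countable products
  provides a single epimorphism \<open>W \<rightarrow> lim S\<^sup>\<beta>\<^sub>i\<close> on which all the projections to \<open>S\<^sub>i/I\<^sup>\<beta>(S)\<^sub>i\<close>,
  \<open>\<beta> = \<beta>\<^sub>n\<close>, lift to \<open>s\<^sub>n : W \<rightarrow> S\<^sub>i\<close>. The differences \<open>x\<^sub>n = s\<^sub>n - s\<^sub>n\<^sub>+\<^sub>1\<close> lie in the \<open>\<beta>\<^sub>n\<close>-th iterated
  image, so on a further cover \<open>x\<^sub>n\<close> is the image of some \<open>z\<^sub>n : W \<rightarrow> S\<^sub>i\<^sub>+\<^sub>n\<close> lying in the \<open>\<gamma>\<^sub>n\<close>-th one.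
  Since \<open>lim\<^sup>1 S = 0\<close>, after passing to another cover one can solve \<open>y\<^sub>i\<^sub>+\<^sub>n - f y\<^sub>i\<^sub>+\<^sub>n\<^sub>+\<^sub>1 = z\<^sub>n\<close>, and by the
  first paragraph \<open>y\<^sub>i\<^sub>+\<^sub>n\<close> lies in the \<open>\<gamma>\<^sub>n\<close>-th iterated image. Then \<open>s\<^sub>0 - y\<^sub>i = s\<^sub>n - f\<^sup>n y\<^sub>i\<^sub>+\<^sub>n\<close> for all \<open>n\<close>,
  so \<open>s\<^sub>0 - y\<^sub>i\<close> lifts the given cover along \<open>S\<^sub>i \<rightarrow> lim S\<^sup>\<beta>\<^sub>i\<close>.
\<close>

section \<open>Categories\<close>

context category
begin

lemma Hom_iff: "f \<in> Hom C X Y \<longleftrightarrow> f \<in> Arr C \<and> Dom C f = X \<and> Cod C f = Y"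
  by (auto simp: Hom_def)

lemma Comp_simps [simp]:
  assumes "f \<in> Arr C" "g \<in> Arr C" "Cod C f = Dom C g"
  shows "g \<cdot> f \<in> Arr C" "Dom C (g \<cdot> f) = Dom C f" "Cod C (g \<cdot> f) = Cod C g"
  using Comp_Hom[of f "Dom C f" "Cod C f" g "Cod C g"] assms by (auto simp: Hom_iff)

lemma Id_simps [simp]:
  assumes "X \<in> Obj C"
  shows "Id C X \<in> Arr C" "Dom C (Id C X) = X" "Cod C (Id C X) = X"
  using Id_Hom[OF assms] by (auto simp: Hom_iff)

lemma Comp_Id_simp [simp]:
  assumes "f \<in> Arr C" "Dom C f = X"
  shows "f \<cdot> Id C X = f"
  using Comp_Id[of f X "Cod C f"] assms by (auto simp: Hom_iff)

lemma Id_Comp_simp [simp]: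
  assumes "f \<in> Arr C" "Cod C f = X"
  shows "Id C X \<cdot> f = f"
  using Id_Comp[of f "Dom C f" X] assms by (auto simp: Hom_iff)

lemma assoc:
  assumes "f \<in> Arr C" "g \<in> Arr C" "h \<in> Arr C" "Cod C f = Dom C g" "Cod C g = Dom C h"
  shows "(h \<cdot> g) \<cdot> f = h \<cdot> (g \<cdot> f)"
  using Comp_assoc[of f "Dom C f" "Dom C g" g "Dom C h" h "Cod C h"] assms
  by (auto simp: Hom_iff)

declare Dom_Obj [simp] Cod_Obj [simp]

lemma Hom_Obj:
  assumes "f \<in> Hom C X Y"
  shows "X \<in> Obj C" "Y \<in> Obj C"
  using assms by (auto simp: Hom_iff)

lemma monicD:
  assumes "monic C m" "g \<in> Hom C W (Dom C m)" "h \<in> Hom C W (Dom C m)" "m \<cdot> g = m \<cdot> h"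
  shows "g = h"
  using assms unfolding monic_def by blast

lemma epicD:
  assumes "epic C e" "g \<in> Hom C (Cod C e) Z" "h \<in> Hom C (Cod C e) Z" "g \<cdot> e = h \<cdot> e"
  shows "g = h"
  using assms unfolding epic_def by blast

lemma monic_Comp:
  assumes "monic C f" "monic C g" "Cod C f = Dom C g"
  shows "monic C (g \<cdot> f)"
proof -
  have fg: "f \<in> Arr C" "g \<in> Arr C" using assms by (auto simp: monic_def)
  show ?thesis unfolding monic_def
  proof (intro conjI allI ballI impI)
    fix W a b
    assume a: "a \<in> Hom C W (Dom C (g \<cdot> f))" and b: "b \<in> Hom C W (Dom C (g \<cdot> f))"
      and eq: "g \<cdot> f \<cdot> a = g \<cdot> f \<cdot> b"
    have "g \<cdot> (f \<cdot> a) = g \<cdot> (f \<cdot> b)"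
      using eq assoc[of a f g] assoc[of b f g] a b fg assms(3) by (metis Hom_iff Comp_simps(2))
    then have "f \<cdot> a = f \<cdot> b"
      using a b fg assms(3) by - (rule monicD[OF assms(2)], auto simp: Hom_iff)
    then show "a = b"
      using a b fg assms(3) by - (rule monicD[OF assms(1)], auto simp: Hom_iff)
  qed (use fg assms(3) in simp)
qed

lemma epic_Comp:
  assumes "epic C f" "epic C g" "Cod C f = Dom C g"
  shows "epic C (g \<cdot> f)"
proof -
  have fg: "f \<in> Arr C" "g \<in> Arr C" using assms by (auto simp: epic_def)
  show ?thesis unfolding epic_def
  proof (intro conjI allI ballI impI)
    fix Z a b
    assume a: "a \<in> Hom C (Cod C (g \<cdot> f)) Z" and b: "b \<in> Hom C (Cod C (g \<cdot> f)) Z"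
      and eq: "a \<cdot> (g \<cdot> f) = b \<cdot> (g \<cdot> f)"
    have "(a \<cdot> g) \<cdot> f = (b \<cdot> g) \<cdot> f"
      using eq assoc[of f g a] assoc[of f g b] a b fg assms(3) by (metis Hom_iff Comp_simps(3))
    then have "a \<cdot> g = b \<cdot> g"
      using a b fg assms(3) by - (rule epicD[OF assms(1)], auto simp: Hom_iff)
    then show "a = b"
      using a b fg assms(3) by - (rule epicD[OF assms(2)], auto simp: Hom_iff)
  qed (use fg assms(3) in simp)
qed

lemma epic_of_Comp:
  assumes "epic C (g \<cdot> f)" "f \<in> Arr C" "g \<in> Arr C" "Cod C f = Dom C g"
  shows "epic C g"
  unfolding epic_def
proof (intro conjI allI ballI impI)
  fix Z a b
  assume a: "a \<in> Hom C (Cod C g) Z" and b: "b \<in> Hom C (Cod C g) Z" and eq: "a \<cdot> g = b \<cdot> g"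
  have "a \<cdot> (g \<cdot> f) = b \<cdot> (g \<cdot> f)"
    using a b eq assms by (simp add: Hom_iff assoc[symmetric])
  then show "a = b"
    using a b assms by - (rule epicD[OF assms(1)], auto simp: Hom_iff)
qed (use assms in simp)

lemma epic_Id: "X \<in> Obj C \<Longrightarrow> epic C (Id C X)"
  unfolding epic_def by (auto simp: Hom_iff)

section \<open>Uniqueness and transport of limits\<close>

text \<open>Both arrows mediate the cone \<open>\<lambda>\<beta>. p \<beta> \<cdot> u\<close>. The
  transition maps are typed by a separate hypothesis because \<open>is_cone\<close> does not type
  them, and the associativity behind the cone condition relies on it.\<close>

lemma limit_unique:
  assumes "is_limit C J X t L p" "u \<in> Hom C W L" "v \<in> Hom C W L"
    and "\<And>\<beta>. \<beta> \<in> J \<Longrightarrow> p \<beta> \<cdot> u = p \<beta> \<cdot> v"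
    and X: "\<And>\<beta> \<gamma>. \<lbrakk>\<beta> \<in> J; \<gamma> \<in> J; \<beta> \<le> \<gamma>\<rbrakk> \<Longrightarrow> t \<beta> \<gamma> \<in> Hom C (X \<gamma>) (X \<beta>)"
  shows "u = v"
proof -
  have L: "is_cone C J X t L p" using assms(1) by (simp add: is_limit_def)
  have "is_cone C J X t W (\<lambda>\<beta>. p \<beta> \<cdot> u)"
    unfolding is_cone_def
  proof (intro conjI ballI impI)
    show "W \<in> Obj C" using assms(2) by (rule Hom_Obj)
    show "p \<beta> \<cdot> u \<in> Hom C W (X \<beta>)" if "\<beta> \<in> J" for \<beta>
      using L that assms(2) by (auto simp: is_cone_def intro: Comp_Hom)
    fix \<beta> \<gamma> assume bg: "\<beta> \<in> J" "\<gamma> \<in> J" "\<beta> \<le> \<gamma>"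
    have eq: "t \<beta> \<gamma> \<cdot> p \<gamma> = p \<beta>" using L bg by (auto simp: is_cone_def)
    have "p \<gamma> \<in> Hom C L (X \<gamma>)" using L bg by (auto simp: is_cone_def)
    then have "t \<beta> \<gamma> \<cdot> (p \<gamma> \<cdot> u) = (t \<beta> \<gamma> \<cdot> p \<gamma>) \<cdot> u"
      using X[OF bg] assms(2) by (simp add: Hom_iff assoc)
    then show "t \<beta> \<gamma> \<cdot> (p \<gamma> \<cdot> u) = p \<beta> \<cdot> u" using eq by simp
  qed
  then have "\<exists>!w. w \<in> Hom C W L \<and> (\<forall>\<beta>\<in>J. p \<beta> \<cdot> w = p \<beta> \<cdot> u)"
    using assms(1) by (simp add: is_limit_def)
  then show ?thesis using assms by metis
qed

lemma is_limit_factor: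
  assumes "is_limit C J X t L p" "is_cone C J X t M q"
  obtains u where "u \<in> Hom C M L" "\<And>\<beta>. \<beta> \<in> J \<Longrightarrow> p \<beta> \<cdot> u = q \<beta>"
proof -
  have "\<exists>!u. u \<in> Hom C M L \<and> (\<forall>\<beta>\<in>J. p \<beta> \<cdot> u = q \<beta>)"
    using assms by (simp add: is_limit_def)
  then show ?thesis using that by blast
qed

text \<open>Each limit mediates the cone of the other; both round trips fix all projections, so
  uniqueness makes them identities. Later this compares a limit selected by \<open>SOME\<close> with
  one built componentwise.\<close>

lemma limits_isomorphic:
  assumes L: "is_limit C J X t L p" and M: "is_limit C J X t M q"
    and X: "\<And>\<beta> \<gamma>. \<lbrakk>\<beta> \<in> J; \<gamma> \<in> J; \<beta> \<le> \<gamma>\<rbrakk> \<Longrightarrow> t \<beta> \<gamma> \<in> Hom C (X \<gamma>) (X \<beta>)"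
  obtains u v where "u \<in> Hom C L M" "v \<in> Hom C M L" "v \<cdot> u = Id C L" "u \<cdot> v = Id C M"
    "\<And>\<beta>. \<beta> \<in> J \<Longrightarrow> q \<beta> \<cdot> u = p \<beta>" "\<And>\<beta>. \<beta> \<in> J \<Longrightarrow> p \<beta> \<cdot> v = q \<beta>"
proof -
  have cL: "is_cone C J X t L p" and cM: "is_cone C J X t M q"
    using L M by (auto simp: is_limit_def)
  have LO: "L \<in> Obj C" "M \<in> Obj C" using cL cM by (auto simp: is_cone_def)
  have pq: "p \<beta> \<in> Hom C L (X \<beta>)" "q \<beta> \<in> Hom C M (X \<beta>)" if "\<beta> \<in> J" for \<beta>
    using cL cM that by (auto simp: is_cone_def)
  obtain u where u: "u \<in> Hom C L M" "\<And>\<beta>. \<beta> \<in> J \<Longrightarrow> q \<beta> \<cdot> u = p \<beta>"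
    by (rule is_limit_factor[OF M cL]) auto
  obtain v where v: "v \<in> Hom C M L" "\<And>\<beta>. \<beta> \<in> J \<Longrightarrow> p \<beta> \<cdot> v = q \<beta>"
    by (rule is_limit_factor[OF L cM]) auto
  have "v \<cdot> u = Id C L"
  proof (rule limit_unique[OF L])
    show "p \<beta> \<cdot> (v \<cdot> u) = p \<beta> \<cdot> Id C L" if "\<beta> \<in> J" for \<beta>
      using u(1) v(1) pq[OF that] u(2)[OF that] v(2)[OF that]
      by (simp add: Hom_iff assoc[symmetric])
  qed (use u v X LO in \<open>auto intro: Comp_Hom Id_Hom\<close>)
  moreover have "u \<cdot> v = Id C M"
  proof (rule limit_unique[OF M])
    show "q \<beta> \<cdot> (u \<cdot> v) = q \<beta> \<cdot> Id C M" if "\<beta> \<in> J" for \<beta>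
      using u(1) v(1) pq[OF that] u(2)[OF that] v(2)[OF that]
      by (simp add: Hom_iff assoc[symmetric])
  qed (use u v X LO in \<open>auto intro: Comp_Hom Id_Hom\<close>)
  ultimately show ?thesis using that u v by blast
qed

text \<open>The universal property is carried along the isomorphism: a cone is mediated by some
  \<open>w\<close> into \<open>M\<close>, hence by \<open>v \<cdot> w\<close> into
  \<open>L\<close>.\<close>

lemma is_limit_iso:
  assumes M: "is_limit C J X t M q"
    and u: "u \<in> Hom C L M" and v: "v \<in> Hom C M L" and vu: "v \<cdot> u = Id C L" and uv: "u \<cdot> v = Id C M"
    and p: "\<And>\<beta>. \<beta> \<in> J \<Longrightarrow> q \<beta> \<cdot> u = p \<beta>"
    and X: "\<And>\<beta> \<gamma>. \<lbrakk>\<beta> \<in> J; \<gamma> \<in> J; \<beta> \<le> \<gamma>\<rbrakk> \<Longrightarrow> t \<beta> \<gamma> \<in> Hom C (X \<gamma>) (X \<beta>)"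
  shows "is_limit C J X t L p"
proof -
  have q: "q \<beta> \<in> Hom C M (X \<beta>)" if "\<beta> \<in> J" for \<beta>
    using M that by (auto simp: is_limit_def is_cone_def)
  have c: "t \<beta> \<gamma> \<cdot> q \<gamma> = q \<beta>" if "\<beta> \<in> J" "\<gamma> \<in> J" "\<beta> \<le> \<gamma>" for \<beta> \<gamma>
    using M that by (auto simp: is_limit_def is_cone_def)
  have "is_cone C J X t L p"
    unfolding is_cone_def
  proof (intro conjI ballI impI)
    show "L \<in> Obj C" using u by (rule Hom_Obj)
    show "p \<beta> \<in> Hom C L (X \<beta>)" if "\<beta> \<in> J" for \<beta>
      using Comp_Hom[OF u q[OF that]] p[OF that] by simp
    fix \<beta> \<gamma> assume bg: "\<beta> \<in> J" "\<gamma> \<in> J" "\<beta> \<le> \<gamma>"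
    have "t \<beta> \<gamma> \<cdot> (q \<gamma> \<cdot> u) = q \<beta> \<cdot> u"
      using X[OF bg] q[OF bg(2)] u by (subst c[OF bg, symmetric]) (simp add: Hom_iff assoc)
    then show "t \<beta> \<gamma> \<cdot> p \<gamma> = p \<beta>" using p bg by simp
  qed
  moreover have "\<exists>!w. w \<in> Hom C N L \<and> (\<forall>\<beta>\<in>J. p \<beta> \<cdot> w = r \<beta>)" if N: "is_cone C J X t N r" for N r
  proof -
    obtain w where w: "w \<in> Hom C N M" "\<And>\<beta>. \<beta> \<in> J \<Longrightarrow> q \<beta> \<cdot> w = r \<beta>"
      by (rule is_limit_factor[OF M N]) auto
    have "p \<beta> \<cdot> (v \<cdot> w) = r \<beta>" if "\<beta> \<in> J" for \<beta>
    proof -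
      have "p \<beta> \<cdot> (v \<cdot> w) = q \<beta> \<cdot> ((u \<cdot> v) \<cdot> w)"
        using u v w(1) q[OF that] by (subst p[OF that, symmetric]) (simp add: Hom_iff assoc)
      then show ?thesis using uv w that by (auto simp: Hom_iff)
    qed
    moreover have "v \<cdot> w \<in> Hom C N L" using w v by (auto intro: Comp_Hom)
    moreover have "a = v \<cdot> w" if a: "a \<in> Hom C N L" "\<forall>\<beta>\<in>J. p \<beta> \<cdot> a = r \<beta>" for a
    proof -
      have "u \<cdot> a = w"
      proof (rule limit_unique[OF M])
        show "q \<beta> \<cdot> (u \<cdot> a) = q \<beta> \<cdot> w" if "\<beta> \<in> J" for \<beta>
        proof -
          have "q \<beta> \<cdot> (u \<cdot> a) = (q \<beta> \<cdot> u) \<cdot> a"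
            using a(1) u q[OF that] by (simp add: Hom_iff assoc)
          then show ?thesis using a p w that by simp
        qed
      qed (use a u w X in \<open>auto intro: Comp_Hom\<close>)
      then have "(v \<cdot> u) \<cdot> a = v \<cdot> w" using a u v by (auto simp: Hom_iff assoc)
      then show ?thesis using vu a by (auto simp: Hom_iff)
    qed
    ultimately show ?thesis by blast
  qed
  ultimately show ?thesis by (simp add: is_limit_def)
qed

end

section \<open>Preadditive categories\<close>

context preadditive_category
begin

text \<open>The hom group in which the inverse is taken is recovered from the arrow itself, so that
  negation takes no objects as arguments.\<close>

definition neg :: "'b \<Rightarrow> 'b" where
  "neg f = inv\<^bsub>hom_group C (Dom C f) (Cod C f)\<^esub> f"

definition diff :: "'b \<Rightarrow> 'b \<Rightarrow> 'b"  (infixl \<open>\<boxminus>\<close> 65) where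
  "f \<boxminus> g = f \<boxplus> neg g"

lemma Zero_Hom: "\<lbrakk>X \<in> Obj C; Y \<in> Obj C\<rbrakk> \<Longrightarrow> Zero C X Y \<in> Hom C X Y"
  using hom_comm_group[of X Y] monoid.one_closed[of "hom_group C X Y"]
  by (simp add: hom_group_def comm_group_def comm_monoid_def group_def)

lemma Zero_simps [simp]:
  assumes "X \<in> Obj C" "Y \<in> Obj C"
  shows "Zero C X Y \<in> Arr C" "Dom C (Zero C X Y) = X" "Cod C (Zero C X Y) = Y"
  using Zero_Hom[OF assms] by (auto simp: Hom_iff)

lemma Add_Hom:
  assumes "f \<in> Hom C X Y" "g \<in> Hom C X Y"
  shows "f \<boxplus> g \<in> Hom C X Y"
proof -
  interpret comm_group "hom_group C X Y" using assms Hom_Obj hom_comm_group by blast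
  show ?thesis using m_closed assms by (simp add: hom_group_def)
qed

lemma Add_simps [simp]:
  assumes "f \<in> Arr C" "g \<in> Arr C" "Dom C f = Dom C g" "Cod C f = Cod C g"
  shows "f \<boxplus> g \<in> Arr C" "Dom C (f \<boxplus> g) = Dom C g" "Cod C (f \<boxplus> g) = Cod C g"
  using Add_Hom[of f "Dom C g" "Cod C g" g] assms by (auto simp: Hom_iff)

lemma neg_Hom:
  assumes "f \<in> Hom C X Y"
  shows "neg f \<in> Hom C X Y"
proof -
  interpret comm_group "hom_group C X Y" using assms Hom_Obj hom_comm_group by blast
  show ?thesis using inv_closed assms by (auto simp: hom_group_def neg_def Hom_iff)
qed

lemma neg_simps [simp]:
  assumes "f \<in> Arr C"
  shows "neg f \<in> Arr C" "Dom C (neg f) = Dom C f" "Cod C (neg f) = Cod C f"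
  using neg_Hom[of f "Dom C f" "Cod C f"] assms by (auto simp: Hom_iff)

lemma diff_Hom: "\<lbrakk>f \<in> Hom C X Y; g \<in> Hom C X Y\<rbrakk> \<Longrightarrow> f \<boxminus> g \<in> Hom C X Y"
  by (simp add: diff_def Add_Hom neg_Hom)

lemma diff_simps [simp]:
  assumes "f \<in> Arr C" "g \<in> Arr C" "Dom C f = Dom C g" "Cod C f = Cod C g"
  shows "f \<boxminus> g \<in> Arr C" "Dom C (f \<boxminus> g) = Dom C g" "Cod C (f \<boxminus> g) = Cod C g"
  using assms by (simp_all add: diff_def)

text \<open>The laws are read off from the commutative group on one hom set, with membership made
  explicit. \<open>Add_diff_Add\<close> is the cancellation behind the telescoping in
  \<open>completion_map_epic\<close>.\<close>

lemma Hom_group_laws: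
  assumes "f \<in> Hom C X Y" "g \<in> Hom C X Y"
  shows "Zero C X Y \<boxplus> f = f" "f \<boxplus> Zero C X Y = f" "f \<boxplus> g = g \<boxplus> f" "f \<boxminus> f = Zero C X Y"
    "f \<boxminus> g \<boxplus> g = f" "f \<boxplus> g = g \<longleftrightarrow> f = Zero C X Y" "f \<boxminus> g = Zero C X Y \<longleftrightarrow> f = g"
    "f \<boxminus> g = h \<longleftrightarrow> f = h \<boxplus> g \<and> h \<in> Hom C X Y"
  and Add_diff_Add: "h \<in> Hom C X Y \<Longrightarrow> (f \<boxplus> g) \<boxminus> (f \<boxplus> h) = g \<boxminus> h"
proof -
  interpret comm_group "hom_group C X Y" using assms Hom_Obj hom_comm_group by blast
  have eqs: "mult (hom_group C X Y) = Add C" "one (hom_group C X Y) = Zero C X Y"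
    "carrier (hom_group C X Y) = Hom C X Y"
    by (auto simp: hom_group_def)
  have ng: "m_inv (hom_group C X Y) k = neg k" if "k \<in> Hom C X Y" for k
    using that by (simp add: neg_def Hom_iff)
  note f = assms
  show "Zero C X Y \<boxplus> f = f" "f \<boxplus> Zero C X Y = f" "f \<boxplus> g = g \<boxplus> f" "f \<boxminus> f = Zero C X Y"
    using f l_one[of f] r_one[of f] m_comm[of f g] r_inv[of f] by (auto simp: eqs ng diff_def)
  show dg: "f \<boxminus> g \<boxplus> g = f"
    using f m_assoc[of f "neg g" g] l_inv[of g] r_one[of f] neg_Hom[of g X Y]
    by (auto simp: eqs ng diff_def)
  show "f \<boxplus> g = g \<longleftrightarrow> f = Zero C X Y"
    using f r_cancel_one[of g f] by (auto simp: eqs)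
  show z: "f \<boxminus> g = Zero C X Y \<longleftrightarrow> f = g"
    using f dg l_one[of g] r_inv[of g] by (auto simp: eqs ng diff_def)
  show "f \<boxminus> g = h \<longleftrightarrow> f = h \<boxplus> g \<and> h \<in> Hom C X Y"
    using f dg m_assoc[of h g "neg g"] r_inv[of g] r_one[of h] neg_Hom[of g X Y] diff_Hom[OF f]
    by (auto simp: eqs ng diff_def)
  show "(f \<boxplus> g) \<boxminus> (f \<boxplus> h) = g \<boxminus> h" if h: "h \<in> Hom C X Y"
  proof -
    have "(f \<boxplus> g) \<boxminus> (f \<boxplus> h) = g \<boxplus> f \<boxplus> (neg f \<boxplus> neg h)"
      using inv_mult[of f h] f h m_closed[of f h] m_comm[of f g] by (auto simp: eqs ng diff_def)
    also have "\<dots> = g \<boxplus> (f \<boxplus> neg f) \<boxplus> neg h"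
      using f h m_assoc m_closed neg_Hom unfolding eqs by presburger
    also have "\<dots> = g \<boxminus> h" using f h r_inv[of f] r_one[of g] by (auto simp: eqs ng diff_def)
    finally show ?thesis .
  qed
qed

text \<open>Composition is additive, so the composite added to itself is itself, which forces it to
  be zero.\<close>

lemma Zero_Comp:
  assumes "f \<in> Hom C X Y" "Z \<in> Obj C"
  shows "Zero C Y Z \<cdot> f = Zero C X Z"
proof -
  have Z: "Zero C Y Z \<in> Hom C Y Z" using assms Hom_Obj Zero_Hom by blast
  have H: "Zero C Y Z \<cdot> f \<in> Hom C X Z" using assms Z Comp_Hom by blast
  show ?thesis
    using Comp_Add_left[OF assms(1) Z Z] Hom_group_laws(1)[OF Z Z] Hom_group_laws(6)[OF H H] by simp
qed

lemma Comp_Zero: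
  assumes "f \<in> Hom C X Y" "W \<in> Obj C"
  shows "f \<cdot> Zero C W X = Zero C W Y"
proof -
  have Z: "Zero C W X \<in> Hom C W X" using assms Hom_Obj Zero_Hom by blast
  have H: "f \<cdot> Zero C W X \<in> Hom C W Y" using assms Z Comp_Hom by blast
  show ?thesis
    using Comp_Add_right[OF Z Z assms(1)] Hom_group_laws(1)[OF Z Z] Hom_group_laws(6)[OF H H] by simp
qed

lemma Zero_Comp_simp [simp]: "\<lbrakk>f \<in> Arr C; Cod C f = Y; Z \<in> Obj C\<rbrakk> \<Longrightarrow> Zero C Y Z \<cdot> f = Zero C (Dom C f) Z"
  by (rule Zero_Comp) (auto simp: Hom_iff)

lemma Comp_Zero_simp [simp]: "\<lbrakk>f \<in> Arr C; Dom C f = X; W \<in> Obj C\<rbrakk> \<Longrightarrow> f \<cdot> Zero C W X = Zero C W (Cod C f)"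
  by (rule Comp_Zero) (auto simp: Hom_iff)

lemma diff_Comp:
  assumes "f \<in> Hom C X Y" "g \<in> Hom C Y Z" "h \<in> Hom C Y Z"
  shows "(g \<boxminus> h) \<cdot> f = g \<cdot> f \<boxminus> h \<cdot> f"
proof -
  have H: "g \<cdot> f \<in> Hom C X Z" "h \<cdot> f \<in> Hom C X Z" "(g \<boxminus> h) \<cdot> f \<in> Hom C X Z"
    using assms diff_Hom Comp_Hom by blast+
  have "g \<cdot> f = (g \<boxminus> h) \<cdot> f \<boxplus> h \<cdot> f"
    using Comp_Add_left[OF assms(1) diff_Hom[OF assms(2,3)] assms(3)]
      Hom_group_laws(5)[OF assms(2,3)] by simp
  then show ?thesis using Hom_group_laws(8)[OF H(1,2)] H(3) by metis
qed

lemma Comp_diff: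
  assumes "f \<in> Hom C X Y" "g \<in> Hom C X Y" "h \<in> Hom C Y Z"
  shows "h \<cdot> (f \<boxminus> g) = h \<cdot> f \<boxminus> h \<cdot> g"
proof -
  have H: "h \<cdot> f \<in> Hom C X Z" "h \<cdot> g \<in> Hom C X Z" "h \<cdot> (f \<boxminus> g) \<in> Hom C X Z"
    using assms diff_Hom Comp_Hom by blast+
  have "h \<cdot> f = h \<cdot> (f \<boxminus> g) \<boxplus> h \<cdot> g"
    using Comp_Add_right[OF diff_Hom[OF assms(1,2)] assms(2,3)]
      Hom_group_laws(5)[OF assms(1,2)] by simp
  then show ?thesis using Hom_group_laws(8)[OF H(1,2)] H(3) by metis
qed

text \<open>Applied to the difference of two arrows, the test against zero becomes
  cancellation.\<close>

lemma monicI: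
  assumes "f \<in> Arr C"
    and "\<And>W g. \<lbrakk>g \<in> Hom C W (Dom C f); f \<cdot> g = Zero C W (Cod C f)\<rbrakk> \<Longrightarrow> g = Zero C W (Dom C f)"
  shows "monic C f"
  unfolding monic_def
proof (intro conjI allI ballI impI)
  fix W g h assume g: "g \<in> Hom C W (Dom C f)" and h: "h \<in> Hom C W (Dom C f)" and eq: "f \<cdot> g = f \<cdot> h"
  have f: "f \<in> Hom C (Dom C f) (Cod C f)" using assms(1) by (simp add: Hom_iff)
  have "f \<cdot> (g \<boxminus> h) = Zero C W (Cod C f)"
    using Comp_diff[OF g h f] Hom_group_laws(4)[OF Comp_Hom[OF h f] Comp_Hom[OF h f]] eq by simp
  then have "g \<boxminus> h = Zero C W (Dom C f)" using assms(2) diff_Hom g h by blast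
  then show "g = h" using Hom_group_laws(7)[OF g h] by simp
qed fact

lemma epicI:
  assumes "f \<in> Arr C"
    and "\<And>Z g. \<lbrakk>g \<in> Hom C (Cod C f) Z; g \<cdot> f = Zero C (Dom C f) Z\<rbrakk> \<Longrightarrow> g = Zero C (Cod C f) Z"
  shows "epic C f"
  unfolding epic_def
proof (intro conjI allI ballI impI)
  fix Z g h assume g: "g \<in> Hom C (Cod C f) Z" and h: "h \<in> Hom C (Cod C f) Z" and eq: "g \<cdot> f = h \<cdot> f"
  have f: "f \<in> Hom C (Dom C f) (Cod C f)" using assms(1) by (simp add: Hom_iff)
  have "(g \<boxminus> h) \<cdot> f = Zero C (Dom C f) Z"
    using diff_Comp[OF f g h] Hom_group_laws(4)[OF Comp_Hom[OF f h] Comp_Hom[OF f h]] eq by simp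
  then have "g \<boxminus> h = Zero C (Cod C f) Z" using assms(2) diff_Hom g h by blast
  then show "g = h" using Hom_group_laws(7)[OF g h] by simp
qed fact

lemma epic_Zero:
  assumes "epic C f" "g \<in> Hom C (Cod C f) Z" "g \<cdot> f = Zero C (Dom C f) Z"
  shows "g = Zero C (Cod C f) Z"
proof (rule epicD[OF assms(1,2)])
  have f: "f \<in> Arr C" using assms(1) by (simp add: epic_def)
  show "Zero C (Cod C f) Z \<in> Hom C (Cod C f) Z" using assms(2) Zero_Hom Hom_Obj by blast
  show "g \<cdot> f = Zero C (Cod C f) Z \<cdot> f" using f assms by (auto simp: Hom_iff)
qed

section \<open>Kernels and cokernels\<close>

text \<open>An arrow that kills \<open>q\<close> and the zero arrow both factor the zero arrow over
  \<open>q\<close>, hence they agree.\<close>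

lemma is_cokernel_epic:
  assumes "is_cokernel C f q"
  shows "epic C q"
proof (rule epicI)
  show q: "q \<in> Arr C" using assms by (simp add: is_cokernel_def Hom_iff)
  have f: "f \<in> Arr C" "Dom C q = Cod C f" using assms by (auto simp: is_cokernel_def Hom_iff)
  fix Z g assume g: "g \<in> Hom C (Cod C q) Z" and gq: "g \<cdot> q = Zero C (Dom C q) Z"
  have Z: "Z \<in> Obj C" using g by (rule Hom_Obj)
  have "\<exists>!u. u \<in> Hom C (Cod C q) Z \<and> u \<cdot> q = Zero C (Cod C f) Z"
    using assms Z f unfolding is_cokernel_def by (metis Cod_Obj Zero_Hom Zero_Comp_simp)
  moreover have "Zero C (Cod C q) Z \<in> Hom C (Cod C q) Z" "Zero C (Cod C q) Z \<cdot> q = Zero C (Cod C f) Z"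
    using q f Z by (auto simp: Hom_iff)
  ultimately show "g = Zero C (Cod C q) Z" using g gq f by metis
qed

lemma is_kernel_monic:
  assumes "is_kernel C f k"
  shows "monic C k"
proof (rule monicI)
  show k: "k \<in> Arr C" using assms by (simp add: is_kernel_def Hom_iff)
  have f: "f \<in> Arr C" "Cod C k = Dom C f" using assms by (auto simp: is_kernel_def Hom_iff)
  fix W g assume g: "g \<in> Hom C W (Dom C k)" and kg: "k \<cdot> g = Zero C W (Cod C k)"
  have W: "W \<in> Obj C" using g by (rule Hom_Obj)
  have "Zero C W (Dom C f) \<in> Hom C W (Dom C f)" "f \<cdot> Zero C W (Dom C f) = Zero C W (Cod C f)"
    using W f by (auto simp: Hom_iff)
  then have "\<exists>!u. u \<in> Hom C W (Dom C k) \<and> k \<cdot> u = Zero C W (Dom C f)"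
    using assms unfolding is_kernel_def by blast
  moreover have "Zero C W (Dom C k) \<in> Hom C W (Dom C k)" "k \<cdot> Zero C W (Dom C k) = Zero C W (Dom C f)"
    using k f W by (auto simp: Hom_iff)
  ultimately show "g = Zero C W (Dom C k)" using g kg f by metis
qed

lemma is_kernel_factor:
  assumes "is_kernel C f k" "g \<in> Hom C W (Dom C f)" "f \<cdot> g = Zero C W (Cod C f)"
  obtains u where "u \<in> Hom C W (Dom C k)" "k \<cdot> u = g"
  using assms unfolding is_kernel_def by blast

lemma is_cokernel_factor:
  assumes "is_cokernel C f q" "g \<in> Hom C (Cod C f) Z" "g \<cdot> f = Zero C (Dom C f) Z"
  obtains u where "u \<in> Hom C (Cod C q) Z" "u \<cdot> q = g"
  using assms unfolding is_cokernel_def by blast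

end

section \<open>Abelian categories\<close>

context abelian_category
begin

text \<open>By normality \<open>q\<close> is the cokernel of some \<open>h\<close>, and
  \<open>h\<close> factors through the kernel \<open>k\<close> of \<open>q\<close>. An arrow that
  kills \<open>k\<close> therefore kills \<open>h\<close> and factors over \<open>q\<close>.\<close>

lemma epic_cokernel_of_kernel:
  assumes "epic C q" "is_kernel C q k"
  shows "is_cokernel C k q"
proof -
  have q: "q \<in> Arr C" and k: "k \<in> Arr C" "Cod C k = Dom C q" "q \<cdot> k = Zero C (Dom C k) (Cod C q)"
    using assms by (auto simp: epic_def is_kernel_def Hom_iff)
  obtain h where h: "is_cokernel C h q" using epi_normal assms(1) by blast
  have hA: "h \<in> Arr C" "Cod C h = Dom C q" "q \<cdot> h = Zero C (Dom C h) (Cod C q)"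
    using h by (auto simp: is_cokernel_def Hom_iff)
  obtain w where w: "w \<in> Hom C (Dom C h) (Dom C k)" "k \<cdot> w = h"
    using is_kernel_factor[OF assms(2), of h "Dom C h"] hA by (auto simp: Hom_iff)
  show ?thesis unfolding is_cokernel_def
  proof (intro conjI allI ballI impI)
    fix Z g assume g: "g \<in> Hom C (Cod C k) Z" and gk: "g \<cdot> k = Zero C (Dom C k) Z"
    have "g \<cdot> h = (g \<cdot> k) \<cdot> w" using g w k by (auto simp: Hom_iff assoc)
    also have "\<dots> = Zero C (Dom C h) Z" using gk w g by (auto simp: Hom_iff)
    finally obtain u where u: "u \<in> Hom C (Cod C q) Z" "u \<cdot> q = g"
      using is_cokernel_factor[OF h, of g Z] g hA k by auto
    then show "\<exists>!u. u \<in> Hom C (Cod C q) Z \<and> u \<cdot> q = g"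
      using epicD[OF assms(1)] by metis
  qed (use q k in \<open>auto simp: Hom_iff\<close>)
qed

lemma monic_kernel_of_cokernel:
  assumes "monic C k" "is_cokernel C k q"
  shows "is_kernel C q k"
proof -
  have q: "q \<in> Arr C" and k: "k \<in> Arr C" "Cod C k = Dom C q" "q \<cdot> k = Zero C (Dom C k) (Cod C q)"
    using assms by (auto simp: is_cokernel_def Hom_iff)
  obtain h where h: "is_kernel C h k" using mono_normal assms(1) by blast
  have hA: "h \<in> Arr C" "Dom C h = Dom C q" "h \<cdot> k = Zero C (Dom C k) (Cod C h)"
    using h k by (auto simp: is_kernel_def Hom_iff)
  obtain w where w: "w \<in> Hom C (Cod C q) (Cod C h)" "w \<cdot> q = h"
    using is_cokernel_factor[OF assms(2), of h "Cod C h"] hA k by (auto simp: Hom_iff)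
  show ?thesis unfolding is_kernel_def
  proof (intro conjI allI ballI impI)
    fix W g assume g: "g \<in> Hom C W (Dom C q)" and qg: "q \<cdot> g = Zero C W (Cod C q)"
    have "h \<cdot> g = w \<cdot> (q \<cdot> g)" using g w q by (auto simp: Hom_iff assoc)
    also have "\<dots> = Zero C W (Cod C h)" using qg w g by (auto simp: Hom_iff)
    finally obtain u where u: "u \<in> Hom C W (Dom C k)" "k \<cdot> u = g"
      using is_kernel_factor[OF h, of g W] g hA k by auto
    then show "\<exists>!u. u \<in> Hom C W (Dom C k) \<and> k \<cdot> u = g"
      using monicD[OF assms(1)] by metis
  qed (use q k in \<open>auto simp: Hom_iff\<close>)
qed

section \<open>Lifting along epimorphisms after passing to a cover\<close>

text \<open>The pullback is the kernel of \<open>f \<cdot> p \<boxminus> g \<cdot> q\<close> on the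
  biproduct of \<open>X\<close> and \<open>Y\<close>. The lemma takes the place of choosing
  preimages of elements: an arrow into \<open>Z\<close> lifts along \<open>f\<close> once its domain
  is replaced by a cover.\<close>

lemma epic_pullback:
  assumes f: "epic C f" "f \<in> Hom C X Z" and g: "g \<in> Hom C Y Z"
  obtains W e a where "epic C e" "e \<in> Hom C W Y" "a \<in> Hom C W X" "f \<cdot> a = g \<cdot> e"
proof -
  have XY: "X \<in> Obj C" "Y \<in> Obj C" using f g Hom_Obj by blast+
  obtain B i j p q where B: "B \<in> Obj C" "i \<in> Hom C X B" "j \<in> Hom C Y B" "p \<in> Hom C B X" "q \<in> Hom C B Y"
    and pi: "p \<cdot> i = Id C X" and qj: "q \<cdot> j = Id C Y" and qi: "q \<cdot> i = Zero C X Y" and pj: "p \<cdot> j = Zero C Y X"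
    using ex_biproduct[OF XY] unfolding has_biproduct_def by blast
  note H = f(2) g B XY
  define d where "d = f \<cdot> p \<boxminus> g \<cdot> q"
  have fp: "f \<cdot> p \<in> Hom C B Z" and gq: "g \<cdot> q \<in> Hom C B Z" using H Comp_Hom by blast+
  have d: "d \<in> Hom C B Z" unfolding d_def by (rule diff_Hom[OF fp gq])
  have di: "d \<cdot> i = f"
  proof -
    have "d \<cdot> i = (f \<cdot> p) \<cdot> i \<boxminus> (g \<cdot> q) \<cdot> i" unfolding d_def by (rule diff_Comp[OF B(2) fp gq])
    also have "(f \<cdot> p) \<cdot> i = f" using H pi by (auto simp: Hom_iff assoc)
    also have "(g \<cdot> q) \<cdot> i = Zero C X Z" using H qi by (auto simp: Hom_iff assoc)
    also have "f \<boxminus> Zero C X Z = f"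
      using Hom_group_laws(2)[OF f(2) f(2)] Hom_group_laws(8)[OF f(2) Zero_Hom] f H Hom_Obj by metis
    finally show ?thesis .
  qed
  \<comment> \<open>On the summand \<open>X\<close> the map \<open>d\<close> is the epimorphism
    \<open>f\<close>. Being epic, \<open>d\<close> is the cokernel of its kernel \<open>k\<close>,
    which yields \<open>v\<close> below.\<close>
  have d_epic: "epic C d"
    using epic_of_Comp[of d i] di f d B by (auto simp: Hom_iff)
  obtain k where k: "is_kernel C d k" using ex_kernel d by (auto simp: Hom_iff)
  have kA: "k \<in> Hom C (Dom C k) B" and dk: "d \<cdot> k = Zero C (Dom C k) Z"
    using k d by (auto simp: is_kernel_def Hom_iff)
  have W: "Dom C k \<in> Obj C" using kA by (auto simp: Hom_iff)
  have pk: "p \<cdot> k \<in> Hom C (Dom C k) X" and qk: "q \<cdot> k \<in> Hom C (Dom C k) Y"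
    using kA B Comp_Hom by blast+
  have "epic C (q \<cdot> k)"
  proof (rule epicI)
    show "q \<cdot> k \<in> Arr C" using qk by (simp add: Hom_iff)
    fix T u assume "u \<in> Hom C (Cod C (q \<cdot> k)) T" "u \<cdot> (q \<cdot> k) = Zero C (Dom C (q \<cdot> k)) T"
    then have u: "u \<in> Hom C Y T" and z: "u \<cdot> (q \<cdot> k) = Zero C (Dom C k) T"
      using qk by (auto simp: Hom_iff)
    have T: "T \<in> Obj C" using u by (rule Hom_Obj)
    have "(u \<cdot> q) \<cdot> k = Zero C (Dom C k) T" using z u B kA by (auto simp: Hom_iff assoc)
    then obtain v where v: "v \<in> Hom C Z T" "v \<cdot> d = u \<cdot> q"
      using is_cokernel_factor[OF epic_cokernel_of_kernel[OF d_epic k], of "u \<cdot> q" T] u kA d B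
      by (auto simp: Hom_iff)
    \<comment> \<open>The arrow \<open>u \<cdot> q\<close> vanishes on the summand \<open>X\<close>,
      so \<open>v \<cdot> f\<close> is zero, and \<open>v\<close> is zero since \<open>f\<close> is
      epic. On the summand \<open>Y\<close> the arrow \<open>u \<cdot> q\<close> is \<open>u\<close>
      itself.\<close>
    have "v \<cdot> f = (v \<cdot> d) \<cdot> i" using v(1) d B by (subst di[symmetric]) (auto simp: Hom_iff assoc)
    also have "\<dots> = u \<cdot> (q \<cdot> i)" using v(2) u B by (auto simp: Hom_iff assoc)
    also have "\<dots> = Zero C X T" using u XY by (auto simp: qi Hom_iff)
    finally have "v = Zero C Z T"
      using epic_Zero[OF f(1), of v T] f v by (auto simp: Hom_iff)
    then have uq: "u \<cdot> q = Zero C B T" using v(2) d T by (auto simp: Hom_iff)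
    have "u = u \<cdot> (q \<cdot> j)" using u by (auto simp: qj Hom_iff)
    also have "\<dots> = (u \<cdot> q) \<cdot> j" using u B by (auto simp: Hom_iff assoc)
    also have "\<dots> = Zero C Y T" using uq B T by (auto simp: Hom_iff)
    finally show "u = Zero C (Cod C (q \<cdot> k)) T" using qk by (auto simp: Hom_iff)
  qed
  moreover have "f \<cdot> (p \<cdot> k) = g \<cdot> (q \<cdot> k)"
  proof -
    have "f \<cdot> p \<cdot> k \<boxminus> g \<cdot> q \<cdot> k = Zero C (Dom C k) Z"
      using dk diff_Comp[OF kA fp gq] by (simp add: d_def)
    then have "f \<cdot> p \<cdot> k = g \<cdot> q \<cdot> k"
      using Hom_group_laws(7)[OF Comp_Hom[OF kA fp] Comp_Hom[OF kA gq]] by simp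
    then show ?thesis using H kA by (auto simp: Hom_iff assoc)
  qed
  ultimately show ?thesis using that pk qk by blast
qed

section \<open>Images\<close>

lemma im_is_image:
  assumes "f \<in> Arr C"
  shows "is_image C f (im C f)"
proof -
  obtain q where q: "is_cokernel C f q" using ex_cokernel assms by blast
  then obtain m where "is_kernel C q m"
    using ex_kernel[of q] by (auto simp: is_cokernel_def Hom_iff)
  then show ?thesis using q unfolding im_def is_image_def by (metis (mono_tags, lifting) someI_ex)
qed

text \<open>The first factor is epic because no smaller subobject admits \<open>f\<close>: if
  \<open>u\<close> kills \<open>e\<close>, then \<open>f\<close> already factors through the kernel
  of \<open>u\<close>, which must be all of the image.\<close>

lemma im_factorization:
  assumes "f \<in> Hom C X Y"
  obtains e where "monic C (im C f)" "im C f \<in> Hom C (Dom C (im C f)) Y"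
    "e \<in> Hom C X (Dom C (im C f))" "epic C e" "im C f \<cdot> e = f"
proof -
  define m where "m = im C f"
  have f: "f \<in> Arr C" "Dom C f = X" "Cod C f = Y" using assms by (auto simp: Hom_iff)
  obtain q where q: "is_cokernel C f q" "is_kernel C q m"
    using im_is_image[OF f(1)] by (auto simp: is_image_def m_def)
  have qA: "q \<in> Arr C" "Dom C q = Y" "q \<cdot> f = Zero C X (Cod C q)"
    using q f by (auto simp: is_cokernel_def Hom_iff)
  have mA: "m \<in> Arr C" "Cod C m = Y" "q \<cdot> m = Zero C (Dom C m) (Cod C q)"
    using q(2) qA by (auto simp: is_kernel_def Hom_iff)
  have mm: "monic C m" using q(2) by (rule is_kernel_monic)
  obtain e where e: "e \<in> Hom C X (Dom C m)" "m \<cdot> e = f"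
    using is_kernel_factor[OF q(2), of f X] assms qA by auto
  have "epic C e"
  proof (rule epicI)
    show "e \<in> Arr C" using e by (simp add: Hom_iff)
    fix Z u assume u: "u \<in> Hom C (Cod C e) Z" and ue: "u \<cdot> e = Zero C (Dom C e) Z"
    have uA: "u \<in> Arr C" "Dom C u = Dom C m" "Cod C u = Z" using u e by (auto simp: Hom_iff)
    obtain k where k: "is_kernel C u k" using ex_kernel uA by blast
    have kA: "k \<in> Arr C" "Cod C k = Dom C m" "u \<cdot> k = Zero C (Dom C k) Z"
      using k uA by (auto simp: is_kernel_def Hom_iff)
    have mk: "monic C (m \<cdot> k)" using monic_Comp[OF is_kernel_monic[OF k] mm] kA by simp
    have mkA: "m \<cdot> k \<in> Arr C" "Dom C (m \<cdot> k) = Dom C k" "Cod C (m \<cdot> k) = Y" using mA kA by auto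
    obtain e' where e': "e' \<in> Hom C X (Dom C k)" "k \<cdot> e' = e"
      using is_kernel_factor[OF k, of e X] e ue uA by (auto simp: Hom_iff)
    \<comment> \<open>Being monic, \<open>m \<cdot> k\<close> is the kernel of its cokernel
      \<open>c\<close>. Now \<open>c\<close> kills \<open>f\<close>, so it factors over
      \<open>q\<close> and kills \<open>m\<close>; this factors \<open>m\<close> through
      \<open>m \<cdot> k\<close>.\<close>
    obtain c where c: "is_cokernel C (m \<cdot> k) c" using ex_cokernel mkA by blast
    have cA: "c \<in> Arr C" "Dom C c = Y" "c \<cdot> (m \<cdot> k) = Zero C (Dom C k) (Cod C c)"
      using c mkA by (auto simp: is_cokernel_def Hom_iff)
    have "c \<cdot> f = (c \<cdot> (m \<cdot> k)) \<cdot> e'"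
      using e e' cA(1,2) mA(1,2) kA(1,2) by (auto simp: Hom_iff assoc)
    also have "\<dots> = Zero C X (Cod C c)" using cA e' by (auto simp: Hom_iff)
    finally obtain c' where c': "c' \<in> Hom C (Cod C q) (Cod C c)" "c' \<cdot> q = c"
      using is_cokernel_factor[OF q(1), of c "Cod C c"] cA f by (auto simp: Hom_iff)
    have "c \<cdot> m = c' \<cdot> (q \<cdot> m)" using c' qA mA(1,2) by (auto simp: Hom_iff assoc)
    also have "\<dots> = Zero C (Dom C m) (Cod C c)" using mA c' by (auto simp: Hom_iff)
    finally obtain v where v: "v \<in> Hom C (Dom C m) (Dom C k)" "m \<cdot> k \<cdot> v = m"
      using is_kernel_factor[OF monic_kernel_of_cokernel[OF mk c], of m "Dom C m"] mA cA mkA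
      by (auto simp: Hom_iff)
    \<comment> \<open>Thus \<open>k\<close> has a right inverse, and \<open>u\<close>, which kills
      \<open>k\<close>, is zero.\<close>
    have "k \<cdot> v = Id C (Dom C m)"
    proof (rule monicD[OF mm])
      show "m \<cdot> (k \<cdot> v) = m \<cdot> Id C (Dom C m)" using v mA kA by (auto simp: Hom_iff assoc)
    qed (use v mA kA in \<open>auto simp: Hom_iff\<close>)
    then have "u = u \<cdot> (k \<cdot> v)" using uA by simp
    also have "\<dots> = (u \<cdot> k) \<cdot> v" using uA kA(1,2) v by (auto simp: Hom_iff assoc)
    also have "\<dots> = Zero C (Dom C m) Z" using kA(3) v uA by (auto simp: Hom_iff)
    finally show "u = Zero C (Cod C e) Z" using e by (simp add: Hom_iff)
  qed
  then show ?thesis using that e mm mA by (auto simp: Hom_iff m_def)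
qed

text \<open>Every arrow that kills \<open>d\<close> factors over the zero object.\<close>

lemma zero_cokernel_epic:
  assumes "is_cokernel C d q" "zero_object C (Cod C q)"
  shows "epic C d"
proof (rule epicI)
  show d: "d \<in> Arr C" using assms by (simp add: is_cokernel_def)
  fix Z g assume g: "g \<in> Hom C (Cod C d) Z" and gd: "g \<cdot> d = Zero C (Dom C d) Z"
  obtain u where u: "u \<in> Hom C (Cod C q) Z" "u \<cdot> q = g" using is_cokernel_factor[OF assms(1) g gd] .
  have "Z \<in> Obj C" using g by (rule Hom_Obj)
  moreover have "Zero C (Cod C q) Z \<in> Hom C (Cod C q) Z"
    using u Hom_Obj Zero_Hom by blast
  ultimately have "u = Zero C (Cod C q) Z" using assms(2) u unfolding zero_object_def by blast
  then show "g = Zero C (Cod C d) Z" using u assms(1) \<open>Z \<in> Obj C\<close> by (auto simp: is_cokernel_def Hom_iff)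
qed

end

section \<open>Products and limits\<close>

lemma small_lepoll: "\<lbrakk>A \<lesssim> B; small U B\<rbrakk> \<Longrightarrow> small U A"
  unfolding small_def by (rule lesspoll_trans1)

text \<open>Products are postulated over index sets inside \<open>'u\<close>; an embedded copy of
  the natural numbers gives access to countable ones.\<close>

lemma grothendieck_universe_nat:
  assumes "grothendieck_universe (U :: 'u itself)"
  obtains \<phi> :: "nat \<Rightarrow> 'u" where "inj \<phi>" "small U (range \<phi>)"
proof -
  have nat: "small U (UNIV :: nat set)"
    using assms by (simp add: grothendieck_universe_def)
  then obtain \<phi> :: "nat \<Rightarrow> 'u" where \<phi>: "inj \<phi>"
    by (auto simp: small_def lesspoll_def lepoll_def)
  have "small U (range \<phi>)"
    by (rule small_lepoll[OF image_lepoll nat])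
  then show ?thesis using that \<phi> by blast
qed

text \<open>This serves the comparable pairs that index the relations of a limit. An infinite set is
  equipotent with its square; the square of a finite set is finite, hence small because
  \<open>'u\<close> is infinite.\<close>

lemma small_Times:
  assumes "grothendieck_universe (U :: 'u itself)" "small U J"
  shows "small U (J \<times> J)"
proof (cases "finite J")
  case True
  obtain \<phi> :: "nat \<Rightarrow> 'u" where "inj \<phi>" using grothendieck_universe_nat[OF assms(1)] .
  then have "infinite (UNIV :: 'u set)" using infinite_super[of "range \<phi>"] range_inj_infinite by blast
  then show ?thesis using True unfolding small_def by (intro finite_lesspoll_infinite) auto
next
  case False
  then obtain h where "bij_betw h (J \<times> J) J"
    using card_of_Times_same_infinite[OF False] card_of_ordIso by blast
  then have "J \<times> J \<lesssim> J" by (auto simp: lepoll_def bij_betw_def)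
  then show ?thesis using assms(2) by (rule small_lepoll)
qed

context category
begin

lemma is_product_cong:
  assumes "\<And>i. i \<in> I \<Longrightarrow> X i = Y i"
  shows "is_product C I X P p \<longleftrightarrow> is_product C I Y P p"
  using assms by (simp add: is_product_def)

lemma product_factor:
  assumes "is_product C I X P p" "W \<in> Obj C" "\<And>i. i \<in> I \<Longrightarrow> f i \<in> Hom C W (X i)"
  obtains u where "u \<in> Hom C W P" "\<And>i. i \<in> I \<Longrightarrow> p i \<cdot> u = f i"
proof -
  have "\<exists>!u. u \<in> Hom C W P \<and> (\<forall>i\<in>I. p i \<cdot> u = f i)"
    using assms by (simp add: is_product_def)
  then show ?thesis using that by blast
qed

lemma product_unique:
  assumes "is_product C I X P p" "u \<in> Hom C W P" "v \<in> Hom C W P"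
    and "\<And>i. i \<in> I \<Longrightarrow> p i \<cdot> u = p i \<cdot> v"
  shows "u = v"
proof -
  have "\<forall>i\<in>I. p i \<cdot> u \<in> Hom C W (X i)" and W: "W \<in> Obj C"
    using assms(1,2) by (auto simp: is_product_def Hom_iff)
  then have "\<exists>!w. w \<in> Hom C W P \<and> (\<forall>i\<in>I. p i \<cdot> w = p i \<cdot> u)"
    using assms(1) by (simp add: is_product_def)
  then show ?thesis using assms by metis
qed

text \<open>Brings a product over a copy of \<open>I\<close> inside \<open>'u\<close> back to the
  index set \<open>I\<close>.\<close>

lemma product_reindex:
  assumes "inj_on \<phi> I" "is_product C (\<phi> ` I) (\<lambda>k. X (inv_into I \<phi> k)) P p"
  shows "is_product C I X P (\<lambda>i. p (\<phi> i))"
  unfolding is_product_def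
proof (intro conjI ballI allI impI)
  show "P \<in> Obj C" using assms(2) by (simp add: is_product_def)
  show "p (\<phi> i) \<in> Hom C P (X i)" if "i \<in> I" for i
    using assms that by (auto simp: is_product_def)
  fix W f assume W: "W \<in> Obj C" and f: "\<forall>i\<in>I. f i \<in> Hom C W (X i)"
  have "\<forall>k\<in>\<phi> ` I. f (inv_into I \<phi> k) \<in> Hom C W (X (inv_into I \<phi> k))"
    using f by (auto intro: inv_into_into)
  then have "\<exists>!u. u \<in> Hom C W P \<and> (\<forall>k\<in>\<phi> ` I. p k \<cdot> u = f (inv_into I \<phi> k))"
    using assms(2) W unfolding is_product_def
    by (elim conjE) (drule bspec[OF _ W], drule spec[of _ "\<lambda>k. f (inv_into I \<phi> k)"], rule mp)
  then show "\<exists>!u. u \<in> Hom C W P \<and> (\<forall>i\<in>I. p (\<phi> i) \<cdot> u = f i)"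
    using assms(1) by simp
qed

lemma ex_small_product:
  assumes "has_small_products (U :: 'u itself) C" "small U I" "\<And>i. i \<in> I \<Longrightarrow> X i \<in> Obj C"
  obtains P p where "is_product C I X P p"
proof -
  obtain \<phi> :: "_ \<Rightarrow> 'u" where \<phi>: "inj_on \<phi> I"
    using assms(2) by (auto simp: small_def lesspoll_def lepoll_def)
  have "small U (\<phi> ` I)"
    by (rule small_lepoll[OF image_lepoll assms(2)])
  moreover have "\<forall>k\<in>\<phi> ` I. X (inv_into I \<phi> k) \<in> Obj C"
    using assms(3) \<phi> by auto
  ultimately obtain P p where "is_product C (\<phi> ` I) (\<lambda>k. X (inv_into I \<phi> k)) P p"
    using assms(1)[unfolded has_small_products_def, rule_format, of "\<phi> ` I" "\<lambda>k. X (inv_into I \<phi> k)"]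
    by auto
  then show ?thesis using that product_reindex[OF \<phi>] by blast
qed

end

context abelian_category
begin

section \<open>Exact products and common covers\<close>

text \<open>Each epimorphism is the cokernel of its kernel, so the family extends to short exact
  sequences, and exactness of products makes the product map a cokernel.\<close>

lemma product_of_epics:
  fixes I :: "'u set"
  assumes U: "has_exact_small_products (U :: 'u itself) C" "small U I"
    and e: "\<And>i. i \<in> I \<Longrightarrow> epic C (e i)"
    and P: "is_product C I (\<lambda>i. Dom C (e i)) P p" and Q: "is_product C I (\<lambda>i. Cod C (e i)) Q q"
    and v: "v \<in> Hom C P Q" "\<And>i. i \<in> I \<Longrightarrow> q i \<cdot> v = e i \<cdot> p i"
  shows "epic C v"
proof -
  have eA: "e i \<in> Arr C" if "i \<in> I" for i using e[OF that] by (simp add: epic_def)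
  then have "\<forall>i\<in>I. \<exists>k. is_kernel C (e i) k" using ex_kernel by blast
  then obtain k where k: "\<And>i. i \<in> I \<Longrightarrow> is_kernel C (e i) (k i)" by metis
  have kA: "k i \<in> Arr C" "Cod C (k i) = Dom C (e i)" if "i \<in> I" for i
    using k[OF that] by (auto simp: is_kernel_def Hom_iff)
  have se: "\<forall>i\<in>I. short_exact C (k i) (e i)"
    using k e epic_cokernel_of_kernel by (auto simp: short_exact_def)
  obtain R r where R: "is_product C I (\<lambda>i. Dom C (k i)) R r"
    using ex_small_product[of U I "\<lambda>i. Dom C (k i)"] U kA
    by (auto simp: has_exact_small_products_def)
  have rA: "R \<in> Obj C" "\<And>i. i \<in> I \<Longrightarrow> r i \<in> Hom C R (Dom C (k i))" using R by (auto simp: is_product_def)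
  have P': "is_product C I (\<lambda>i. Cod C (k i)) P p"
    using P by (subst is_product_cong[of I _ "\<lambda>i. Dom C (e i)"]) (auto simp: kA)
  obtain u where u: "u \<in> Hom C R P" "\<And>i. i \<in> I \<Longrightarrow> p i \<cdot> u = k i \<cdot> r i"
    using product_factor[OF P' rA(1), of "\<lambda>i. k i \<cdot> r i"] rA(2) kA by (auto simp: Hom_iff)
  have "short_exact C u v"
    using U se R P' Q u v unfolding has_exact_small_products_def small_products_exact_def by blast
  then show ?thesis using is_cokernel_epic by (auto simp: short_exact_def)
qed

text \<open>The product of all \<open>e i\<close> is epic and is pulled back along the diagonal of
  \<open>W\<close>. In this way infinitely many lifts, each made over its own cover, can be carried
  to a single one.\<close>

lemma ex_common_cover:
  fixes I :: "'u set"
  assumes U: "has_exact_small_products (U :: 'u itself) C" "small U I" and W: "W \<in> Obj C"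
    and e: "\<And>i. i \<in> I \<Longrightarrow> epic C (e i) \<and> Cod C (e i) = W"
  obtains V d a where "epic C d" "d \<in> Hom C V W"
    "\<And>i. i \<in> I \<Longrightarrow> a i \<in> Hom C V (Dom C (e i))" "\<And>i. i \<in> I \<Longrightarrow> e i \<cdot> a i = d"
proof -
  have eA: "e i \<in> Arr C" "Cod C (e i) = W" if "i \<in> I" for i using e[OF that] by (auto simp: epic_def)
  have prods: "has_small_products U C" using U by (simp add: has_exact_small_products_def)
  obtain P p where P: "is_product C I (\<lambda>i. Dom C (e i)) P p"
    using ex_small_product[OF prods U(2), of "\<lambda>i. Dom C (e i)"] eA by auto
  obtain Q q where Q: "is_product C I (\<lambda>i. Cod C (e i)) Q q"
    using ex_small_product[OF prods U(2), of "\<lambda>i. Cod C (e i)"] eA Cod_Obj by metis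
  have pA: "P \<in> Obj C" "\<And>i. i \<in> I \<Longrightarrow> p i \<in> Hom C P (Dom C (e i))" using P by (auto simp: is_product_def)
  have qA: "Q \<in> Obj C" "\<And>i. i \<in> I \<Longrightarrow> q i \<in> Hom C Q W" using Q eA by (auto simp: is_product_def)
  obtain v where v: "v \<in> Hom C P Q" "\<And>i. i \<in> I \<Longrightarrow> q i \<cdot> v = e i \<cdot> p i"
    using product_factor[OF Q pA(1), of "\<lambda>i. e i \<cdot> p i"] pA eA by (auto simp: Hom_iff)
  have "epic C v" using product_of_epics[OF U _ P Q v] e by blast
  \<comment> \<open>\<open>D\<close> is the diagonal of \<open>W\<close>; composing the pullback
    square with \<open>q i\<close> yields one equation for each index.\<close>
  obtain D where D: "D \<in> Hom C W Q" "\<And>i. i \<in> I \<Longrightarrow> q i \<cdot> D = Id C W"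
    using product_factor[OF Q W, of "\<lambda>i. Id C W"] eA W by (auto simp: Hom_iff)
  obtain V d b where d: "epic C d" "d \<in> Hom C V W" "b \<in> Hom C V P" "v \<cdot> b = D \<cdot> d"
    using epic_pullback[OF \<open>epic C v\<close> v(1) D(1)] .
  have "e i \<cdot> (p i \<cdot> b) = d" if i: "i \<in> I" for i
  proof -
    have "e i \<cdot> (p i \<cdot> b) = (q i \<cdot> v) \<cdot> b"
      using d pA(2)[OF i] eA[OF i] v(2)[OF i] by (simp add: Hom_iff assoc)
    also have "\<dots> = q i \<cdot> (D \<cdot> d)"
      using d v(1) qA(2)[OF i] by (simp add: Hom_iff assoc)
    also have "\<dots> = (q i \<cdot> D) \<cdot> d"
      using d D(1) qA(2)[OF i] by (simp add: Hom_iff assoc)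
    also have "\<dots> = d" using D(2)[OF i] d by (simp add: Hom_iff)
    finally show ?thesis .
  qed
  moreover have "p i \<cdot> b \<in> Hom C V (Dom C (e i))" if "i \<in> I" for i
    using d(3) pA(2)[OF that] by (rule Comp_Hom)
  ultimately show ?thesis by (intro that[of d V "\<lambda>i. p i \<cdot> b"] d(1,2))
qed

text \<open>The natural numbers are replaced by their copy in \<open>'u\<close>, to which
  \<open>ex_common_cover\<close> applies.\<close>

lemma ex_countable_common_cover:
  fixes e :: "nat \<Rightarrow> _"
  assumes U: "grothendieck_universe (U :: 'u itself)" "has_exact_small_products U C"
    and W: "W \<in> Obj C" and e: "\<And>n. epic C (e n)" "\<And>n. Cod C (e n) = W"
  obtains V d a where "epic C d" "d \<in> Hom C V W"
    "\<And>n. a n \<in> Hom C V (Dom C (e n))" "\<And>n. e n \<cdot> a n = d"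
proof -
  obtain \<phi> :: "nat \<Rightarrow> 'u" where \<phi>: "inj \<phi>" "small U (range \<phi>)"
    using grothendieck_universe_nat[OF U(1)] .
  obtain V d a where d: "epic C d" "d \<in> Hom C V W" and
    a: "\<And>k. k \<in> range \<phi> \<Longrightarrow> a k \<in> Hom C V (Dom C (e (inv_into UNIV \<phi> k)))"
    "\<And>k. k \<in> range \<phi> \<Longrightarrow> e (inv_into UNIV \<phi> k) \<cdot> a k = d"
    by (rule ex_common_cover[OF U(2) \<phi>(2) W, of "\<lambda>k. e (inv_into UNIV \<phi> k)"]) (use e in auto)
  have inv: "inv_into UNIV \<phi> (\<phi> n) = n" for n using \<phi>(1) by simp
  show ?thesis
    by (rule that[of d V "\<lambda>n. a (\<phi> n)"]) (use d a[of "\<phi> _"] inv in simp_all)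
qed

section \<open>Limits as kernels between products\<close>

text \<open>The limit is the kernel of a map from the product of all \<open>X \<beta>\<close> to a
  product over comparable pairs; its component at \<open>(\<beta>, \<gamma>)\<close> is
  \<open>p \<beta> \<boxminus> t \<beta> \<gamma> \<cdot> p \<gamma>\<close>.\<close>

lemma ex_limit:
  fixes J :: "'w::order set"
  assumes U: "grothendieck_universe (U :: 'u itself)" "has_small_products U C" "small U J"
    and X: "\<And>\<beta>. \<beta> \<in> J \<Longrightarrow> X \<beta> \<in> Obj C"
    and t: "\<And>\<beta> \<gamma>. \<lbrakk>\<beta> \<in> J; \<gamma> \<in> J; \<beta> \<le> \<gamma>\<rbrakk> \<Longrightarrow> t \<beta> \<gamma> \<in> Hom C (X \<gamma>) (X \<beta>)"
  obtains L p where "is_limit C J X t L p"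
proof -
  obtain P p where P: "is_product C J X P p"
    by (rule ex_small_product[OF U(2,3), of X]) (use X in auto)
  define K where "K = {(\<beta>, \<gamma>). \<beta> \<in> J \<and> \<gamma> \<in> J \<and> \<beta> \<le> \<gamma>}"
  have "small U K"
    by (rule small_lepoll[OF subset_imp_lepoll small_Times[OF U(1,3)]]) (auto simp: K_def)
  then obtain Q q where Q: "is_product C K (\<lambda>k. X (fst k)) Q q"
    by (rule ex_small_product[OF U(2), of K "\<lambda>k. X (fst k)"]) (use X in \<open>auto simp: K_def\<close>)
  have pA: "P \<in> Obj C" "\<And>\<beta>. \<beta> \<in> J \<Longrightarrow> p \<beta> \<in> Hom C P (X \<beta>)" using P by (auto simp: is_product_def)
  have qA: "q (\<beta>, \<gamma>) \<in> Hom C Q (X \<beta>)" if "(\<beta>, \<gamma>) \<in> K" for \<beta> \<gamma>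
    using Q that by (auto simp: is_product_def)
  have tp: "t \<beta> \<gamma> \<cdot> p \<gamma> \<in> Hom C P (X \<beta>)" if "(\<beta>, \<gamma>) \<in> K" for \<beta> \<gamma>
    using that t pA(2) Comp_Hom by (simp add: K_def) blast
  obtain d where d: "d \<in> Hom C P Q"
    and qd: "\<And>k. k \<in> K \<Longrightarrow> q k \<cdot> d = p (fst k) \<boxminus> t (fst k) (snd k) \<cdot> p (snd k)"
    by (rule product_factor[OF Q pA(1), of "\<lambda>k. p (fst k) \<boxminus> t (fst k) (snd k) \<cdot> p (snd k)"])
      (use tp pA(2) diff_Hom in \<open>auto simp: K_def\<close>)
  have QO: "Q \<in> Obj C" using d Hom_Obj by blast
  \<comment> \<open>Arrows into the product that are killed by \<open>d\<close> are those whose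
    components form a cone.\<close>
  have d_zero: "d \<cdot> u = Zero C W Q \<longleftrightarrow> (\<forall>\<beta>\<in>J. \<forall>\<gamma>\<in>J. \<beta> \<le> \<gamma> \<longrightarrow> t \<beta> \<gamma> \<cdot> (p \<gamma> \<cdot> u) = p \<beta> \<cdot> u)"
    if u: "u \<in> Hom C W P" for W u
  proof -
    have W: "W \<in> Obj C" using u by (rule Hom_Obj)
    have du: "d \<cdot> u \<in> Hom C W Q" using u d by (rule Comp_Hom)
    have "d \<cdot> u = Zero C W Q \<longleftrightarrow> (\<forall>k\<in>K. q k \<cdot> (d \<cdot> u) = q k \<cdot> Zero C W Q)"
      using product_unique[OF Q du Zero_Hom[OF W QO]] by auto
    also have "\<dots> \<longleftrightarrow> (\<forall>\<beta>\<in>J. \<forall>\<gamma>\<in>J. \<beta> \<le> \<gamma> \<longrightarrow> q (\<beta>, \<gamma>) \<cdot> (d \<cdot> u) = q (\<beta>, \<gamma>) \<cdot> Zero C W Q)"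
      by (auto simp: K_def)
    also have "\<dots> \<longleftrightarrow> (\<forall>\<beta>\<in>J. \<forall>\<gamma>\<in>J. \<beta> \<le> \<gamma> \<longrightarrow> t \<beta> \<gamma> \<cdot> (p \<gamma> \<cdot> u) = p \<beta> \<cdot> u)"
    proof (intro ball_cong imp_cong refl)
      fix \<beta> \<gamma> assume bg: "\<beta> \<in> J" "\<gamma> \<in> J" "\<beta> \<le> \<gamma>"
      then have k: "(\<beta>, \<gamma>) \<in> K" by (simp add: K_def)
      have pu: "p \<beta> \<cdot> u \<in> Hom C W (X \<beta>)" "(t \<beta> \<gamma> \<cdot> p \<gamma>) \<cdot> u \<in> Hom C W (X \<beta>)"
        using u pA(2)[OF bg(1)] tp[OF k] Comp_Hom by blast+
      have "q (\<beta>, \<gamma>) \<cdot> (d \<cdot> u) = (q (\<beta>, \<gamma>) \<cdot> d) \<cdot> u"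
        using u d qA[OF k] by (simp add: Hom_iff assoc)
      also have "\<dots> = p \<beta> \<cdot> u \<boxminus> t \<beta> \<gamma> \<cdot> p \<gamma> \<cdot> u"
        using qd[OF k] diff_Comp[OF u pA(2)[OF bg(1)] tp[OF k]] by simp
      finally have "q (\<beta>, \<gamma>) \<cdot> (d \<cdot> u) = Zero C W (X \<beta>) \<longleftrightarrow> p \<beta> \<cdot> u = t \<beta> \<gamma> \<cdot> p \<gamma> \<cdot> u"
        using Hom_group_laws(7)[OF pu] by simp
      moreover have "q (\<beta>, \<gamma>) \<cdot> Zero C W Q = Zero C W (X \<beta>)" using qA[OF k] W by (simp add: Hom_iff)
      moreover have "t \<beta> \<gamma> \<cdot> p \<gamma> \<cdot> u = t \<beta> \<gamma> \<cdot> (p \<gamma> \<cdot> u)"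
        using u pA(2)[OF bg(2)] t[OF bg] by (simp add: Hom_iff assoc)
      ultimately show "q (\<beta>, \<gamma>) \<cdot> (d \<cdot> u) = q (\<beta>, \<gamma>) \<cdot> Zero C W Q \<longleftrightarrow>
          t \<beta> \<gamma> \<cdot> (p \<gamma> \<cdot> u) = p \<beta> \<cdot> u" by auto
    qed
    finally show ?thesis .
  qed
  obtain k where k: "is_kernel C d k" using ex_kernel d by (auto simp: Hom_iff)
  have kA: "k \<in> Hom C (Dom C k) P" "d \<cdot> k = Zero C (Dom C k) Q"
    using k d by (auto simp: is_kernel_def Hom_iff)
  have "is_limit C J X t (Dom C k) (\<lambda>\<beta>. p \<beta> \<cdot> k)"
    unfolding is_limit_def
  proof (intro conjI allI impI)
    show "is_cone C J X t (Dom C k) (\<lambda>\<beta>. p \<beta> \<cdot> k)"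
      using d_zero[OF kA(1)] kA pA(2) by (auto simp: is_cone_def Hom_iff)
    fix M r assume "is_cone C J X t M r"
    then have M: "M \<in> Obj C" "\<And>\<beta>. \<beta> \<in> J \<Longrightarrow> r \<beta> \<in> Hom C M (X \<beta>)"
      "\<And>\<beta> \<gamma>. \<lbrakk>\<beta> \<in> J; \<gamma> \<in> J; \<beta> \<le> \<gamma>\<rbrakk> \<Longrightarrow> t \<beta> \<gamma> \<cdot> r \<gamma> = r \<beta>"
      by (auto simp: is_cone_def)
    obtain w where w: "w \<in> Hom C M P" "\<And>\<beta>. \<beta> \<in> J \<Longrightarrow> p \<beta> \<cdot> w = r \<beta>"
      by (rule product_factor[OF P M(1,2)]) auto
    have "d \<cdot> w = Zero C M Q" using d_zero[OF w(1)] w(2) M(3) by simp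
    then obtain u where u: "u \<in> Hom C M (Dom C k)" "k \<cdot> u = w"
      using is_kernel_factor[OF k, of w M] w(1) d by (auto simp: Hom_iff)
    show "\<exists>!u. u \<in> Hom C M (Dom C k) \<and> (\<forall>\<beta>\<in>J. p \<beta> \<cdot> k \<cdot> u = r \<beta>)"
    proof (intro ex1I conjI ballI)
      show "u \<in> Hom C M (Dom C k)" by fact
      show "p \<beta> \<cdot> k \<cdot> u = r \<beta>" if "\<beta> \<in> J" for \<beta>
        using u kA(1) pA(2)[OF that] w(2)[OF that] by (auto simp: Hom_iff assoc)
      fix u' assume u': "u' \<in> Hom C M (Dom C k) \<and> (\<forall>\<beta>\<in>J. p \<beta> \<cdot> k \<cdot> u' = r \<beta>)"
      have "k \<cdot> u' = w"
      proof (rule product_unique[OF P _ w(1)])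
        show "p \<beta> \<cdot> (k \<cdot> u') = p \<beta> \<cdot> w" if "\<beta> \<in> J" for \<beta>
          using u' kA(1) pA(2)[OF that] w(2)[OF that] that by (auto simp: Hom_iff assoc)
      qed (use u' kA in \<open>auto intro: Comp_Hom\<close>)
      then show "u' = u"
        using monicD[OF is_kernel_monic[OF k]] u u' by blast
    qed
  qed
  then show ?thesis using that by blast
qed

end

section \<open>The category of inverse sequences\<close>

lemma invseq_cat_simps [simp]:
  "Dom (invseq_cat A) = src" "Cod (invseq_cat A) = tgt"
  "Obj (invseq_cat A) = {S. inverse_sequence A S}"
  "src (\<psi> \<cdot>\<^bsub>invseq_cat A\<^esub> \<phi>) = src \<phi>" "tgt (\<psi> \<cdot>\<^bsub>invseq_cat A\<^esub> \<phi>) = tgt \<psi>"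
  "cmp (\<psi> \<cdot>\<^bsub>invseq_cat A\<^esub> \<phi>) i = cmp \<psi> i \<cdot>\<^bsub>A\<^esub> cmp \<phi> i"
  "src (Id (invseq_cat A) S) = S" "tgt (Id (invseq_cat A) S) = S"
  "cmp (Id (invseq_cat A) S) i = Id A (ob S i)"
  "src (Zero (invseq_cat A) S T) = S" "tgt (Zero (invseq_cat A) S T) = T"
  "cmp (Zero (invseq_cat A) S T) i = Zero A (ob S i) (ob T i)"
  by (auto simp: invseq_cat_def)

lemma invseq_Hom_iff:
  "\<phi> \<in> Hom (invseq_cat A) S T \<longleftrightarrow>
     src \<phi> = S \<and> tgt \<phi> = T \<and> inverse_sequence A S \<and> inverse_sequence A T \<and>
     (\<forall>i. cmp \<phi> i \<in> Hom A (ob S i) (ob T i)) \<and>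
     (\<forall>i. bond T i \<cdot>\<^bsub>A\<^esub> cmp \<phi> (Suc i) = cmp \<phi> i \<cdot>\<^bsub>A\<^esub> bond S i)"
  unfolding Hom_def[of "invseq_cat A"] by (auto simp: invseq_cat_def)

lemma invseq_Hom_cmp: "\<phi> \<in> Hom (invseq_cat A) S T \<Longrightarrow> cmp \<phi> i \<in> Hom A (ob S i) (ob T i)"
  and invseq_Hom_bond: "\<phi> \<in> Hom (invseq_cat A) S T \<Longrightarrow>
    bond T i \<cdot>\<^bsub>A\<^esub> cmp \<phi> (Suc i) = cmp \<phi> i \<cdot>\<^bsub>A\<^esub> bond S i"
  and invseq_Hom_inverse_sequence: "\<phi> \<in> Hom (invseq_cat A) S T \<Longrightarrow>
    inverse_sequence A S \<and> inverse_sequence A T"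
  by (auto simp: invseq_Hom_iff)

lemma invseq_Arr_iff: "\<phi> \<in> Arr (invseq_cat A) \<longleftrightarrow> \<phi> \<in> Hom (invseq_cat A) (src \<phi>) (tgt \<phi>)"
  unfolding Hom_def by simp

lemma invseq_Hom_eqI:
  assumes "\<phi> \<in> Hom (invseq_cat A) S T" "\<psi> \<in> Hom (invseq_cat A) S T" "\<And>i. cmp \<phi> i = cmp \<psi> i"
  shows "\<phi> = \<psi>"
  using assms by (cases \<phi>; cases \<psi>) (auto simp: invseq_Hom_iff fun_eq_iff)

lemma inverse_sequence_ob: "inverse_sequence A S \<Longrightarrow> ob S i \<in> Obj A"
  and inverse_sequence_bond: "inverse_sequence A S \<Longrightarrow> bond S i \<in> Hom A (ob S (Suc i)) (ob S i)"
  by (auto simp: inverse_sequence_def)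

context category
begin

abbreviation V where "V \<equiv> invseq_cat C"

lemma invseq_Comp_Hom:
  assumes f: "f \<in> Hom V S T" and g: "g \<in> Hom V T R"
  shows "g \<cdot>\<^bsub>V\<^esub> f \<in> Hom V S R"
  unfolding invseq_Hom_iff
proof (intro conjI allI)
  show "inverse_sequence C S" "inverse_sequence C R"
    using f g by (auto simp: invseq_Hom_iff)
  show "cmp (g \<cdot>\<^bsub>V\<^esub> f) i \<in> Hom C (ob S i) (ob R i)" for i
    using Comp_Hom[OF invseq_Hom_cmp[OF f] invseq_Hom_cmp[OF g]] by simp
  show "bond R i \<cdot> cmp (g \<cdot>\<^bsub>V\<^esub> f) (Suc i) = cmp (g \<cdot>\<^bsub>V\<^esub> f) i \<cdot> bond S i" for i
  proof -
    have S: "inverse_sequence C S" "inverse_sequence C T" "inverse_sequence C R"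
      using f g by (auto simp: invseq_Hom_iff)
    note H = invseq_Hom_cmp[OF f, of i] invseq_Hom_cmp[OF g, of i] invseq_Hom_cmp[OF f, of "Suc i"]
      invseq_Hom_cmp[OF g, of "Suc i"] S[THEN inverse_sequence_bond, of i]
    have "bond R i \<cdot> cmp (g \<cdot>\<^bsub>V\<^esub> f) (Suc i) = (bond R i \<cdot> cmp g (Suc i)) \<cdot> cmp f (Suc i)"
      using H by (simp add: Hom_iff assoc)
    also have "\<dots> = cmp g i \<cdot> (bond T i \<cdot> cmp f (Suc i))"
      using H by (subst invseq_Hom_bond[OF g]) (simp add: Hom_iff assoc)
    also have "\<dots> = cmp (g \<cdot>\<^bsub>V\<^esub> f) i \<cdot> bond S i"
      using H by (subst invseq_Hom_bond[OF f]) (simp add: Hom_iff assoc)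
    finally show ?thesis .
  qed
qed (use f g in \<open>auto simp: invseq_Hom_iff\<close>)

lemma invseq_Id_Hom: "inverse_sequence C S \<Longrightarrow> Id V S \<in> Hom V S S"
  unfolding invseq_Hom_iff
  using inverse_sequence_bond[of C S] by (auto simp: inverse_sequence_ob Id_Hom Hom_iff)

text \<open>With this, the results on limits and on cancelling monomorphisms and epimorphisms apply
  to inverse sequences.\<close>

lemma category_invseq_cat: "category V"
proof
  show "Dom V f \<in> Obj V" "Cod V f \<in> Obj V" if "f \<in> Arr V" for f
    using that by (auto simp: invseq_Arr_iff invseq_Hom_iff)
  show "Id V X \<in> Hom V X X" if "X \<in> Obj V" for X using that invseq_Id_Hom by simp
  show "g \<cdot>\<^bsub>V\<^esub> f \<in> Hom V X Z" if "f \<in> Hom V X Y" "g \<in> Hom V Y Z" for f g X Y Z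
    using that by (rule invseq_Comp_Hom)
  show "f \<cdot>\<^bsub>V\<^esub> Id V X = f" "Id V Y \<cdot>\<^bsub>V\<^esub> f = f" if f: "f \<in> Hom V X Y" for f X Y
  proof -
    have XY: "inverse_sequence C X" "inverse_sequence C Y" using f by (auto simp: invseq_Hom_iff)
    show "f \<cdot>\<^bsub>V\<^esub> Id V X = f"
      by (rule invseq_Hom_eqI[OF invseq_Comp_Hom[OF invseq_Id_Hom[OF XY(1)] f] f])
        (simp add: Comp_Id[OF invseq_Hom_cmp[OF f]])
    show "Id V Y \<cdot>\<^bsub>V\<^esub> f = f"
      by (rule invseq_Hom_eqI[OF invseq_Comp_Hom[OF f invseq_Id_Hom[OF XY(2)]] f])
        (simp add: Id_Comp[OF invseq_Hom_cmp[OF f]])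
  qed
  show "h \<cdot>\<^bsub>V\<^esub> (g \<cdot>\<^bsub>V\<^esub> f) = h \<cdot>\<^bsub>V\<^esub> g \<cdot>\<^bsub>V\<^esub> f"
    if f: "f \<in> Hom V W X" and g: "g \<in> Hom V X Y" and h: "h \<in> Hom V Y Z" for f g h W X Y Z
    by (rule invseq_Hom_eqI[of _ C W Z]; (intro invseq_Comp_Hom f g h)?)
      (use f g h in \<open>auto intro: invseq_Comp_Hom\<close>,
       use Comp_assoc[OF invseq_Hom_cmp[OF f] invseq_Hom_cmp[OF g] invseq_Hom_cmp[OF h]] in simp)
qed

section \<open>Componentwise monomorphisms, epimorphisms and factorizations\<close>

lemma invseq_monic:
  assumes m: "m \<in> Hom V S T" and mono: "\<And>i. monic C (cmp m i)"
  shows "monic V m"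
  unfolding monic_def
proof (intro conjI allI ballI impI)
  show "m \<in> Arr V" using m by (simp add: Hom_def)
  fix W g h assume gh: "g \<in> Hom V W (Dom V m)" "h \<in> Hom V W (Dom V m)" and eq: "m \<cdot>\<^bsub>V\<^esub> g = m \<cdot>\<^bsub>V\<^esub> h"
  have "src m = S" using m by (simp add: invseq_Hom_iff)
  show "g = h"
  proof (rule invseq_Hom_eqI[OF gh])
    fix i
    have "cmp m i \<cdot> cmp g i = cmp m i \<cdot> cmp h i" using arg_cong[OF eq, of "\<lambda>x. cmp x i"] by simp
    then show "cmp g i = cmp h i"
      using gh m by - (rule monicD[OF mono[of i], of _ "ob W i"], auto simp: invseq_Hom_iff Hom_iff)
  qed
qed

lemma invseq_epic:
  assumes m: "m \<in> Hom V S T" and epi: "\<And>i. epic C (cmp m i)"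
  shows "epic V m"
  unfolding epic_def
proof (intro conjI allI ballI impI)
  show "m \<in> Arr V" using m by (simp add: Hom_def)
  fix W g h assume gh: "g \<in> Hom V (Cod V m) W" "h \<in> Hom V (Cod V m) W" and eq: "g \<cdot>\<^bsub>V\<^esub> m = h \<cdot>\<^bsub>V\<^esub> m"
  show "g = h"
  proof (rule invseq_Hom_eqI[OF gh])
    fix i
    have "cmp g i \<cdot> cmp m i = cmp h i \<cdot> cmp m i" using arg_cong[OF eq, of "\<lambda>x. cmp x i"] by simp
    then show "cmp g i = cmp h i"
      using gh m by - (rule epicD[OF epi[of i], of _ "ob W i"], auto simp: invseq_Hom_iff Hom_iff)
  qed
qed

text \<open>Componentwise factorizations commute with the bonding maps because
  \<open>cmp m i\<close> can be cancelled on the left. They form the unique arrow described by the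
  \<open>THE\<close> in \<open>factor_through\<close>.\<close>

lemma invseq_factor_through:
  assumes m: "m \<in> Hom V S R" "\<And>i. monic C (cmp m i)" and n: "n \<in> Hom V T R"
    and fac: "\<And>i. \<exists>u. u \<in> Hom C (ob T i) (ob S i) \<and> cmp m i \<cdot> u = cmp n i"
  shows "factor_through V m n \<in> Hom V T S" "m \<cdot>\<^bsub>V\<^esub> factor_through V m n = n"
proof -
  obtain u where u: "\<And>i. u i \<in> Hom C (ob T i) (ob S i)" "\<And>i. cmp m i \<cdot> u i = cmp n i"
    using fac by metis
  have seq: "inverse_sequence C S" "inverse_sequence C T" "inverse_sequence C R"
    using m n by (auto simp: invseq_Hom_iff)
  have "bond S i \<cdot> u (Suc i) = u i \<cdot> bond T i" for i
  proof (rule monicD[OF m(2)[of i], of _ "ob T (Suc i)"])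
    note H = seq[THEN inverse_sequence_bond, of i] u(1)[of i] u(1)[of "Suc i"]
      invseq_Hom_cmp[OF m(1), of i] invseq_Hom_cmp[OF m(1), of "Suc i"]
    have "cmp m i \<cdot> (bond S i \<cdot> u (Suc i)) = (cmp m i \<cdot> bond S i) \<cdot> u (Suc i)"
      using H by (simp add: Hom_iff assoc)
    also have "\<dots> = bond R i \<cdot> (cmp m (Suc i) \<cdot> u (Suc i))"
      using H by (subst invseq_Hom_bond[OF m(1), symmetric]) (simp add: Hom_iff assoc)
    also have "\<dots> = cmp n i \<cdot> bond T i" using u(2) invseq_Hom_bond[OF n] by simp
    also have "\<dots> = cmp m i \<cdot> (u i \<cdot> bond T i)"
      using H by (subst u(2)[symmetric]) (simp add: Hom_iff assoc)
    finally show "cmp m i \<cdot> (bond S i \<cdot> u (Suc i)) = cmp m i \<cdot> (u i \<cdot> bond T i)" .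
    show "bond S i \<cdot> u (Suc i) \<in> Hom C (ob T (Suc i)) (Dom C (cmp m i))"
      "u i \<cdot> bond T i \<in> Hom C (ob T (Suc i)) (Dom C (cmp m i))"
      using H by (auto simp: Hom_iff)
  qed
  then have w: "\<lparr>src = T, tgt = S, cmp = u\<rparr> \<in> Hom V T S" (is "?w \<in> _")
    using u seq by (auto simp: invseq_Hom_iff)
  have mw: "m \<cdot>\<^bsub>V\<^esub> ?w = n"
    by (rule invseq_Hom_eqI[OF invseq_Comp_Hom[OF w m(1)] n]) (simp add: u)
  have src: "src m = S" "src n = T" using m n by (auto simp: invseq_Hom_iff)
  have "\<exists>!w. w \<in> Hom V T S \<and> m \<cdot>\<^bsub>V\<^esub> w = n"
    using w mw category.monicD[OF category_invseq_cat invseq_monic[OF m]] src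
    by (intro ex1I[of _ ?w]) auto
  from theI'[OF this]
  show "factor_through V m n \<in> Hom V T S" "m \<cdot>\<^bsub>V\<^esub> factor_through V m n = n"
    by (simp_all add: factor_through_def src)
qed

text \<open>Dual to \<open>invseq_factor_through\<close>, except that the compatibility square
  starts at index i + 1, so that \<open>cmp q (Suc i)\<close> is cancelled.\<close>

lemma invseq_factor_over:
  assumes q: "q \<in> Hom V R S" "\<And>i. epic C (cmp q i)" and r: "r \<in> Hom V R T"
    and fac: "\<And>i. \<exists>u. u \<in> Hom C (ob S i) (ob T i) \<and> u \<cdot> cmp q i = cmp r i"
  shows "factor_over V q r \<in> Hom V S T" "factor_over V q r \<cdot>\<^bsub>V\<^esub> q = r"
proof -
  obtain u where u: "\<And>i. u i \<in> Hom C (ob S i) (ob T i)" "\<And>i. u i \<cdot> cmp q i = cmp r i"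
    using fac by metis
  have seq: "inverse_sequence C S" "inverse_sequence C T" "inverse_sequence C R"
    using q r by (auto simp: invseq_Hom_iff)
  have "bond T i \<cdot> u (Suc i) = u i \<cdot> bond S i" for i
  proof (rule epicD[OF q(2)[of "Suc i"], of _ "ob T i"])
    note H = seq[THEN inverse_sequence_bond, of i] u(1)[of i] u(1)[of "Suc i"]
      invseq_Hom_cmp[OF q(1), of i] invseq_Hom_cmp[OF q(1), of "Suc i"]
    have "bond T i \<cdot> u (Suc i) \<cdot> cmp q (Suc i) = bond T i \<cdot> cmp r (Suc i)"
      using H by (subst u(2)[symmetric]) (simp add: Hom_iff assoc)
    also have "\<dots> = (u i \<cdot> cmp q i) \<cdot> bond R i" using u(2) invseq_Hom_bond[OF r] by simp
    also have "\<dots> = u i \<cdot> (cmp q i \<cdot> bond R i)"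
      using H by (simp add: Hom_iff assoc)
    also have "\<dots> = u i \<cdot> bond S i \<cdot> cmp q (Suc i)"
      using H by (subst invseq_Hom_bond[OF q(1), symmetric]) (simp add: Hom_iff assoc)
    finally show "bond T i \<cdot> u (Suc i) \<cdot> cmp q (Suc i) = u i \<cdot> bond S i \<cdot> cmp q (Suc i)" .
    show "bond T i \<cdot> u (Suc i) \<in> Hom C (Cod C (cmp q (Suc i))) (ob T i)"
      "u i \<cdot> bond S i \<in> Hom C (Cod C (cmp q (Suc i))) (ob T i)"
      using H by (auto simp: Hom_iff)
  qed
  then have w: "\<lparr>src = S, tgt = T, cmp = u\<rparr> \<in> Hom V S T" (is "?w \<in> _")
    using u seq by (auto simp: invseq_Hom_iff)
  have wq: "?w \<cdot>\<^bsub>V\<^esub> q = r"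
    by (rule invseq_Hom_eqI[OF invseq_Comp_Hom[OF q(1) w] r]) (simp add: u)
  have tgt: "tgt q = S" "tgt r = T" using q r by (auto simp: invseq_Hom_iff)
  have "\<exists>!w. w \<in> Hom V S T \<and> w \<cdot>\<^bsub>V\<^esub> q = r"
    using w wq category.epicD[OF category_invseq_cat invseq_epic[OF q]] tgt
    by (intro ex1I[of _ ?w]) auto
  from theI'[OF this]
  show "factor_over V q r \<in> Hom V S T" "factor_over V q r \<cdot>\<^bsub>V\<^esub> q = r"
    by (simp_all add: factor_over_def tgt)
qed

end

context abelian_category
begin

section \<open>Cokernels and limits of inverse sequences\<close>

text \<open>Cokernels are chosen in each component; bonding maps between them are induced because
  \<open>Q i \<cdot> bond T i\<close> kills \<open>cmp f (Suc i)\<close>.\<close>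

lemma ex_invseq_cokernel:
  assumes f: "f \<in> Hom V S T"
  obtains q where "is_cokernel V f q" "\<And>i. is_cokernel C (cmp f i) (cmp q i)"
proof -
  have seq: "inverse_sequence C S" "inverse_sequence C T" using f by (auto simp: invseq_Hom_iff)
  have fA: "cmp f i \<in> Hom C (ob S i) (ob T i)" for i using f by (rule invseq_Hom_cmp)
  have "\<exists>q. is_cokernel C (cmp f i) q" for i using ex_cokernel fA[of i] by (simp add: Hom_iff)
  then obtain Q where Q: "\<And>i. is_cokernel C (cmp f i) (Q i)" by metis
  have QA: "Q i \<in> Hom C (ob T i) (Cod C (Q i))" "Q i \<cdot> cmp f i = Zero C (ob S i) (Cod C (Q i))" for i
    using Q[of i] fA[of i] by (auto simp: is_cokernel_def Hom_iff)
  have "\<exists>b. b \<in> Hom C (Cod C (Q (Suc i))) (Cod C (Q i)) \<and> b \<cdot> Q (Suc i) = Q i \<cdot> bond T i" for i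
  proof -
    note H = seq[THEN inverse_sequence_bond, of i] fA[of i] fA[of "Suc i"] QA(1)[of i] QA(1)[of "Suc i"]
    have "Q i \<cdot> bond T i \<cdot> cmp f (Suc i) = (Q i \<cdot> cmp f i) \<cdot> bond S i"
      using H invseq_Hom_bond[OF f, of i] by (simp add: Hom_iff assoc)
    also have "\<dots> = Zero C (ob S (Suc i)) (Cod C (Q i))"
      using H QA(2)[of i] by (auto simp: Hom_iff)
    finally show ?thesis
      using is_cokernel_factor[OF Q[of "Suc i"], of "Q i \<cdot> bond T i" "Cod C (Q i)"] H
      by (auto simp: Hom_iff)
  qed
  then obtain b where b: "\<And>i. b i \<in> Hom C (Cod C (Q (Suc i))) (Cod C (Q i))"
    "\<And>i. b i \<cdot> Q (Suc i) = Q i \<cdot> bond T i" by metis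
  define R where "R = \<lparr>ob = \<lambda>i. Cod C (Q i), bond = b\<rparr>"
  define q where "q = \<lparr>src = T, tgt = R, cmp = Q\<rparr>"
  have R: "inverse_sequence C R" using QA(1) b by (auto simp: R_def inverse_sequence_def Hom_iff)
  have q: "q \<in> Hom V T R"
    using QA b R seq by (auto simp: q_def R_def invseq_Hom_iff)
  have "is_cokernel V f q"
    unfolding is_cokernel_def
  proof (intro conjI allI ballI impI)
    show "f \<in> Arr V" using f by (simp add: Hom_def)
    show "q \<in> Hom V (Cod V f) (Cod V q)" using f q by (simp add: invseq_Hom_iff)
    have "Zero V S R \<in> Hom V S R"
      unfolding invseq_Hom_iff using R seq inverse_sequence_bond[OF R] inverse_sequence_bond[OF seq(1)]
      by (auto simp: Hom_iff inverse_sequence_ob)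
    then show "q \<cdot>\<^bsub>V\<^esub> f = Zero V (Dom V f) (Cod V q)"
      using invseq_Hom_eqI[OF invseq_Comp_Hom[OF f q], of "Zero V S R"] QA(2) f q
      by (auto simp: invseq_Hom_iff q_def R_def)
    fix Z g assume "g \<in> Hom V (Cod V f) Z" and gf: "g \<cdot>\<^bsub>V\<^esub> f = Zero V (Dom V f) Z"
    then have g: "g \<in> Hom V T Z" using f by (simp add: invseq_Hom_iff)
    have fac: "\<exists>u. u \<in> Hom C (ob R i) (ob Z i) \<and> u \<cdot> cmp q i = cmp g i" for i
    proof -
      have "cmp g i \<cdot> cmp f i = Zero C (ob S i) (ob Z i)"
        using arg_cong[OF gf, of "\<lambda>x. cmp x i"] f by (simp add: invseq_Hom_iff)
      then show ?thesis
        using is_cokernel_factor[OF Q[of i], of "cmp g i" "ob Z i"] fA[of i] invseq_Hom_cmp[OF g, of i]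
        by (auto simp: R_def q_def Hom_iff)
    qed
    have ep: "epic C (cmp q i)" for i using is_cokernel_epic[OF Q] by (simp add: q_def)
    note fo = invseq_factor_over[OF q ep g fac]
    have tq: "tgt q = R" by (simp add: q_def)
    show "\<exists>!u. u \<in> Hom V (Cod V q) Z \<and> u \<cdot>\<^bsub>V\<^esub> q = g"
      using fo category.epicD[OF category_invseq_cat invseq_epic[OF q ep]] tq
      by (intro ex1I[of _ "factor_over V q g"]) auto
  qed
  then show ?thesis using that Q by (simp add: q_def)
qed

text \<open>\<open>quot_map\<close> is an arbitrary choice of a cokernel, so an arbitrary
  \<open>r\<close> is compared with a componentwise cokernel \<open>q\<close> through arrows
  \<open>u\<close> and \<open>v\<close> between their targets.\<close>

lemma invseq_cokernel:
  assumes f: "f \<in> Hom V S T" and r: "is_cokernel V f r"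
  shows "is_cokernel C (cmp f i) (cmp r i)"
proof -
  interpret V: category V by (rule category_invseq_cat)
  obtain q where q: "is_cokernel V f q" "\<And>i. is_cokernel C (cmp f i) (cmp q i)"
    by (rule ex_invseq_cokernel[OF f]) auto
  define Q R where "Q = tgt q" and "R = tgt r"
  have st: "src f = S" "tgt f = T" using f by (auto simp: invseq_Hom_iff)
  have qA: "q \<in> Hom V T Q" and rA: "r \<in> Hom V T R"
    and qf: "q \<cdot>\<^bsub>V\<^esub> f = Zero V S Q" and rf: "r \<cdot>\<^bsub>V\<^esub> f = Zero V S R"
    using q r by (auto simp: is_cokernel_def st Q_def R_def)
  have q_ex1: "\<exists>!u. u \<in> Hom V Q Z \<and> u \<cdot>\<^bsub>V\<^esub> q = g" if "g \<in> Hom V T Z" "g \<cdot>\<^bsub>V\<^esub> f = Zero V S Z" for g Z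
    using q(1) that by (simp add: is_cokernel_def st Q_def)
  have r_ex1: "\<exists>!u. u \<in> Hom V R Z \<and> u \<cdot>\<^bsub>V\<^esub> r = g" if "g \<in> Hom V T Z" "g \<cdot>\<^bsub>V\<^esub> f = Zero V S Z" for g Z
    using r that by (simp add: is_cokernel_def st R_def)
  obtain u where u: "u \<in> Hom V Q R" "u \<cdot>\<^bsub>V\<^esub> q = r" using q_ex1[OF rA rf] by blast
  obtain v where v: "v \<in> Hom V R Q" "v \<cdot>\<^bsub>V\<^esub> r = q" using r_ex1[OF qA qf] by blast
  have RO: "R \<in> Obj V" using rA V.Hom_Obj by blast
  have "(u \<cdot>\<^bsub>V\<^esub> v) \<cdot>\<^bsub>V\<^esub> r = r" using u v rA by (simp add: V.Hom_iff V.assoc)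
  moreover have "Id V R \<cdot>\<^bsub>V\<^esub> r = r" using rA by (rule V.Id_Comp)
  ultimately have uv: "u \<cdot>\<^bsub>V\<^esub> v = Id V R"
    using r_ex1[OF rA rf] V.Comp_Hom[OF v(1) u(1)] V.Id_Hom[OF RO] by metis
  note H = invseq_Hom_cmp[OF f, of i] invseq_Hom_cmp[OF qA, of i] invseq_Hom_cmp[OF rA, of i]
    invseq_Hom_cmp[OF u(1), of i] invseq_Hom_cmp[OF v(1), of i]
  have uvi: "cmp u i \<cdot> cmp v i = Id C (ob R i)" and ri: "cmp u i \<cdot> cmp q i = cmp r i"
    and qi: "cmp v i \<cdot> cmp r i = cmp q i"
    using arg_cong[OF uv, of "\<lambda>x. cmp x i"] arg_cong[OF u(2), of "\<lambda>x. cmp x i"]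
      arg_cong[OF v(2), of "\<lambda>x. cmp x i"] by simp_all
  \<comment> \<open>\<open>u\<close> has the right inverse \<open>v\<close>, so its components are
    epic, and so are the components \<open>cmp u i \<cdot> cmp q i\<close> of
    \<open>r\<close>.\<close>
  have "epic C (cmp u i)"
    using H epic_Id[OF Hom_Obj(2)[OF H(4)]]
    by - (rule epic_of_Comp[of _ "cmp v i"], auto simp: uvi Hom_iff)
  then have epi: "epic C (cmp r i)"
    using epic_Comp[OF is_cokernel_epic[OF q(2)[of i]], of "cmp u i"] H by (auto simp: ri Hom_iff)
  show ?thesis
    unfolding is_cokernel_def
  proof (intro conjI allI ballI impI)
    show "cmp f i \<in> Arr C" "cmp r i \<in> Hom C (Cod C (cmp f i)) (Cod C (cmp r i))"
      using H by (auto simp: Hom_iff)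
    show "cmp r i \<cdot> cmp f i = Zero C (Dom C (cmp f i)) (Cod C (cmp r i))"
      using arg_cong[OF rf, of "\<lambda>x. cmp x i"] H by (simp add: Hom_iff)
    fix Z g assume g: "g \<in> Hom C (Cod C (cmp f i)) Z" "g \<cdot> cmp f i = Zero C (Dom C (cmp f i)) Z"
    obtain w where w: "w \<in> Hom C (Cod C (cmp q i)) Z" "w \<cdot> cmp q i = g"
      using is_cokernel_factor[OF q(2) g] .
    have "w \<cdot> cmp v i \<cdot> cmp r i = g" using H w qi by (auto simp: Hom_iff assoc)
    moreover have "w \<cdot> cmp v i \<in> Hom C (Cod C (cmp r i)) Z" using H w by (auto simp: Hom_iff)
    ultimately show "\<exists>!u. u \<in> Hom C (Cod C (cmp r i)) Z \<and> u \<cdot> cmp r i = g"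
      using epicD[OF epi] by (intro ex1I[of _ "w \<cdot> cmp v i"]) auto
  qed
qed

text \<open>The limits of the components are linked by the arrows that mediate the cones
  \<open>bond (X \<beta>) i \<cdot> p (Suc i) \<beta>\<close>. Uniqueness in each component makes
  the mediating arrows commute with these bonding maps.\<close>

lemma ex_invseq_limit:
  fixes J :: "'w::order set"
  assumes U: "grothendieck_universe (U :: 'u itself)" "has_small_products U C" "small U J"
    and X: "\<And>\<beta>. \<beta> \<in> J \<Longrightarrow> inverse_sequence C (X \<beta>)"
    and t: "\<And>\<beta> \<gamma>. \<lbrakk>\<beta> \<in> J; \<gamma> \<in> J; \<beta> \<le> \<gamma>\<rbrakk> \<Longrightarrow> t \<beta> \<gamma> \<in> Hom V (X \<gamma>) (X \<beta>)"
  obtains L p where "is_limit V J X t L p"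
    "\<And>i. is_limit C J (\<lambda>\<beta>. ob (X \<beta>) i) (\<lambda>\<beta> \<gamma>. cmp (t \<beta> \<gamma>) i) (ob L i) (\<lambda>\<beta>. cmp (p \<beta>) i)"
proof -
  have tc: "cmp (t \<beta> \<gamma>) i \<in> Hom C (ob (X \<gamma>) i) (ob (X \<beta>) i)" if "\<beta> \<in> J" "\<gamma> \<in> J" "\<beta> \<le> \<gamma>" for \<beta> \<gamma> i
    using t[OF that] by (rule invseq_Hom_cmp)
  have "\<exists>L p. is_limit C J (\<lambda>\<beta>. ob (X \<beta>) i) (\<lambda>\<beta> \<gamma>. cmp (t \<beta> \<gamma>) i) L p" for i
    by (rule ex_limit[OF U, of "\<lambda>\<beta>. ob (X \<beta>) i" "\<lambda>\<beta> \<gamma>. cmp (t \<beta> \<gamma>) i"])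
      (use X tc in \<open>auto intro: inverse_sequence_ob\<close>)
  then obtain L p where lim:
    "\<And>i. is_limit C J (\<lambda>\<beta>. ob (X \<beta>) i) (\<lambda>\<beta> \<gamma>. cmp (t \<beta> \<gamma>) i) (L i) (p i)" by metis
  have L: "L i \<in> Obj C" for i using lim[of i] by (auto simp: is_limit_def is_cone_def)
  have pA: "p i \<beta> \<in> Hom C (L i) (ob (X \<beta>) i)" if "\<beta> \<in> J" for i \<beta>
    using lim[of i] that by (auto simp: is_limit_def is_cone_def)
  have tp: "cmp (t \<beta> \<gamma>) i \<cdot> p i \<gamma> = p i \<beta>" if "\<beta> \<in> J" "\<gamma> \<in> J" "\<beta> \<le> \<gamma>" for i \<beta> \<gamma>
    using lim[of i] that by (auto simp: is_limit_def is_cone_def)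
  have "\<exists>b. b \<in> Hom C (L (Suc i)) (L i) \<and> (\<forall>\<beta>\<in>J. p i \<beta> \<cdot> b = bond (X \<beta>) i \<cdot> p (Suc i) \<beta>)" for i
  proof -
    have "is_cone C J (\<lambda>\<beta>. ob (X \<beta>) i) (\<lambda>\<beta> \<gamma>. cmp (t \<beta> \<gamma>) i) (L (Suc i))
        (\<lambda>\<beta>. bond (X \<beta>) i \<cdot> p (Suc i) \<beta>)"
      unfolding is_cone_def
    proof (intro conjI ballI impI)
      show "bond (X \<beta>) i \<cdot> p (Suc i) \<beta> \<in> Hom C (L (Suc i)) (ob (X \<beta>) i)" if "\<beta> \<in> J" for \<beta>
        using pA[OF that] inverse_sequence_bond[OF X[OF that]] by (rule Comp_Hom)
      fix \<beta> \<gamma> assume bg: "\<beta> \<in> J" "\<gamma> \<in> J" "\<beta> \<le> \<gamma>"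
      note H = tc[OF bg, of i] tc[OF bg, of "Suc i"] inverse_sequence_bond[OF X[OF bg(1)], of i]
        inverse_sequence_bond[OF X[OF bg(2)], of i] pA[OF bg(2), of "Suc i"]
      have "cmp (t \<beta> \<gamma>) i \<cdot> (bond (X \<gamma>) i \<cdot> p (Suc i) \<gamma>) = (cmp (t \<beta> \<gamma>) i \<cdot> bond (X \<gamma>) i) \<cdot> p (Suc i) \<gamma>"
        using H by (simp add: Hom_iff assoc)
      also have "\<dots> = bond (X \<beta>) i \<cdot> (cmp (t \<beta> \<gamma>) (Suc i) \<cdot> p (Suc i) \<gamma>)"
        using H by (subst invseq_Hom_bond[OF t[OF bg], symmetric]) (simp add: Hom_iff assoc)
      also have "\<dots> = bond (X \<beta>) i \<cdot> p (Suc i) \<beta>" using tp[OF bg] by simp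
      finally show "cmp (t \<beta> \<gamma>) i \<cdot> (bond (X \<gamma>) i \<cdot> p (Suc i) \<gamma>) = bond (X \<beta>) i \<cdot> p (Suc i) \<beta>" .
    qed (rule L)
    from is_limit_factor[OF lim this] show ?thesis by metis
  qed
  then obtain b where b: "\<And>i. b i \<in> Hom C (L (Suc i)) (L i)"
    "\<And>i \<beta>. \<beta> \<in> J \<Longrightarrow> p i \<beta> \<cdot> b i = bond (X \<beta>) i \<cdot> p (Suc i) \<beta>" by metis
  define LL where "LL = \<lparr>ob = L, bond = b\<rparr>"
  define P where "P = (\<lambda>\<beta>. \<lparr>src = LL, tgt = X \<beta>, cmp = \<lambda>i. p i \<beta>\<rparr>)"
  have LL: "inverse_sequence C LL" using L b by (auto simp: LL_def inverse_sequence_def)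
  have P: "P \<beta> \<in> Hom V LL (X \<beta>)" if "\<beta> \<in> J" for \<beta>
    using LL X[OF that] pA[OF that] b that by (auto simp: invseq_Hom_iff P_def LL_def)
  have "is_limit V J X t LL P"
    unfolding is_limit_def
  proof (intro conjI allI impI)
    show "is_cone V J X t LL P"
      unfolding is_cone_def
    proof (intro conjI ballI impI)
      fix \<beta> \<gamma> assume bg: "\<beta> \<in> J" "\<gamma> \<in> J" "\<beta> \<le> \<gamma>"
      show "t \<beta> \<gamma> \<cdot>\<^bsub>V\<^esub> P \<gamma> = P \<beta>"
        by (rule invseq_Hom_eqI[OF invseq_Comp_Hom[OF P[OF bg(2)] t[OF bg]] P[OF bg(1)]])
          (simp add: P_def tp[OF bg])
    qed (use LL P in auto)
    fix M r assume M: "is_cone V J X t M r"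
    have rA: "r \<beta> \<in> Hom V M (X \<beta>)" if "\<beta> \<in> J" for \<beta>
      using M that by (auto simp: is_cone_def)
    have tr: "t \<beta> \<gamma> \<cdot>\<^bsub>V\<^esub> r \<gamma> = r \<beta>" if "\<beta> \<in> J" "\<gamma> \<in> J" "\<beta> \<le> \<gamma>" for \<beta> \<gamma>
      using M that by (auto simp: is_cone_def)
    have MS: "inverse_sequence C M" using M by (simp add: is_cone_def)
    have cone: "is_cone C J (\<lambda>\<beta>. ob (X \<beta>) i) (\<lambda>\<beta> \<gamma>. cmp (t \<beta> \<gamma>) i) (ob M i) (\<lambda>\<beta>. cmp (r \<beta>) i)" for i
      unfolding is_cone_def
    proof (intro conjI ballI impI)
      show "cmp (t \<beta> \<gamma>) i \<cdot> cmp (r \<gamma>) i = cmp (r \<beta>) i" if "\<beta> \<in> J" "\<gamma> \<in> J" "\<beta> \<le> \<gamma>" for \<beta> \<gamma>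
        using arg_cong[OF tr[OF that], of "\<lambda>x. cmp x i"] by simp
    qed (use MS invseq_Hom_cmp[OF rA] in \<open>auto intro: inverse_sequence_ob\<close>)
    have "\<exists>u. u \<in> Hom C (ob M i) (L i) \<and> (\<forall>\<beta>\<in>J. p i \<beta> \<cdot> u = cmp (r \<beta>) i)" for i
      using is_limit_factor[OF lim cone[of i]] by metis
    then obtain u where u: "\<And>i. u i \<in> Hom C (ob M i) (L i)"
      "\<And>i \<beta>. \<beta> \<in> J \<Longrightarrow> p i \<beta> \<cdot> u i = cmp (r \<beta>) i" by metis
    have "b i \<cdot> u (Suc i) = u i \<cdot> bond M i" for i
    proof (rule limit_unique[OF lim, of _ "ob M (Suc i)" i])
      note M_bond = inverse_sequence_bond[OF MS, of i]
      show "b i \<cdot> u (Suc i) \<in> Hom C (ob M (Suc i)) (L i)" using u b Comp_Hom by blast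
      show "u i \<cdot> bond M i \<in> Hom C (ob M (Suc i)) (L i)" using u M_bond Comp_Hom by blast
      fix \<beta> assume \<beta>: "\<beta> \<in> J"
      note H = u(1)[of i] u(1)[of "Suc i"] b(1)[of i] pA[OF \<beta>, of i] pA[OF \<beta>, of "Suc i"] M_bond
        inverse_sequence_bond[OF X[OF \<beta>], of i]
      have "p i \<beta> \<cdot> (b i \<cdot> u (Suc i)) = (p i \<beta> \<cdot> b i) \<cdot> u (Suc i)" using H by (simp add: Hom_iff assoc)
      also have "\<dots> = bond (X \<beta>) i \<cdot> (p (Suc i) \<beta> \<cdot> u (Suc i))"
        using H by (subst b(2)[OF \<beta>]) (simp add: Hom_iff assoc)
      also have "\<dots> = cmp (r \<beta>) i \<cdot> bond M i"
        using invseq_Hom_bond[OF rA[OF \<beta>]] by (simp add: u(2)[OF \<beta>])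
      also have "\<dots> = p i \<beta> \<cdot> (u i \<cdot> bond M i)"
        using H by (subst u(2)[OF \<beta>, symmetric]) (simp add: Hom_iff assoc)
      finally show "p i \<beta> \<cdot> (b i \<cdot> u (Suc i)) = p i \<beta> \<cdot> (u i \<cdot> bond M i)" .
    qed (use tc in auto)
    then have w: "\<lparr>src = M, tgt = LL, cmp = u\<rparr> \<in> Hom V M LL" (is "?w \<in> _")
      using u MS LL by (auto simp: invseq_Hom_iff LL_def)
    show "\<exists>!w. w \<in> Hom V M LL \<and> (\<forall>\<beta>\<in>J. P \<beta> \<cdot>\<^bsub>V\<^esub> w = r \<beta>)"
    proof (intro ex1I[of _ ?w] conjI ballI w)
      show "P \<beta> \<cdot>\<^bsub>V\<^esub> ?w = r \<beta>" if \<beta>: "\<beta> \<in> J" for \<beta>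
        by (rule invseq_Hom_eqI[OF invseq_Comp_Hom[OF w P[OF \<beta>]] rA[OF \<beta>]]) (simp add: P_def u(2)[OF \<beta>])
      fix w' assume w': "w' \<in> Hom V M LL \<and> (\<forall>\<beta>\<in>J. P \<beta> \<cdot>\<^bsub>V\<^esub> w' = r \<beta>)"
      have "cmp w' i = u i" for i
      proof (rule limit_unique[OF lim _ u(1)[of i]])
        show "cmp w' i \<in> Hom C (ob M i) (L i)"
          using w' invseq_Hom_cmp[of w' C M LL i] by (simp add: LL_def)
        show "p i \<beta> \<cdot> cmp w' i = p i \<beta> \<cdot> u i" if \<beta>: "\<beta> \<in> J" for \<beta>
        proof -
          have "P \<beta> \<cdot>\<^bsub>V\<^esub> w' = r \<beta>" using w' \<beta> by blast
          from arg_cong[OF this, of "\<lambda>x. cmp x i"] show ?thesis by (simp add: P_def u(2)[OF \<beta>])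
        qed
      qed (use tc in auto)
      then show "w' = ?w" using w' w by (intro invseq_Hom_eqI[of w' C M LL]) auto
    qed
  qed
  then show ?thesis using lim by (intro that[of LL P]) (simp_all add: LL_def P_def)
qed

text \<open>Limits selected by \<open>SOME\<close> come without a componentwise description; the
  isomorphism with a componentwise limit supplies one.\<close>

lemma invseq_limit:
  fixes J :: "'w::order set"
  assumes U: "grothendieck_universe (U :: 'u itself)" "has_small_products U C" "small U J"
    and X: "\<And>\<beta>. \<beta> \<in> J \<Longrightarrow> inverse_sequence C (X \<beta>)"
    and t: "\<And>\<beta> \<gamma>. \<lbrakk>\<beta> \<in> J; \<gamma> \<in> J; \<beta> \<le> \<gamma>\<rbrakk> \<Longrightarrow> t \<beta> \<gamma> \<in> Hom V (X \<gamma>) (X \<beta>)"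
    and M: "is_limit V J X t M r"
  shows "is_limit C J (\<lambda>\<beta>. ob (X \<beta>) i) (\<lambda>\<beta> \<gamma>. cmp (t \<beta> \<gamma>) i) (ob M i) (\<lambda>\<beta>. cmp (r \<beta>) i)"
proof -
  interpret V: category V by (rule category_invseq_cat)
  obtain L p where L: "is_limit V J X t L p" and
    lim: "\<And>i. is_limit C J (\<lambda>\<beta>. ob (X \<beta>) i) (\<lambda>\<beta> \<gamma>. cmp (t \<beta> \<gamma>) i) (ob L i) (\<lambda>\<beta>. cmp (p \<beta>) i)"
    by (rule ex_invseq_limit[OF U X t]) auto
  obtain u v where u: "u \<in> Hom V M L" and v: "v \<in> Hom V L M" and vu: "v \<cdot>\<^bsub>V\<^esub> u = Id V M"
    and uv: "u \<cdot>\<^bsub>V\<^esub> v = Id V L" and pu: "\<And>\<beta>. \<beta> \<in> J \<Longrightarrow> p \<beta> \<cdot>\<^bsub>V\<^esub> u = r \<beta>"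
    by (rule V.limits_isomorphic[OF M L t]) auto
  show ?thesis
  proof (rule is_limit_iso[OF lim invseq_Hom_cmp[OF u] invseq_Hom_cmp[OF v]])
    show "cmp v i \<cdot> cmp u i = Id C (ob M i)" using arg_cong[OF vu, of "\<lambda>x. cmp x i"] by simp
    show "cmp u i \<cdot> cmp v i = Id C (ob L i)" using arg_cong[OF uv, of "\<lambda>x. cmp x i"] by simp
    show "cmp (p \<beta>) i \<cdot> cmp u i = cmp (r \<beta>) i" if "\<beta> \<in> J" for \<beta>
      using arg_cong[OF pu[OF that], of "\<lambda>x. cmp x i"] by simp
  qed (use t invseq_Hom_cmp in blast)
qed

end

section \<open>Iterated images\<close>

lemma is_zero_unique: "\<lbrakk>is_zero \<alpha>; is_zero \<beta>\<rbrakk> \<Longrightarrow> \<alpha> = \<beta>"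
  unfolding is_zero_def by (meson antisym)

lemma ex_is_zero: "\<exists>\<zeta> :: 'w::wellorder. is_zero \<zeta>"
proof -
  have "is_zero (LEAST \<zeta> :: 'w. True)" unfolding is_zero_def by (auto intro: Least_le)
  then show ?thesis ..
qed

lemma is_succ_of_unique: "\<lbrakk>is_succ_of \<alpha> \<beta>; is_succ_of \<alpha> \<gamma>\<rbrakk> \<Longrightarrow> \<beta> = \<gamma>"
  unfolding is_succ_of_def by (meson leD linorder_less_linear)

lemma is_succ_of_not_zero: "is_succ_of \<alpha> \<beta> \<Longrightarrow> \<not> is_zero \<alpha>"
  unfolding is_succ_of_def is_zero_def by (meson leD)

lemma is_succ_of_less_iff: "is_succ_of \<alpha> \<beta> \<Longrightarrow> \<gamma> < \<alpha> \<longleftrightarrow> \<gamma> \<le> \<beta>"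
  unfolding is_succ_of_def by (meson leD leI le_less_trans)

text \<open>The bound \<open>l\<close> guarantees that something lies above \<alpha>; otherwise
  \<open>LEAST\<close> would be unspecified.\<close>

lemma is_succ_of_Least:
  fixes \<alpha> l :: "'w::wellorder"
  assumes "\<alpha> < l"
  shows "is_succ_of (LEAST \<gamma>. \<alpha> < \<gamma>) \<alpha>"
  unfolding is_succ_of_def using LeastI[of "\<lambda>\<gamma>. \<alpha> < \<gamma>", OF assms] by (auto intro: Least_le)

lemma limit_ordinal_succ_less:
  assumes "limit_ordinal l" "\<alpha> < l"
  shows "(LEAST \<gamma>. \<alpha> < \<gamma>) < l"
proof -
  have "(LEAST \<gamma>. \<alpha> < \<gamma>) \<le> l" using assms(2) by (rule Least_le)
  moreover have "(LEAST \<gamma>. \<alpha> < \<gamma>) \<noteq> l"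
    using is_succ_of_Least[OF assms(2)] assms(1) by (auto simp: limit_ordinal_def)
  ultimately show ?thesis by simp
qed

lemma limit_ordinal_zero_less: "\<lbrakk>limit_ordinal \<alpha>; is_zero \<zeta>\<rbrakk> \<Longrightarrow> \<zeta> < \<alpha>"
  unfolding limit_ordinal_def is_zero_def by (meson dual_order.trans not_le_imp_less)

lemma Least_greater_mono:
  fixes \<alpha> \<beta> l :: "'w::wellorder"
  assumes "\<alpha> \<le> \<beta>" "\<beta> < l"
  shows "(LEAST \<gamma>. \<alpha> < \<gamma>) \<le> (LEAST \<gamma>. \<beta> < \<gamma>)"
  by (rule Least_le) (use LeastI[of "\<lambda>\<gamma>. \<beta> < \<gamma>", OF assms(2)] assms(1) in auto)

section \<open>Unfolding the transfinite recursion\<close>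

lemma is_limit_cong:
  assumes "\<And>\<beta>. \<beta> \<in> J \<Longrightarrow> X \<beta> = X' \<beta>" "\<And>\<beta> \<gamma>. \<lbrakk>\<beta> \<in> J; \<gamma> \<in> J\<rbrakk> \<Longrightarrow> t \<beta> \<gamma> = t' \<beta> \<gamma>"
  shows "is_limit A J X t L p \<longleftrightarrow> is_limit A J X' t' L p"
proof -
  have "is_cone A J X t M q \<longleftrightarrow> is_cone A J X' t' M q" for M q
    using assms by (simp add: is_cone_def)
  then show ?thesis by (simp add: is_limit_def)
qed

lemma iter_image_zero: "is_zero \<alpha> \<Longrightarrow> iter_image A S \<alpha> = Id (invseq_cat A) S"
  by (subst iter_image.simps) simp

lemma iter_image_succ:
  assumes "is_succ_of \<alpha> \<beta>"
  shows "iter_image A S \<alpha> =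
    iter_image A S \<beta> \<cdot>\<^bsub>invseq_cat A\<^esub> image_incl A (src (iter_image A S \<beta>))"
proof -
  have "(THE \<beta>. is_succ_of \<alpha> \<beta>) = \<beta>" using assms is_succ_of_unique by blast
  moreover have "\<beta> < \<alpha>" using assms by (simp add: is_succ_of_def)
  ultimately show ?thesis
    using assms is_succ_of_not_zero[OF assms] by (subst iter_image.simps) (auto simp: Let_def)
qed

text \<open>The recursion selects a limit by \<open>SOME\<close>. The given limit \<open>L0\<close>
  shows that the selection succeeds; the selected \<open>L\<close> may be a different one.\<close>

lemma iter_image_limit:
  assumes "limit_ordinal \<alpha>" "is_zero \<zeta>"
    and "is_limit (invseq_cat A) {..<\<alpha>} (\<lambda>\<beta>. src (iter_image A S \<beta>))
           (\<lambda>\<beta> \<gamma>. factor_through (invseq_cat A) (iter_image A S \<beta>) (iter_image A S \<gamma>)) L0 p0"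
  obtains L p where
    "is_limit (invseq_cat A) {..<\<alpha>} (\<lambda>\<beta>. src (iter_image A S \<beta>))
       (\<lambda>\<beta> \<gamma>. factor_through (invseq_cat A) (iter_image A S \<beta>) (iter_image A S \<gamma>)) L p"
    "iter_image A S \<alpha> = p \<zeta>"
proof -
  define lim where "lim = (\<lambda>(L, p). is_limit (invseq_cat A) {..<\<alpha>} (\<lambda>\<beta>. src (iter_image A S \<beta>))
    (\<lambda>\<beta> \<gamma>. factor_through (invseq_cat A) (iter_image A S \<beta>) (iter_image A S \<gamma>)) L p)"
  define M where "M = (\<lambda>\<beta>. if \<beta> < \<alpha> then iter_image A S \<beta> else undefined)"
  obtain L p where Lp: "(SOME x. lim x) = (L, p)" by (cases "SOME x. lim x")
  have "lim (SOME x. lim x)" by (rule someI[of lim "(L0, p0)"]) (use assms(3) in \<open>simp add: lim_def\<close>)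
  then have L: "lim (L, p)" by (simp add: Lp)
  \<comment> \<open>The guard in \<open>M\<close> has an effect only outside
    \<open>{..<\<alpha>}\<close>, where \<open>is_limit\<close> does not look.\<close>
  have eq: "(\<lambda>(L, p). is_limit (invseq_cat A) {..<\<alpha>} (\<lambda>\<beta>. src (M \<beta>))
      (\<lambda>\<beta> \<gamma>. factor_through (invseq_cat A) (M \<beta>) (M \<gamma>)) L p) = lim"
    unfolding lim_def
    by (intro ext, clarify) (rule is_limit_cong, auto simp: M_def)
  have not_zero: "\<not> is_zero \<alpha>" and not_succ: "\<not> (\<exists>\<beta>. is_succ_of \<alpha> \<beta>)"
    using assms(1) by (auto simp: limit_ordinal_def)
  have the_zero: "(THE \<zeta>. is_zero \<zeta>) = \<zeta>" using assms(2) is_zero_unique by blast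
  have "iter_image A S \<alpha> = (let (L, p) = (SOME x. lim x) in p \<zeta>)"
    by (subst iter_image.simps) (simp only: not_zero not_succ if_False Let_def eq[unfolded M_def] the_zero)
  then have "iter_image A S \<alpha> = p \<zeta>" by (simp add: Lp)
  then show ?thesis using that L by (simp add: lim_def)
qed

context abelian_category
begin

section \<open>The iterated images as nested subobjects\<close>

text \<open>The bonding maps of the image sequence are given by \<open>THE\<close>. If
  \<open>bond T i\<close> is \<open>m i \<cdot> e i\<close>, then
  \<open>e i \<cdot> m (Suc i)\<close> is a solution, and it is unique because \<open>m i\<close> is
  monic.\<close>

lemma image_incl_Hom:
  assumes "inverse_sequence C T"
  shows "image_incl C T \<in> Hom V (src (image_incl C T)) T"
    and "cmp (image_incl C T) i = im C (bond T i)"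
proof -
  have b: "bond T i \<in> Hom C (ob T (Suc i)) (ob T i)" for i
    using assms by (rule inverse_sequence_bond)
  define m where "m = (\<lambda>i. im C (bond T i))"
  have "\<exists>e. e \<in> Hom C (ob T (Suc i)) (Dom C (m i)) \<and> m i \<cdot> e = bond T i" for i
    by (rule im_factorization[OF b[of i]]) (auto simp: m_def)
  then obtain e where e: "\<And>i. e i \<in> Hom C (ob T (Suc i)) (Dom C (m i))" "\<And>i. m i \<cdot> e i = bond T i"
    by metis
  have m: "monic C (m i)" "m i \<in> Hom C (Dom C (m i)) (ob T i)" for i
    by (rule im_factorization[OF b[of i]], simp add: m_def)+
  define g where "g = (\<lambda>i. THE g. g \<in> Hom C (Dom C (m (Suc i))) (Dom C (m i)) \<and>
    m i \<cdot> g = bond T i \<cdot> m (Suc i))"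
  have g: "g i \<in> Hom C (Dom C (m (Suc i))) (Dom C (m i)) \<and> m i \<cdot> g i = bond T i \<cdot> m (Suc i)" for i
    unfolding g_def
  proof (rule theI', rule ex1I[of _ "e i \<cdot> m (Suc i)"])
    show "e i \<cdot> m (Suc i) \<in> Hom C (Dom C (m (Suc i))) (Dom C (m i)) \<and>
        m i \<cdot> (e i \<cdot> m (Suc i)) = bond T i \<cdot> m (Suc i)"
      using e(1)[of i] m(2)[of "Suc i"] m(2)[of i]
      by (subst e(2)[of i, symmetric]) (simp add: Hom_iff assoc)
    then show "h = e i \<cdot> m (Suc i)"
      if "h \<in> Hom C (Dom C (m (Suc i))) (Dom C (m i)) \<and> m i \<cdot> h = bond T i \<cdot> m (Suc i)" for h
      using that monicD[OF m(1)[of i], of h _ "e i \<cdot> m (Suc i)"] by auto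
  qed
  have incl: "image_incl C T = \<lparr>src = \<lparr>ob = \<lambda>i. Dom C (m i), bond = g\<rparr>, tgt = T, cmp = m\<rparr>"
    by (simp add: image_incl_def m_def g_def)
  show "image_incl C T \<in> Hom V (src (image_incl C T)) T"
    using m(2) g assms by (auto simp: incl invseq_Hom_iff inverse_sequence_def Hom_iff)
  show "cmp (image_incl C T) i = im C (bond T i)" by (simp add: incl m_def)
qed

end

text \<open>Smallness of the set of ordinals below \<open>l\<close> provides the limits at all limit
  stages up to \<open>l\<close>.\<close>

locale iterated_images = abelian_category +
  fixes S :: "('a, 'b) invseq" and l :: "'w::wellorder" and U :: "'u itself"
  assumes universe: "grothendieck_universe U"
    and exact_products: "has_exact_small_products U C"
    and S: "inverse_sequence C S"
    and small_l: "small U {..<l}"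
begin

abbreviation M where "M (\<alpha> :: 'w) \<equiv> iter_image C S \<alpha>"

text \<open>The invariant of the transfinite induction. The last clause makes
  \<open>factor_through\<close> meaningful as a transition map, on which the diagram at the next
  limit stage depends.\<close>

definition nested :: "'w \<Rightarrow> bool" where
  "nested \<alpha> \<longleftrightarrow> M \<alpha> \<in> Hom V (src (M \<alpha>)) S \<and> (\<forall>i. monic C (cmp (M \<alpha>) i)) \<and>
     (\<forall>\<beta>\<le>\<alpha>. \<forall>i. \<exists>u. u \<in> Hom C (ob (src (M \<alpha>)) i) (ob (src (M \<beta>)) i) \<and>
        cmp (M \<beta>) i \<cdot> u = cmp (M \<alpha>) i)"

lemma small_products: "has_small_products U C"
  using exact_products by (simp add: has_exact_small_products_def)

lemma small_below: "\<alpha> \<le> l \<Longrightarrow> small U {..<\<alpha>}"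
  by (rule small_lepoll[OF subset_imp_lepoll small_l]) auto

lemma nested_transition:
  assumes "nested \<beta>" "nested \<gamma>" "\<beta> \<le> \<gamma>"
  shows "factor_through V (M \<beta>) (M \<gamma>) \<in> Hom V (src (M \<gamma>)) (src (M \<beta>))"
    "M \<beta> \<cdot>\<^bsub>V\<^esub> factor_through V (M \<beta>) (M \<gamma>) = M \<gamma>"
  using invseq_factor_through[of "M \<beta>" "src (M \<beta>)" S "M \<gamma>" "src (M \<gamma>)"] assms
  by (auto simp: nested_def)

text \<open>For \<zeta> zero, \<open>M \<zeta>\<close> is the identity, so the transition map from
  stage \<beta> to stage \<zeta> is \<open>M \<beta>\<close> itself. The cone condition then turns
  \<open>M \<alpha>\<close>, the projection to stage \<zeta>, into the composite of
  \<open>M \<beta>\<close> with \<open>p \<beta>\<close>.\<close>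

lemma limit_stage:
  assumes lim: "limit_ordinal \<alpha>" and \<alpha>: "\<alpha> \<le> l" and nest: "\<And>\<beta>. \<beta> < \<alpha> \<Longrightarrow> nested \<beta>"
  obtains p where
    "\<And>\<beta>. \<beta> < \<alpha> \<Longrightarrow> p \<beta> \<in> Hom V (src (M \<alpha>)) (src (M \<beta>))"
    "\<And>\<beta>. \<beta> < \<alpha> \<Longrightarrow> M \<beta> \<cdot>\<^bsub>V\<^esub> p \<beta> = M \<alpha>"
    "\<And>i. is_limit C {..<\<alpha>} (\<lambda>\<beta>. ob (src (M \<beta>)) i)
       (\<lambda>\<beta> \<gamma>. cmp (factor_through V (M \<beta>) (M \<gamma>)) i) (ob (src (M \<alpha>)) i) (\<lambda>\<beta>. cmp (p \<beta>) i)"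
proof -
  interpret V: category V by (rule category_invseq_cat)
  obtain \<zeta> :: 'w where \<zeta>: "is_zero \<zeta>" using ex_is_zero by blast
  have \<zeta>_less: "\<zeta> < \<alpha>" by (rule limit_ordinal_zero_less[OF lim \<zeta>])
  have X: "inverse_sequence C (src (M \<beta>))" if "\<beta> \<in> {..<\<alpha>}" for \<beta>
    using nest that by (auto simp: nested_def invseq_Hom_iff)
  have t: "factor_through V (M \<beta>) (M \<gamma>) \<in> Hom V (src (M \<gamma>)) (src (M \<beta>))"
    if "\<beta> \<in> {..<\<alpha>}" "\<gamma> \<in> {..<\<alpha>}" "\<beta> \<le> \<gamma>" for \<beta> \<gamma>
    using nested_transition(1) nest that by auto
  note U = universe small_products small_below[OF \<alpha>]
  obtain L0 p0 where L0: "is_limit V {..<\<alpha>} (\<lambda>\<beta>. src (M \<beta>)) (\<lambda>\<beta> \<gamma>. factor_through V (M \<beta>) (M \<gamma>)) L0 p0"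
    by (rule ex_invseq_limit[OF U X t]) auto
  obtain L p where L: "is_limit V {..<\<alpha>} (\<lambda>\<beta>. src (M \<beta>)) (\<lambda>\<beta> \<gamma>. factor_through V (M \<beta>) (M \<gamma>)) L p"
    and M: "M \<alpha> = p \<zeta>"
    by (rule iter_image_limit[OF lim \<zeta> L0])
  have p: "p \<beta> \<in> Hom V L (src (M \<beta>))" if "\<beta> < \<alpha>" for \<beta>
    using L that by (auto simp: is_limit_def is_cone_def)
  have tp: "factor_through V (M \<zeta>) (M \<beta>) \<cdot>\<^bsub>V\<^esub> p \<beta> = p \<zeta>" if "\<beta> < \<alpha>" for \<beta>
    using L that \<zeta> \<zeta>_less by (auto simp: is_limit_def is_cone_def is_zero_def)
  have src: "src (M \<alpha>) = L" using p[OF \<zeta>_less] by (simp add: M invseq_Hom_iff)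
  have "M \<beta> \<cdot>\<^bsub>V\<^esub> p \<beta> = M \<alpha>" if \<beta>: "\<beta> < \<alpha>" for \<beta>
  proof -
    have le: "\<zeta> \<le> \<beta>" using \<zeta> by (simp add: is_zero_def)
    note f = nested_transition[OF nest[OF \<zeta>_less] nest[OF \<beta>] le]
    have "factor_through V (M \<zeta>) (M \<beta>) = Id V S \<cdot>\<^bsub>V\<^esub> factor_through V (M \<zeta>) (M \<beta>)"
      using f(1) by (intro V.Id_Comp[symmetric]) (simp add: iter_image_zero[OF \<zeta>])
    also have "\<dots> = M \<beta>" using f(2) by (simp add: iter_image_zero[OF \<zeta>])
    finally show ?thesis using tp[OF \<beta>] M by simp
  qed
  moreover have "is_limit C {..<\<alpha>} (\<lambda>\<beta>. ob (src (M \<beta>)) i)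
      (\<lambda>\<beta> \<gamma>. cmp (factor_through V (M \<beta>) (M \<gamma>)) i) (ob (src (M \<alpha>)) i) (\<lambda>\<beta>. cmp (p \<beta>) i)" for i
    unfolding src by (rule invseq_limit[OF U X t L])
  ultimately show ?thesis using that[of p] p src by simp
qed

text \<open>A limit stage is the intersection of the earlier ones: factorizations of the same
  \<open>x\<close> through all \<open>M \<beta>\<close> are compatible because each
  \<open>M \<beta>\<close> is monic, and so they form a cone.\<close>

lemma limit_stage_factor:
  assumes "limit_ordinal \<alpha>" "\<alpha> \<le> l" and nest: "\<And>\<beta>. \<beta> < \<alpha> \<Longrightarrow> nested \<beta>"
    and p: "\<And>\<beta>. \<beta> < \<alpha> \<Longrightarrow> p \<beta> \<in> Hom V (src (M \<alpha>)) (src (M \<beta>))"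
      "\<And>\<beta>. \<beta> < \<alpha> \<Longrightarrow> M \<beta> \<cdot>\<^bsub>V\<^esub> p \<beta> = M \<alpha>"
    and lim: "is_limit C {..<\<alpha>} (\<lambda>\<beta>. ob (src (M \<beta>)) i)
       (\<lambda>\<beta> \<gamma>. cmp (factor_through V (M \<beta>) (M \<gamma>)) i) (ob (src (M \<alpha>)) i) (\<lambda>\<beta>. cmp (p \<beta>) i)"
    and v: "\<And>\<beta>. \<beta> < \<alpha> \<Longrightarrow> v \<beta> \<in> Hom C W (ob (src (M \<beta>)) i) \<and> cmp (M \<beta>) i \<cdot> v \<beta> = x"
  obtains u where "u \<in> Hom C W (ob (src (M \<alpha>)) i)" "cmp (M \<alpha>) i \<cdot> u = x"
proof -
  obtain \<zeta> :: 'w where \<zeta>: "is_zero \<zeta>" using ex_is_zero by blast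
  have \<zeta>_less: "\<zeta> < \<alpha>" by (rule limit_ordinal_zero_less[OF assms(1) \<zeta>])
  have mA: "cmp (M \<beta>) i \<in> Hom C (ob (src (M \<beta>)) i) (ob S i)" if "\<beta> < \<alpha>" for \<beta>
    using nest[OF that] by (auto simp: nested_def invseq_Hom_cmp)
  have "is_cone C {..<\<alpha>} (\<lambda>\<beta>. ob (src (M \<beta>)) i)
       (\<lambda>\<beta> \<gamma>. cmp (factor_through V (M \<beta>) (M \<gamma>)) i) W v"
    unfolding is_cone_def
  proof (intro conjI ballI impI)
    show "W \<in> Obj C" using v[OF \<zeta>_less] Hom_Obj by blast
    show "v \<beta> \<in> Hom C W (ob (src (M \<beta>)) i)" if "\<beta> \<in> {..<\<alpha>}" for \<beta> using v that by auto
    fix \<beta> \<gamma> assume "\<beta> \<in> {..<\<alpha>}" "\<gamma> \<in> {..<\<alpha>}" and le: "\<beta> \<le> \<gamma>"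
    then have bg: "\<beta> < \<alpha>" "\<gamma> < \<alpha>" by auto
    let ?t = "factor_through V (M \<beta>) (M \<gamma>)"
    note t = nested_transition[OF nest[OF bg(1)] nest[OF bg(2)] le]
    note tc = invseq_Hom_cmp[OF t(1), of i]
    show "cmp ?t i \<cdot> v \<gamma> = v \<beta>"
    proof (rule monicD)
      show "monic C (cmp (M \<beta>) i)" using nest[OF bg(1)] by (simp add: nested_def)
      have "cmp (M \<beta>) i \<cdot> (cmp ?t i \<cdot> v \<gamma>) = (cmp (M \<beta>) i \<cdot> cmp ?t i) \<cdot> v \<gamma>"
        using mA[OF bg(1)] tc v[OF bg(2)] by (simp add: Hom_iff assoc)
      also have "cmp (M \<beta>) i \<cdot> cmp ?t i = cmp (M \<gamma>) i"
        using arg_cong[OF t(2), of "\<lambda>x. cmp x i"] by simp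
      finally show "cmp (M \<beta>) i \<cdot> (cmp ?t i \<cdot> v \<gamma>) = cmp (M \<beta>) i \<cdot> v \<beta>"
        using v bg by simp
    qed (use mA[OF bg(1)] tc v bg in \<open>auto simp: Hom_iff\<close>)
  qed
  then obtain u where u: "u \<in> Hom C W (ob (src (M \<alpha>)) i)" "\<And>\<beta>. \<beta> \<in> {..<\<alpha>} \<Longrightarrow> cmp (p \<beta>) i \<cdot> u = v \<beta>"
    by (rule is_limit_factor[OF lim]) auto
  have "cmp (M \<alpha>) i \<cdot> u = (cmp (M \<zeta>) i \<cdot> cmp (p \<zeta>) i) \<cdot> u"
    using arg_cong[OF p(2)[OF \<zeta>_less], of "\<lambda>x. cmp x i"] by simp
  also have "\<dots> = cmp (M \<zeta>) i \<cdot> (cmp (p \<zeta>) i \<cdot> u)"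
    using mA[OF \<zeta>_less] invseq_Hom_cmp[OF p(1)[OF \<zeta>_less], of i] u(1) by (simp add: Hom_iff assoc)
  also have "\<dots> = x" using u(2) v \<zeta>_less by simp
  finally show ?thesis using that u(1) by blast
qed

lemma nested:
  assumes "\<alpha> \<le> l"
  shows "nested \<alpha>"
  using assms
proof (induction \<alpha> rule: less_induct)
  case (less \<alpha>)
  have IH: "nested \<beta>" if "\<beta> < \<alpha>" for \<beta> using less that by auto
  have refl: "\<exists>u. u \<in> Hom C (ob (src (M \<alpha>)) i) (ob (src (M \<alpha>)) i) \<and> cmp (M \<alpha>) i \<cdot> u = cmp (M \<alpha>) i"
    if "M \<alpha> \<in> Hom V (src (M \<alpha>)) S" for i
    using invseq_Hom_cmp[OF that, of i] Hom_Obj[OF invseq_Hom_cmp[OF that, of i]] Comp_Id Id_Hom by blast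
  consider "is_zero \<alpha>" | \<beta> where "is_succ_of \<alpha> \<beta>" | "limit_ordinal \<alpha>"
    by (auto simp: limit_ordinal_def)
  then show ?case
  proof cases
    case 1
    have MI: "M \<alpha> = Id V S" by (rule iter_image_zero[OF 1])
    have "monic C (Id C (ob S i))" for i
      using inverse_sequence_ob[OF S, of i] by (auto simp: monic_def Hom_iff)
    then show ?thesis
      unfolding nested_def using refl invseq_Id_Hom[OF S] 1
      by (metis MI invseq_cat_simps(7,9) is_zero_def order_antisym)
  next
    case 2
    have \<beta>: "\<beta> < \<alpha>" using 2 by (simp add: is_succ_of_def)
    let ?I = "src (M \<beta>)"
    have N: "nested \<beta>" by (rule IH[OF \<beta>])
    have B: "M \<beta> \<in> Hom V ?I S" and mB: "\<And>i. monic C (cmp (M \<beta>) i)" using N by (auto simp: nested_def)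
    have I: "inverse_sequence C ?I" using B by (auto simp: invseq_Hom_iff)
    have eq: "M \<alpha> = M \<beta> \<cdot>\<^bsub>V\<^esub> image_incl C ?I" by (rule iter_image_succ[OF 2])
    have H: "M \<alpha> \<in> Hom V (src (M \<alpha>)) S"
      using invseq_Comp_Hom[OF image_incl_Hom(1)[OF I] B] by (simp add: eq)
    note incl = invseq_Hom_cmp[OF image_incl_Hom(1)[OF I]]
    have mono: "monic C (cmp (M \<alpha>) i)" for i
    proof -
      have "monic C (im C (bond ?I i))"
        by (rule im_factorization[OF inverse_sequence_bond[OF I, of i]])
      then show ?thesis
        using monic_Comp[OF _ mB[of i]] incl[of i] invseq_Hom_cmp[OF B, of i]
        by (simp add: eq image_incl_Hom(2)[OF I] Hom_iff)
    qed
    have "\<exists>u. u \<in> Hom C (ob (src (M \<alpha>)) i) (ob (src (M \<gamma>)) i) \<and> cmp (M \<gamma>) i \<cdot> u = cmp (M \<alpha>) i"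
      if "\<gamma> \<le> \<alpha>" for \<gamma> i
    proof (cases "\<gamma> = \<alpha>")
      case True
      then show ?thesis using refl[OF H] by simp
    next
      case False
      then have "\<gamma> \<le> \<beta>" using that is_succ_of_less_iff[OF 2, of \<gamma>] by auto
      then obtain u where u: "u \<in> Hom C (ob ?I i) (ob (src (M \<gamma>)) i)" "cmp (M \<gamma>) i \<cdot> u = cmp (M \<beta>) i"
        using N unfolding nested_def by blast
      have "\<gamma> < \<alpha>" using that False by simp
      then have "cmp (M \<gamma>) i \<in> Hom C (ob (src (M \<gamma>)) i) (ob S i)"
        using IH by (auto simp: nested_def invseq_Hom_cmp)
      then have "cmp (M \<gamma>) i \<cdot> (u \<cdot> cmp (image_incl C ?I) i) = cmp (M \<alpha>) i"
        using u incl[of i] by (simp add: eq Hom_iff assoc[symmetric])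
      moreover have "u \<cdot> cmp (image_incl C ?I) i \<in> Hom C (ob (src (M \<alpha>)) i) (ob (src (M \<gamma>)) i)"
        using u(1) incl[of i] by (simp add: eq Hom_iff)
      ultimately show ?thesis by blast
    qed
    then show ?thesis unfolding nested_def using H mono by blast
  next
    case 3
    obtain p where p: "\<And>\<beta>. \<beta> < \<alpha> \<Longrightarrow> p \<beta> \<in> Hom V (src (M \<alpha>)) (src (M \<beta>))"
      "\<And>\<beta>. \<beta> < \<alpha> \<Longrightarrow> M \<beta> \<cdot>\<^bsub>V\<^esub> p \<beta> = M \<alpha>"
      and lim: "\<And>i. is_limit C {..<\<alpha>} (\<lambda>\<beta>. ob (src (M \<beta>)) i)
       (\<lambda>\<beta> \<gamma>. cmp (factor_through V (M \<beta>) (M \<gamma>)) i) (ob (src (M \<alpha>)) i) (\<lambda>\<beta>. cmp (p \<beta>) i)"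
      by (rule limit_stage[OF 3 less.prems IH]) auto
    obtain \<zeta> :: 'w where \<zeta>: "is_zero \<zeta>" using ex_is_zero by blast
    have \<zeta>_less: "\<zeta> < \<alpha>" by (rule limit_ordinal_zero_less[OF 3 \<zeta>])
    have B: "M \<beta> \<in> Hom V (src (M \<beta>)) S" and mB: "monic C (cmp (M \<beta>) i)" if "\<beta> < \<alpha>" for \<beta> i
      using IH[OF that] by (auto simp: nested_def)
    have H: "M \<alpha> \<in> Hom V (src (M \<alpha>)) S"
      using invseq_Comp_Hom[OF p(1)[OF \<zeta>_less] B[OF \<zeta>_less]] p(2)[OF \<zeta>_less] by simp
    have pc: "cmp (M \<beta>) i \<cdot> cmp (p \<beta>) i = cmp (M \<alpha>) i" if "\<beta> < \<alpha>" for \<beta> i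
      using arg_cong[OF p(2)[OF that], of "\<lambda>x. cmp x i"] by simp
    \<comment> \<open>The projections of a limit are jointly monic. Each of them, followed by the
      monomorphism \<open>M \<beta>\<close>, becomes \<open>M \<alpha>\<close>, so equality after
      \<open>M \<alpha>\<close> gives equality after every projection.\<close>
    have mono: "monic C (cmp (M \<alpha>) i)" for i
      unfolding monic_def
    proof (intro conjI allI ballI impI)
      note MA = invseq_Hom_cmp[OF H, of i]
      show "cmp (M \<alpha>) i \<in> Arr C" using MA by (simp add: Hom_iff)
      fix W g h assume "g \<in> Hom C W (Dom C (cmp (M \<alpha>) i))" "h \<in> Hom C W (Dom C (cmp (M \<alpha>) i))"
        and eq: "cmp (M \<alpha>) i \<cdot> g = cmp (M \<alpha>) i \<cdot> h"
      then have gh: "g \<in> Hom C W (ob (src (M \<alpha>)) i)" "h \<in> Hom C W (ob (src (M \<alpha>)) i)"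
        using MA by (auto simp: Hom_iff)
      show "g = h"
      proof (rule limit_unique[OF lim gh])
        fix \<beta> assume "\<beta> \<in> {..<\<alpha>}"
        then have \<beta>: "\<beta> < \<alpha>" by simp
        note P = invseq_Hom_cmp[OF p(1)[OF \<beta>], of i] and MB = invseq_Hom_cmp[OF B[OF \<beta>], of i]
        have "(cmp (M \<beta>) i \<cdot> cmp (p \<beta>) i) \<cdot> g = (cmp (M \<beta>) i \<cdot> cmp (p \<beta>) i) \<cdot> h"
          using eq pc[OF \<beta>] by simp
        then have "cmp (M \<beta>) i \<cdot> (cmp (p \<beta>) i \<cdot> g) = cmp (M \<beta>) i \<cdot> (cmp (p \<beta>) i \<cdot> h)"
          using P MB gh by (simp add: Hom_iff assoc)
        then show "cmp (p \<beta>) i \<cdot> g = cmp (p \<beta>) i \<cdot> h"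
          using P MB gh by - (rule monicD[OF mB[OF \<beta>, of i], of _ W], auto simp: Hom_iff)
      qed (use invseq_Hom_cmp[OF nested_transition(1)[OF IH IH]] in auto)
    qed
    have "\<exists>u. u \<in> Hom C (ob (src (M \<alpha>)) i) (ob (src (M \<gamma>)) i) \<and> cmp (M \<gamma>) i \<cdot> u = cmp (M \<alpha>) i"
      if "\<gamma> \<le> \<alpha>" for \<gamma> i
    proof (cases "\<gamma> = \<alpha>")
      case True
      then show ?thesis using refl[OF H] by simp
    next
      case False
      then have "\<gamma> < \<alpha>" using that by simp
      then show ?thesis using pc invseq_Hom_cmp[OF p(1)] by blast
    qed
    then show ?thesis unfolding nested_def using H mono by blast
  qed
qed

section \<open>Generalized elements of the iterated images\<close>

definition lies_in :: "'w \<Rightarrow> nat \<Rightarrow> 'b \<Rightarrow> bool" where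
  "lies_in \<alpha> i x \<longleftrightarrow> (\<exists>u. u \<in> Hom C (Dom C x) (ob (src (M \<alpha>)) i) \<and> cmp (M \<alpha>) i \<cdot> u = x)"

lemma M_Hom: "\<alpha> \<le> l \<Longrightarrow> M \<alpha> \<in> Hom V (src (M \<alpha>)) S"
  and M_monic: "\<alpha> \<le> l \<Longrightarrow> monic C (cmp (M \<alpha>) i)"
  using nested by (auto simp: nested_def)

lemma M_cmp: "\<alpha> \<le> l \<Longrightarrow> cmp (M \<alpha>) i \<in> Hom C (ob (src (M \<alpha>)) i) (ob S i)"
  using M_Hom invseq_Hom_cmp by blast

lemma lies_inE:
  assumes "lies_in \<alpha> i x" "x \<in> Hom C W Y"
  obtains u where "u \<in> Hom C W (ob (src (M \<alpha>)) i)" "cmp (M \<alpha>) i \<cdot> u = x"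
  using assms by (auto simp: lies_in_def Hom_iff)

lemma lies_inI:
  assumes "u \<in> Hom C W (ob (src (M \<alpha>)) i)" "\<alpha> \<le> l"
  shows "lies_in \<alpha> i (cmp (M \<alpha>) i \<cdot> u)"
  using assms M_cmp[OF assms(2), of i] by (auto simp: lies_in_def Hom_iff)

lemma lies_in_Hom:
  assumes "lies_in \<alpha> i x" "\<alpha> \<le> l"
  shows "x \<in> Hom C (Dom C x) (ob S i)"
  using assms Comp_Hom M_cmp unfolding lies_in_def by blast

lemma lies_in_Comp:
  assumes "lies_in \<alpha> i x" "\<alpha> \<le> l" "x \<in> Hom C W Y" "e \<in> Hom C T W"
  shows "lies_in \<alpha> i (x \<cdot> e)"
proof -
  obtain u where u: "u \<in> Hom C W (ob (src (M \<alpha>)) i)" "cmp (M \<alpha>) i \<cdot> u = x"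
    using lies_inE[OF assms(1,3)] .
  then have "x \<cdot> e = cmp (M \<alpha>) i \<cdot> (u \<cdot> e)" using M_cmp[OF assms(2), of i] assms(4) by (auto simp: Hom_iff assoc)
  then show ?thesis using lies_inI[OF Comp_Hom[OF assms(4) u(1)] assms(2)] by simp
qed

lemma lies_in_Add:
  assumes "lies_in \<alpha> i x" "lies_in \<alpha> i y" "\<alpha> \<le> l" "x \<in> Hom C W (ob S i)" "y \<in> Hom C W (ob S i)"
  shows "lies_in \<alpha> i (x \<boxplus> y)"
proof -
  obtain u where u: "u \<in> Hom C W (ob (src (M \<alpha>)) i)" "cmp (M \<alpha>) i \<cdot> u = x"
    using lies_inE[OF assms(1,4)] .
  obtain v where v: "v \<in> Hom C W (ob (src (M \<alpha>)) i)" "cmp (M \<alpha>) i \<cdot> v = y"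
    using lies_inE[OF assms(2,5)] .
  show ?thesis
    using lies_inI[OF Add_Hom[OF u(1) v(1)] assms(3)] Comp_Add_right[OF u(1) v(1) M_cmp[OF assms(3)]] u v
    by simp
qed

lemma lies_in_antimono:
  assumes "lies_in \<alpha> i x" "\<beta> \<le> \<alpha>" "\<alpha> \<le> l"
  shows "lies_in \<beta> i x"
proof -
  have x: "x \<in> Hom C (Dom C x) (ob S i)" by (rule lies_in_Hom[OF assms(1,3)])
  obtain u where u: "u \<in> Hom C (Dom C x) (ob (src (M \<alpha>)) i)" "cmp (M \<alpha>) i \<cdot> u = x"
    using lies_inE[OF assms(1) x] .
  obtain v where v: "v \<in> Hom C (ob (src (M \<alpha>)) i) (ob (src (M \<beta>)) i)" "cmp (M \<beta>) i \<cdot> v = cmp (M \<alpha>) i"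
    using nested[OF assms(3)] assms(2) unfolding nested_def by blast
  have \<beta>: "\<beta> \<le> l" using assms by simp
  have "cmp (M \<beta>) i \<cdot> (v \<cdot> u) = (cmp (M \<beta>) i \<cdot> v) \<cdot> u"
    using u(1) v(1) M_cmp[OF \<beta>, of i] by (simp add: Hom_iff assoc)
  then show ?thesis using lies_inI[OF Comp_Hom[OF u(1) v(1)] \<beta>] u v by simp
qed

lemma lies_in_zero:
  assumes "is_zero \<alpha>" "x \<in> Hom C W (ob S i)"
  shows "lies_in \<alpha> i x"
  using assms by (auto simp: lies_in_def iter_image_zero Hom_iff)

text \<open>Factorizations chosen at all earlier stages are glued by
  \<open>limit_stage_factor\<close>.\<close>

lemma lies_in_limit:
  assumes "limit_ordinal \<alpha>" "\<alpha> \<le> l" "x \<in> Hom C W (ob S i)" "\<And>\<beta>. \<beta> < \<alpha> \<Longrightarrow> lies_in \<beta> i x"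
  shows "lies_in \<alpha> i x"
proof -
  have N: "nested \<beta>" if "\<beta> < \<alpha>" for \<beta> using that assms(2) nested by simp
  obtain p where p: "\<And>\<beta>. \<beta> < \<alpha> \<Longrightarrow> p \<beta> \<in> Hom V (src (M \<alpha>)) (src (M \<beta>))"
    "\<And>\<beta>. \<beta> < \<alpha> \<Longrightarrow> M \<beta> \<cdot>\<^bsub>V\<^esub> p \<beta> = M \<alpha>"
    and lim: "\<And>i. is_limit C {..<\<alpha>} (\<lambda>\<beta>. ob (src (M \<beta>)) i)
     (\<lambda>\<beta> \<gamma>. cmp (factor_through V (M \<beta>) (M \<gamma>)) i) (ob (src (M \<alpha>)) i) (\<lambda>\<beta>. cmp (p \<beta>) i)"
    by (rule limit_stage[OF assms(1,2) N]) auto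
  have "\<forall>\<beta>\<in>{..<\<alpha>}. \<exists>u. u \<in> Hom C W (ob (src (M \<beta>)) i) \<and> cmp (M \<beta>) i \<cdot> u = x"
    using assms(3,4) lies_inE by (metis lessThan_iff)
  then obtain v where v: "\<And>\<beta>. \<beta> < \<alpha> \<Longrightarrow> v \<beta> \<in> Hom C W (ob (src (M \<beta>)) i) \<and> cmp (M \<beta>) i \<cdot> v \<beta> = x"
    by (metis lessThan_iff)
  obtain u where "u \<in> Hom C W (ob (src (M \<alpha>)) i)" "cmp (M \<alpha>) i \<cdot> u = x"
    by (rule limit_stage_factor[OF assms(1,2) N p lim v])
  then show ?thesis using lies_inI assms(2) by blast
qed

lemma lies_in_bond:
  assumes "lies_in \<alpha> (Suc i) x" "\<alpha> \<le> l"
  shows "lies_in \<alpha> i (bond S i \<cdot> x)"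
proof -
  have x: "x \<in> Hom C (Dom C x) (ob S (Suc i))" by (rule lies_in_Hom[OF assms])
  obtain u where u: "u \<in> Hom C (Dom C x) (ob (src (M \<alpha>)) (Suc i))" "cmp (M \<alpha>) (Suc i) \<cdot> u = x"
    using lies_inE[OF assms(1) x] .
  note MH = M_Hom[OF assms(2)]
  have I: "bond (src (M \<alpha>)) i \<in> Hom C (ob (src (M \<alpha>)) (Suc i)) (ob (src (M \<alpha>)) i)"
    using invseq_Hom_inverse_sequence[OF MH] inverse_sequence_bond by blast
  note H = I u(1) M_cmp[OF assms(2), of i] M_cmp[OF assms(2), of "Suc i"] inverse_sequence_bond[OF S, of i]
  have "bond S i \<cdot> (cmp (M \<alpha>) (Suc i) \<cdot> u) = (bond S i \<cdot> cmp (M \<alpha>) (Suc i)) \<cdot> u"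
    using H by (simp add: Hom_iff assoc)
  also have "\<dots> = cmp (M \<alpha>) i \<cdot> (bond (src (M \<alpha>)) i \<cdot> u)"
    using H by (subst invseq_Hom_bond[OF MH]) (simp add: Hom_iff assoc)
  finally show ?thesis using lies_inI[OF Comp_Hom[OF u(1) I] assms(2)] u(2) by simp
qed

text \<open>Stage \<alpha> at index i is the image of the bonding map of stage \<beta>. The gain of
  one stage over \<open>lies_in_bond\<close> drives the induction in
  \<open>lies_in_of_differences\<close>.\<close>

lemma lies_in_succI:
  assumes "is_succ_of \<alpha> \<beta>" "lies_in \<beta> (Suc i) y" "\<alpha> \<le> l"
  shows "lies_in \<alpha> i (bond S i \<cdot> y)"
proof -
  have \<beta>: "\<beta> \<le> l" using assms(1,3) by (auto simp: is_succ_of_def)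
  have y: "y \<in> Hom C (Dom C y) (ob S (Suc i))" by (rule lies_in_Hom[OF assms(2) \<beta>])
  obtain u where u: "u \<in> Hom C (Dom C y) (ob (src (M \<beta>)) (Suc i))" "cmp (M \<beta>) (Suc i) \<cdot> u = y"
    using lies_inE[OF assms(2) y] .
  note MH = M_Hom[OF \<beta>]
  let ?I = "src (M \<beta>)"
  have IS: "inverse_sequence C ?I" using invseq_Hom_inverse_sequence[OF MH] by blast
  have I: "bond ?I i \<in> Hom C (ob ?I (Suc i)) (ob ?I i)" by (rule inverse_sequence_bond[OF IS])
  obtain e where m: "im C (bond ?I i) \<in> Hom C (Dom C (im C (bond ?I i))) (ob ?I i)"
    and e: "e \<in> Hom C (ob ?I (Suc i)) (Dom C (im C (bond ?I i)))" "im C (bond ?I i) \<cdot> e = bond ?I i"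
    by (rule im_factorization[OF I])
  have eq: "M \<alpha> = M \<beta> \<cdot>\<^bsub>V\<^esub> image_incl C ?I" by (rule iter_image_succ[OF assms(1)])
  have eqi: "cmp (M \<alpha>) i = cmp (M \<beta>) i \<cdot> im C (bond ?I i)"
    by (simp add: eq image_incl_Hom(2)[OF IS])
  have ob: "ob (src (M \<alpha>)) i = Dom C (im C (bond ?I i))"
    using M_cmp[OF assms(3), of i] m M_cmp[OF \<beta>, of i] by (simp add: eqi Hom_iff)
  note H = I u(1) M_cmp[OF \<beta>, of i] M_cmp[OF \<beta>, of "Suc i"] inverse_sequence_bond[OF S, of i] m e(1)
  have "bond S i \<cdot> (cmp (M \<beta>) (Suc i) \<cdot> u) = (bond S i \<cdot> cmp (M \<beta>) (Suc i)) \<cdot> u"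
    using H by (simp add: Hom_iff assoc)
  also have "\<dots> = cmp (M \<beta>) i \<cdot> (bond ?I i \<cdot> u)"
    using H by (subst invseq_Hom_bond[OF MH]) (simp add: Hom_iff assoc)
  also have "\<dots> = cmp (M \<alpha>) i \<cdot> (e \<cdot> u)"
    using H by (subst e(2)[symmetric]) (simp add: eqi Hom_iff assoc)
  finally have "bond S i \<cdot> y = cmp (M \<alpha>) i \<cdot> (e \<cdot> u)" using u(2) by simp
  moreover have "e \<cdot> u \<in> Hom C (Dom C y) (ob (src (M \<alpha>)) i)" using ob H by (simp add: Hom_iff)
  ultimately show ?thesis using lies_inI assms(3) by simp
qed

text \<open>The bonding map of stage \<beta> is epic onto its image but need not split, so a
  preimage of \<open>x\<close> is obtained by pulling this epimorphism back along the factorization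
  of \<open>x\<close>.\<close>

lemma lies_in_succE:
  assumes "is_succ_of \<alpha> \<beta>" "lies_in \<alpha> i x" "\<alpha> \<le> l" "x \<in> Hom C W (ob S i)"
  obtains T e y where "epic C e" "e \<in> Hom C T W" "y \<in> Hom C T (ob S (Suc i))" "lies_in \<beta> (Suc i) y"
    "bond S i \<cdot> y = x \<cdot> e"
proof -
  have \<beta>: "\<beta> \<le> l" using assms(1,3) by (auto simp: is_succ_of_def)
  note MH = M_Hom[OF \<beta>]
  let ?I = "src (M \<beta>)"
  have IS: "inverse_sequence C ?I" using invseq_Hom_inverse_sequence[OF MH] by blast
  have I: "bond ?I i \<in> Hom C (ob ?I (Suc i)) (ob ?I i)" by (rule inverse_sequence_bond[OF IS])
  obtain e where m: "im C (bond ?I i) \<in> Hom C (Dom C (im C (bond ?I i))) (ob ?I i)"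
    and e: "e \<in> Hom C (ob ?I (Suc i)) (Dom C (im C (bond ?I i)))" "im C (bond ?I i) \<cdot> e = bond ?I i" "epic C e"
    by (rule im_factorization[OF I])
  have eq: "M \<alpha> = M \<beta> \<cdot>\<^bsub>V\<^esub> image_incl C ?I" by (rule iter_image_succ[OF assms(1)])
  have eqi: "cmp (M \<alpha>) i = cmp (M \<beta>) i \<cdot> im C (bond ?I i)"
    by (simp add: eq image_incl_Hom(2)[OF IS])
  have ob: "ob (src (M \<alpha>)) i = Dom C (im C (bond ?I i))"
    using M_cmp[OF assms(3), of i] m M_cmp[OF \<beta>, of i] by (simp add: eqi Hom_iff)
  obtain u where u: "u \<in> Hom C W (ob (src (M \<alpha>)) i)" "cmp (M \<alpha>) i \<cdot> u = x"
    using lies_inE[OF assms(2,4)] .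
  obtain T d b where d: "epic C d" "d \<in> Hom C T W" "b \<in> Hom C T (ob ?I (Suc i))" "e \<cdot> b = u \<cdot> d"
    by (rule epic_pullback[OF e(3,1) u(1)[unfolded ob]])
  note H = I u(1)[unfolded ob] M_cmp[OF \<beta>, of i] M_cmp[OF \<beta>, of "Suc i"] inverse_sequence_bond[OF S, of i]
    m e(1) d(2,3)
  have "bond S i \<cdot> (cmp (M \<beta>) (Suc i) \<cdot> b) = (bond S i \<cdot> cmp (M \<beta>) (Suc i)) \<cdot> b"
    using H by (simp add: Hom_iff assoc)
  also have "\<dots> = cmp (M \<beta>) i \<cdot> (bond ?I i \<cdot> b)"
    using H by (subst invseq_Hom_bond[OF MH]) (simp add: Hom_iff assoc)
  also have "\<dots> = cmp (M \<alpha>) i \<cdot> (e \<cdot> b)"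
    using H by (subst e(2)[symmetric]) (simp add: eqi Hom_iff assoc)
  also have "\<dots> = (cmp (M \<alpha>) i \<cdot> u) \<cdot> d"
    using H d(4) by (simp add: eqi Hom_iff assoc)
  finally have "bond S i \<cdot> (cmp (M \<beta>) (Suc i) \<cdot> b) = x \<cdot> d" using u(2) by simp
  then show ?thesis
    using that[OF d(1,2) Comp_Hom[OF d(3) M_cmp[OF \<beta>]] lies_inI[OF d(3) \<beta>]] by simp
qed

text \<open>This says that \<open>lim S\<^sup>\<alpha> = 0\<close>.\<close>

lemma lies_in_of_differences:
  assumes "\<alpha> \<le> l" "\<And>n. n \<ge> N \<Longrightarrow> y n \<in> Hom C W (ob S n)"
    and "\<And>n. n \<ge> N \<Longrightarrow> lies_in \<alpha> n (y n \<boxminus> bond S n \<cdot> y (Suc n))" and "n \<ge> N"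
  shows "lies_in \<alpha> n (y n)"
  using assms(1,3,4)
proof (induction \<alpha> arbitrary: n rule: less_induct)
  case (less \<alpha>)
  have IH: "lies_in \<beta> n (y n)" if "\<beta> < \<alpha>" "n \<ge> N" for \<beta> n
  proof (rule less.IH[OF that(1)])
    show "lies_in \<beta> n (y n \<boxminus> bond S n \<cdot> y (Suc n))" if "n \<ge> N" for n
      using lies_in_antimono[OF less.prems(2)[OF that] _ less.prems(1)] \<open>\<beta> < \<alpha>\<close> by simp
  qed (use that less.prems in auto)
  consider "is_zero \<alpha>" | \<beta> where "is_succ_of \<alpha> \<beta>" | "limit_ordinal \<alpha>"
    by (auto simp: limit_ordinal_def)
  then show ?case
  proof cases
    case 1
    then show ?thesis using lies_in_zero assms(2) less.prems by blast
  next
    case 2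
    then have "\<beta> < \<alpha>" by (simp add: is_succ_of_def)
    \<comment> \<open>The induction hypothesis is used at index n + 1, hence the arbitrary
      \<open>n\<close>; one bonding map then leads from stage \<beta> to its successor
      \<alpha>.\<close>
    then have "lies_in \<alpha> n (bond S n \<cdot> y (Suc n))"
      using lies_in_succI[OF 2 IH less.prems(1)] less.prems(3) by simp
    moreover have y: "y n \<in> Hom C W (ob S n)" "bond S n \<cdot> y (Suc n) \<in> Hom C W (ob S n)"
      using assms(2) less.prems(3) Comp_Hom[OF _ inverse_sequence_bond[OF S]] by auto
    ultimately have "lies_in \<alpha> n (y n \<boxminus> bond S n \<cdot> y (Suc n) \<boxplus> bond S n \<cdot> y (Suc n))"
      using lies_in_Add less.prems diff_Hom by blast
    then show ?thesis using Hom_group_laws(5)[OF y] by simp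
  next
    case 3
    then show ?thesis using lies_in_limit[OF 3 less.prems(1)] IH assms(2) less.prems(3) by blast
  qed
qed

section \<open>The quotients by the iterated images\<close>

lemma quot_map_cokernel:
  assumes "\<alpha> \<le> l"
  shows "is_cokernel V (M \<alpha>) (quot_map C S \<alpha>)"
    and "is_cokernel C (cmp (M \<alpha>) i) (cmp (quot_map C S \<alpha>) i)"
proof -
  show c: "is_cokernel V (M \<alpha>) (quot_map C S \<alpha>)"
    unfolding quot_map_def by (rule ex_invseq_cokernel[OF M_Hom[OF assms]]) (rule someI)
  show "is_cokernel C (cmp (M \<alpha>) i) (cmp (quot_map C S \<alpha>) i)"
    by (rule invseq_cokernel[OF M_Hom[OF assms] c])
qed

abbreviation Q where "Q (\<alpha> :: 'w) \<equiv> quot_map C S \<alpha>"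

lemma Q_Hom: "\<alpha> \<le> l \<Longrightarrow> Q \<alpha> \<in> Hom V S (tgt (Q \<alpha>))"
  using quot_map_cokernel(1) M_Hom by (fastforce simp: is_cokernel_def invseq_Hom_iff)

lemma Q_cmp: "\<alpha> \<le> l \<Longrightarrow> cmp (Q \<alpha>) i \<in> Hom C (ob S i) (ob (tgt (Q \<alpha>)) i)"
  using Q_Hom invseq_Hom_cmp by blast

lemma Q_epic: "\<alpha> \<le> l \<Longrightarrow> epic C (cmp (Q \<alpha>) i)"
  using quot_map_cokernel(2) is_cokernel_epic by blast

text \<open>A monomorphism is the kernel of its cokernel. Membership thereby becomes an equation in
  the quotient, which differences and compositions respect.\<close>

lemma lies_in_iff:
  assumes "\<alpha> \<le> l" "x \<in> Hom C W (ob S i)"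
  shows "lies_in \<alpha> i x \<longleftrightarrow> cmp (Q \<alpha>) i \<cdot> x = Zero C W (ob (tgt (Q \<alpha>)) i)"
proof
  have q: "cmp (Q \<alpha>) i \<cdot> cmp (M \<alpha>) i = Zero C (ob (src (M \<alpha>)) i) (ob (tgt (Q \<alpha>)) i)"
    using quot_map_cokernel(2)[OF assms(1), of i] M_cmp[OF assms(1), of i] Q_cmp[OF assms(1), of i]
    by (auto simp: is_cokernel_def Hom_iff)
  assume "lies_in \<alpha> i x"
  then obtain u where u: "u \<in> Hom C W (ob (src (M \<alpha>)) i)" "cmp (M \<alpha>) i \<cdot> u = x"
    using lies_inE assms(2) by blast
  have "cmp (Q \<alpha>) i \<cdot> (cmp (M \<alpha>) i \<cdot> u) = (cmp (Q \<alpha>) i \<cdot> cmp (M \<alpha>) i) \<cdot> u"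
    using u(1) M_cmp[OF assms(1), of i] Q_cmp[OF assms(1), of i] by (simp add: Hom_iff assoc)
  then show "cmp (Q \<alpha>) i \<cdot> x = Zero C W (ob (tgt (Q \<alpha>)) i)"
    using u q Zero_Comp[OF u(1)] Hom_Obj(2)[OF Q_cmp[OF assms(1)]] by simp
next
  assume z: "cmp (Q \<alpha>) i \<cdot> x = Zero C W (ob (tgt (Q \<alpha>)) i)"
  have k: "is_kernel C (cmp (Q \<alpha>) i) (cmp (M \<alpha>) i)"
    by (rule monic_kernel_of_cokernel[OF M_monic quot_map_cokernel(2)]) fact+
  obtain u where "u \<in> Hom C W (Dom C (cmp (M \<alpha>) i))" "cmp (M \<alpha>) i \<cdot> u = x"
    using is_kernel_factor[OF k, of x W] assms z Q_cmp[OF assms(1), of i] by (auto simp: Hom_iff)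
  then show "lies_in \<alpha> i x"
    using lies_inI[OF _ assms(1)] M_cmp[OF assms(1), of i] by (auto simp: Hom_iff)
qed

end

section \<open>Completeness\<close>

text \<open>The sequence consists of the running maxima of an enumeration of a countable cofinal
  set, which is nonempty because zero lies below \<open>l\<close>.\<close>

lemma cofinal_sequence:
  fixes l :: "'w::wellorder"
  assumes "limit_ordinal l" "countable_cofinality l"
  obtains g :: "nat \<Rightarrow> 'w" where "mono g" "\<And>n. g n < l" "\<And>\<beta>. \<beta> < l \<Longrightarrow> \<exists>n. \<beta> \<le> g n"
proof -
  obtain D where D: "D \<subseteq> {..<l}" "countable D" "\<And>\<beta>. \<beta> < l \<Longrightarrow> \<exists>\<gamma>\<in>D. \<beta> \<le> \<gamma>"
    using assms(2) unfolding countable_cofinality_def by blast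
  obtain \<zeta> :: 'w where "is_zero \<zeta>" using ex_is_zero by blast
  then have "\<zeta> < l" using limit_ordinal_zero_less[OF assms(1)] by blast
  then have D_ne: "D \<noteq> {}" using D(3) by blast
  define d where "d = from_nat_into D"
  have d: "range d = D" using range_from_nat_into[OF D_ne D(2)] by (simp add: d_def)
  define g where "g = (\<lambda>n. Max (d ` {..n}))"
  have "mono g" unfolding g_def by (intro monoI Max_mono) auto
  moreover have "g n < l" for n
  proof -
    have "g n \<in> d ` {..n}" unfolding g_def by (rule Max_in) auto
    then show ?thesis using d D(1) by auto
  qed
  moreover have "\<exists>n. \<beta> \<le> g n" if \<beta>: "\<beta> < l" for \<beta>
  proof -
    obtain n where "\<beta> \<le> d n" using D(3)[OF \<beta>] d by blast
    also have "d n \<le> g n" unfolding g_def by (rule Max_ge) auto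
    finally show ?thesis ..
  qed
  ultimately show ?thesis using that by blast
qed

context abelian_category
begin

section \<open>Solving equations by the vanishing of lim1\<close>

text \<open>The product is the one selected inside \<open>lim1\<close>, and \<open>d\<close> is the
  map 1 - F on it. The cokernel of \<open>d\<close> is a zero object, so \<open>d\<close> is
  epic.\<close>

lemma lim1_zero_epic:
  assumes U: "grothendieck_universe U" "has_small_products U C"
    and S: "inverse_sequence C S" and lim1: "zero_object C (lim1 C S)"
  obtains P p d where "is_product C UNIV (ob S) P p" "d \<in> Hom C P P" "epic C d"
    "\<And>j. p j \<cdot> d = p j \<boxminus> bond S j \<cdot> p (Suc j)"
proof -
  obtain P p where Pp: "(SOME (P, p). is_product C UNIV (ob S) P p) = (P, p)"
    by (cases "SOME (P, p). is_product C UNIV (ob S) P p")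
  have "small U (UNIV :: nat set)" using U(1) by (simp add: grothendieck_universe_def)
  then obtain P' p' where P': "is_product C UNIV (ob S) P' p'"
    by (rule ex_small_product[OF U(2), of UNIV "ob S"]) (use S in \<open>auto intro: inverse_sequence_ob\<close>)
  have "(\<lambda>(P, p). is_product C UNIV (ob S) P p) (SOME (P, p). is_product C UNIV (ob S) P p)"
    by (rule someI[of _ "(P', p')"]) (use P' in simp)
  then have P: "is_product C UNIV (ob S) P p" by (simp add: Pp)
  have pA: "P \<in> Obj C" "p j \<in> Hom C P (ob S j)" for j using P by (auto simp: is_product_def)
  have bp: "bond S j \<cdot> p (Suc j) \<in> Hom C P (ob S j)" for j
    using Comp_Hom[OF pA(2) inverse_sequence_bond[OF S]] .
  define F where "F = shift_map C S P p"
  have "F \<in> Hom C P P \<and> (\<forall>j. p j \<cdot> F = bond S j \<cdot> p (Suc j))"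
    unfolding F_def shift_map_def
  proof (rule theI')
    obtain G where "G \<in> Hom C P P" "\<And>j. p j \<cdot> G = bond S j \<cdot> p (Suc j)"
      by (rule product_factor[OF P pA(1), of "\<lambda>j. bond S j \<cdot> p (Suc j)"]) (use bp in auto)
    then show "\<exists>!F. F \<in> Hom C P P \<and> (\<forall>j. p j \<cdot> F = bond S j \<cdot> p (Suc j))"
      using product_unique[OF P] by (intro ex1I[of _ G]) auto
  qed
  then have F: "F \<in> Hom C P P" "\<And>j. p j \<cdot> F = bond S j \<cdot> p (Suc j)" by auto
  define d where "d = Id C P \<boxminus> F"
  have d: "d \<in> Hom C P P" unfolding d_def using diff_Hom Id_Hom pA(1) F(1) by blast
  have "p j \<cdot> d = p j \<boxminus> bond S j \<cdot> p (Suc j)" for j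
    using Comp_diff[OF Id_Hom[OF pA(1)] F(1) pA(2)] Comp_Id[OF pA(2)] F(2) by (simp add: d_def)
  moreover have "epic C d"
  proof -
    have "lim1 C S = Cod C (SOME q. is_cokernel C d q)"
      using F(1) by (simp add: lim1_def Pp d_def diff_def neg_def F_def Hom_iff Let_def)
    moreover have "is_cokernel C d (SOME q. is_cokernel C d q)"
      using someI_ex[OF ex_cokernel[of d]] d by (simp add: Hom_iff)
    ultimately show ?thesis using zero_cokernel_epic lim1 by metis
  qed
  ultimately show ?thesis using that P d by blast
qed

end

context iterated_images
begin

text \<open>The family \<open>z\<close> amounts to one arrow into the product. Over a cover it lifts
  along the epimorphism 1 - F, and the components of the lift solve the equations.\<close>

lemma lim1_zero_solve:
  assumes lim1: "zero_object C (lim1 C S)" and z: "\<And>n. z n \<in> Hom C W (ob S n)"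
  obtains T e y where "epic C e" "e \<in> Hom C T W" "\<And>n. y n \<in> Hom C T (ob S n)"
    "\<And>n. y n \<boxminus> bond S n \<cdot> y (Suc n) = z n \<cdot> e"
proof -
  obtain P p d where P: "is_product C UNIV (ob S) P p" and d: "d \<in> Hom C P P" "epic C d"
    and pd: "\<And>j. p j \<cdot> d = p j \<boxminus> bond S j \<cdot> p (Suc j)"
    by (rule lim1_zero_epic[OF universe small_products S lim1]) auto
  have pA: "p j \<in> Hom C P (ob S j)" for j using P by (auto simp: is_product_def)
  obtain h where h: "h \<in> Hom C W P" "\<And>n. p n \<cdot> h = z n"
    by (rule product_factor[OF P, of W z]) (use z Hom_Obj(1)[OF z] in auto)
  obtain T e a where e: "epic C e" "e \<in> Hom C T W" and a: "a \<in> Hom C T P" "d \<cdot> a = h \<cdot> e"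
    by (rule epic_pullback[OF d(2,1) h(1)])
  have "p n \<cdot> a \<boxminus> bond S n \<cdot> (p (Suc n) \<cdot> a) = z n \<cdot> e" for n
  proof -
    note b = inverse_sequence_bond[OF S, of n]
    have "p n \<cdot> a \<boxminus> bond S n \<cdot> (p (Suc n) \<cdot> a) = p n \<cdot> a \<boxminus> bond S n \<cdot> p (Suc n) \<cdot> a"
      using a(1) pA[of "Suc n"] b by (simp add: Hom_iff assoc)
    also have "\<dots> = (p n \<cdot> d) \<cdot> a"
      using diff_Comp[OF a(1) pA Comp_Hom[OF pA b]] pd by simp
    also have "\<dots> = p n \<cdot> (h \<cdot> e)" using a pA[of n] d(1) by (simp add: Hom_iff assoc)
    also have "\<dots> = z n \<cdot> e" using h(1) e(2) pA[of n] by (subst h(2)[symmetric]) (simp add: Hom_iff assoc)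
    finally show ?thesis .
  qed
  then show ?thesis using that[OF e, of "\<lambda>n. p n \<cdot> a"] Comp_Hom[OF a(1) pA] by blast
qed

section \<open>Descending finitely many stages\<close>

text \<open>The composite of n bonding maps from index i + n down to i. It is extended at its
  source, so that a lift found at i + n can be lifted one step further.\<close>

primrec bonds :: "nat \<Rightarrow> nat \<Rightarrow> 'b" where
  "bonds i 0 = Id C (ob S i)"
| "bonds i (Suc n) = bonds i n \<cdot> bond S (i + n)"

lemma bonds_Hom: "bonds i n \<in> Hom C (ob S (i + n)) (ob S i)"
proof (induction n)
  case 0
  then show ?case using Id_Hom inverse_sequence_ob[OF S] by simp
next
  case (Suc n)
  then show ?case using Comp_Hom[OF inverse_sequence_bond[OF S, of "i + n"] Suc] by simp
qed

lemma lies_in_bonds: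
  assumes "\<alpha> \<le> l" "lies_in \<alpha> (i + n) x"
  shows "lies_in \<alpha> i (bonds i n \<cdot> x)"
  using assms(2)
proof (induction n arbitrary: x)
  case 0
  then show ?case using Id_Comp[OF lies_in_Hom[OF 0 assms(1)]] by simp
next
  case (Suc n)
  have x: "x \<in> Hom C (Dom C x) (ob S (Suc (i + n)))" using lies_in_Hom[OF Suc.prems assms(1)] by simp
  have "bonds i (Suc n) \<cdot> x = bonds i n \<cdot> (bond S (i + n) \<cdot> x)"
    using x bonds_Hom[of i n] inverse_sequence_bond[OF S, of "i + n"] by (simp add: Hom_iff assoc)
  then show ?case using Suc.IH[OF lies_in_bond] Suc.prems assms(1) by simp
qed

text \<open>The ordinal successor, meaningful for \<alpha> below \<open>l\<close>; for limit
  \<open>l\<close>, \<open>(nxt ^^ n) \<alpha>\<close> is then the ordinal \<alpha> + n.\<close>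

abbreviation nxt :: "'w \<Rightarrow> 'w" where "nxt \<alpha> \<equiv> LEAST \<gamma>. \<alpha> < \<gamma>"

lemma nxt_funpow_less: "limit_ordinal l \<Longrightarrow> \<alpha> < l \<Longrightarrow> (nxt ^^ n) \<alpha> < l"
  by (induction n) (auto intro: limit_ordinal_succ_less)

lemma nxt_funpow_mono:
  "limit_ordinal l \<Longrightarrow> \<alpha> \<le> \<beta> \<Longrightarrow> \<beta> < l \<Longrightarrow> (nxt ^^ n) \<alpha> \<le> (nxt ^^ n) \<beta>"
  by (induction n) (auto intro: Least_greater_mono[of _ _ l] nxt_funpow_less)

lemma nxt_greater: "\<alpha> < l \<Longrightarrow> \<alpha> < nxt \<alpha>"
  using is_succ_of_Least[of \<alpha> l] by (simp add: is_succ_of_def)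

lemma nxt_funpow_ge: "limit_ordinal l \<Longrightarrow> \<alpha> < l \<Longrightarrow> \<alpha> \<le> (nxt ^^ n) \<alpha>"
  by (induction n) (auto intro: nxt_greater[OF nxt_funpow_less, THEN less_imp_le] order_trans)

text \<open>By \<open>lies_in_succE\<close>, each of the n steps gives up one stage, moves one index
  up and passes to a further cover; the covers are composed.\<close>

lemma lies_in_nxt_funpow:
  assumes "limit_ordinal l" "\<alpha> < l" "x \<in> Hom C W (ob S i)" "lies_in ((nxt ^^ n) \<alpha>) i x"
  obtains T e z where "epic C e" "e \<in> Hom C T W" "z \<in> Hom C T (ob S (i + n))" "lies_in \<alpha> (i + n) z"
    "bonds i n \<cdot> z = x \<cdot> e"
proof -
  have "\<exists>T e z. epic C e \<and> e \<in> Hom C T W \<and> z \<in> Hom C T (ob S (i + n)) \<and> lies_in \<alpha> (i + n) z \<and>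
    bonds i n \<cdot> z = x \<cdot> e"
    using assms(2,4)
  proof (induction n arbitrary: \<alpha>)
    case 0
    have W: "W \<in> Obj C" using assms(3) by (rule Hom_Obj)
    show ?case
      by (rule exI[of _ W], rule exI[of _ "Id C W"], rule exI[of _ x])
        (use 0 W assms(3) epic_Id Id_Hom Comp_Id Id_Comp in simp)
  next
    case (Suc n)
    have succ: "is_succ_of (nxt \<alpha>) \<alpha>" and less: "nxt \<alpha> < l"
      using is_succ_of_Least[OF Suc.prems(1)] limit_ordinal_succ_less[OF assms(1) Suc.prems(1)] .
    \<comment> \<open>The induction hypothesis is used for \<open>nxt \<alpha>\<close> in place of
      \<alpha>, which leaves the step from \<open>nxt \<alpha>\<close> down to \<alpha>.\<close>
    obtain T e z where e: "epic C e" "e \<in> Hom C T W" and z: "z \<in> Hom C T (ob S (i + n))"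
      "lies_in (nxt \<alpha>) (i + n) z" and eq: "bonds i n \<cdot> z = x \<cdot> e"
      using Suc.IH[OF less] Suc.prems(2) unfolding funpow_Suc_right comp_apply by blast
    obtain T' e' z' where e': "epic C e'" "e' \<in> Hom C T' T" and z': "z' \<in> Hom C T' (ob S (Suc (i + n)))"
      "lies_in \<alpha> (Suc (i + n)) z'" and eq': "bond S (i + n) \<cdot> z' = z \<cdot> e'"
      by (rule lies_in_succE[OF succ z(2) less_imp_le[OF less] z(1)])
    note H = e(2) e'(2) z(1) z'(1) bonds_Hom[of i n] inverse_sequence_bond[OF S, of "i + n"] assms(3)
    have "bonds i (Suc n) \<cdot> z' = bonds i n \<cdot> (bond S (i + n) \<cdot> z')" using H by (simp add: Hom_iff assoc)
    also have "\<dots> = (bonds i n \<cdot> z) \<cdot> e'" unfolding eq' using H by (simp add: Hom_iff assoc)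
    also have "\<dots> = x \<cdot> (e \<cdot> e')" unfolding eq using H by (simp add: Hom_iff assoc)
    finally have "bonds i (Suc n) \<cdot> z' = x \<cdot> (e \<cdot> e')" .
    moreover have "epic C (e \<cdot> e')" using epic_Comp[OF e'(1) e(1)] H by (simp add: Hom_iff)
    moreover have "e \<cdot> e' \<in> Hom C T' W" using Comp_Hom[OF e'(2) e(2)] .
    ultimately show ?case using z' by (metis add_Suc_right)
  qed
  then show ?thesis using that by blast
qed

section \<open>The completion map\<close>

text \<open>Stage \<gamma> is contained in stage \<beta>, so \<open>Q \<beta>\<close> kills
  \<open>M \<gamma>\<close> and factors over the cokernel \<open>Q \<gamma>\<close>.\<close>

lemma Q_transition:
  assumes "\<beta> \<le> \<gamma>" "\<gamma> \<le> l"
  shows "factor_over V (Q \<gamma>) (Q \<beta>) \<in> Hom V (tgt (Q \<gamma>)) (tgt (Q \<beta>))"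
    "factor_over V (Q \<gamma>) (Q \<beta>) \<cdot>\<^bsub>V\<^esub> Q \<gamma> = Q \<beta>"
proof -
  have \<beta>: "\<beta> \<le> l" using assms by simp
  have fac: "\<exists>u. u \<in> Hom C (ob (tgt (Q \<gamma>)) i) (ob (tgt (Q \<beta>)) i) \<and> u \<cdot> cmp (Q \<gamma>) i = cmp (Q \<beta>) i" for i
  proof -
    have I: "ob (src (M \<gamma>)) i \<in> Obj C" using M_cmp[OF assms(2)] Hom_Obj by blast
    have "lies_in \<gamma> i (cmp (M \<gamma>) i)"
      using lies_inI[OF Id_Hom[OF I] assms(2)] Comp_Id[OF M_cmp[OF assms(2)]] by simp
    then have "cmp (Q \<beta>) i \<cdot> cmp (M \<gamma>) i = Zero C (ob (src (M \<gamma>)) i) (ob (tgt (Q \<beta>)) i)"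
      using lies_in_iff[OF \<beta> M_cmp[OF assms(2)]] lies_in_antimono assms by blast
    then show ?thesis
      using is_cokernel_factor[OF quot_map_cokernel(2)[OF assms(2), of i], of "cmp (Q \<beta>) i"]
        Q_cmp[OF \<beta>, of i] Q_cmp[OF assms(2), of i] M_cmp[OF assms(2), of i] by (auto simp: Hom_iff)
  qed
  note f = invseq_factor_over[OF Q_Hom[OF assms(2)] Q_epic[OF assms(2)] Q_Hom[OF \<beta>] fac]
  show "factor_over V (Q \<gamma>) (Q \<beta>) \<in> Hom V (tgt (Q \<gamma>)) (tgt (Q \<beta>))"
    "factor_over V (Q \<gamma>) (Q \<beta>) \<cdot>\<^bsub>V\<^esub> Q \<gamma> = Q \<beta>"
    using f by auto
qed

text \<open>Existence of limits justifies the \<open>SOME\<close> in \<open>completion\<close>; the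
  universal property, applied to the cone of all \<open>Q \<beta>\<close>, justifies the
  \<open>THE\<close> in \<open>completion_map\<close>.\<close>

lemma completion_map_limit:
  obtains L p where
    "completion_map C S l \<in> Hom V S L"
    "\<And>\<beta>. \<beta> < l \<Longrightarrow> p \<beta> \<in> Hom V L (tgt (Q \<beta>))"
    "\<And>\<beta>. \<beta> < l \<Longrightarrow> p \<beta> \<cdot>\<^bsub>V\<^esub> completion_map C S l = Q \<beta>"
    "\<And>i. is_limit C {..<l} (\<lambda>\<beta>. ob (tgt (Q \<beta>)) i)
       (\<lambda>\<beta> \<gamma>. cmp (factor_over V (Q \<gamma>) (Q \<beta>)) i) (ob L i) (\<lambda>\<beta>. cmp (p \<beta>) i)"
proof -
  interpret V: category V by (rule category_invseq_cat)
  have X: "inverse_sequence C (tgt (Q \<beta>))" if "\<beta> \<in> {..<l}" for \<beta>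
    using that Q_Hom[of \<beta>] by (auto simp: invseq_Hom_iff)
  have t: "factor_over V (Q \<gamma>) (Q \<beta>) \<in> Hom V (tgt (Q \<gamma>)) (tgt (Q \<beta>))"
    if "\<beta> \<in> {..<l}" "\<gamma> \<in> {..<l}" "\<beta> \<le> \<gamma>" for \<beta> \<gamma>
    using that Q_transition(1) by simp
  note U = universe small_products small_l
  let ?lim = "is_limit V {..<l} (\<lambda>\<beta>. tgt (Q \<beta>)) (\<lambda>\<beta> \<gamma>. factor_over V (Q \<gamma>) (Q \<beta>))"
  obtain L0 p0 where L0: "?lim L0 p0" by (rule ex_invseq_limit[OF U X t]) auto
  obtain L p where Lp: "completion C S l = (L, p)" by (cases "completion C S l")
  have "(\<lambda>(L, p). ?lim L p) (completion C S l)"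
    unfolding completion_def by (rule someI[of _ "(L0, p0)"]) (use L0 in simp)
  then have L: "?lim L p" by (simp add: Lp)
  have p: "p \<beta> \<in> Hom V L (tgt (Q \<beta>))" if "\<beta> < l" for \<beta>
    using L that by (auto simp: is_limit_def is_cone_def)
  have "is_cone V {..<l} (\<lambda>\<beta>. tgt (Q \<beta>)) (\<lambda>\<beta> \<gamma>. factor_over V (Q \<gamma>) (Q \<beta>)) S Q"
    using S Q_Hom Q_transition(2) by (auto simp: is_cone_def)
  then obtain c where c: "c \<in> Hom V S L" "\<And>\<beta>. \<beta> \<in> {..<l} \<Longrightarrow> p \<beta> \<cdot>\<^bsub>V\<^esub> c = Q \<beta>"
    by (rule V.is_limit_factor[OF L]) auto
  have "\<exists>!u. u \<in> Hom V S L \<and> (\<forall>\<beta><l. p \<beta> \<cdot>\<^bsub>V\<^esub> u = Q \<beta>)"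
  proof (intro ex1I[of _ c] conjI allI impI)
    fix u assume "u \<in> Hom V S L \<and> (\<forall>\<beta><l. p \<beta> \<cdot>\<^bsub>V\<^esub> u = Q \<beta>)"
    then show "u = c" by (intro V.limit_unique[OF L _ c(1) _ t]) (use c(2) in auto)
  qed (use c in auto)
  from theI'[OF this]
  have "completion_map C S l \<in> Hom V S L" "\<And>\<beta>. \<beta> < l \<Longrightarrow> p \<beta> \<cdot>\<^bsub>V\<^esub> completion_map C S l = Q \<beta>"
    by (simp_all add: completion_map_def Lp)
  then show ?thesis using that p invseq_limit[OF U X t L] by blast
qed

text \<open>Each component is epic because its composite with a suitable arrow \<open>r 0\<close> is
  a cover of \<open>ob L i\<close>.\<close>

theorem completion_map_epic:
  assumes l: "limit_ordinal l" "countable_cofinality l" and lim1: "zero_object C (lim1 C S)"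
  shows "epic V (completion_map C S l)"
proof -
  define c where "c = completion_map C S l"
  obtain L p where c: "c \<in> Hom V S L"
    and p: "\<And>\<beta>. \<beta> < l \<Longrightarrow> p \<beta> \<in> Hom V L (tgt (Q \<beta>))"
    and pc: "\<And>\<beta>. \<beta> < l \<Longrightarrow> p \<beta> \<cdot>\<^bsub>V\<^esub> c = Q \<beta>"
    and lim: "\<And>i. is_limit C {..<l} (\<lambda>\<beta>. ob (tgt (Q \<beta>)) i)
       (\<lambda>\<beta> \<gamma>. cmp (factor_over V (Q \<gamma>) (Q \<beta>)) i) (ob L i) (\<lambda>\<beta>. cmp (p \<beta>) i)"
    unfolding c_def by (rule completion_map_limit) auto
  obtain g :: "nat \<Rightarrow> 'w" where g: "mono g" "\<And>n. g n < l" "\<And>\<beta>. \<beta> < l \<Longrightarrow> \<exists>n. \<beta> \<le> g n"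
    by (rule cofinal_sequence[OF l]) auto
  \<comment> \<open>An element of stage \<open>b n\<close> can be lifted n times and still lie in
    stage \<open>g n\<close>.\<close>
  define b where "b = (\<lambda>n. (nxt ^^ n) (g n))"
  have b_less: "b n < l" for n unfolding b_def by (rule nxt_funpow_less[OF l(1) g(2)])
  have g_le_b: "g n \<le> b n" for n unfolding b_def by (rule nxt_funpow_ge[OF l(1) g(2)])
  \<comment> \<open>Monotonicity allows the lifts number n and n + 1 to be compared at stage
    \<open>b n\<close>.\<close>
  have b_Suc: "b n \<le> b (Suc n)" for n
  proof -
    have "b n \<le> (nxt ^^ n) (g (Suc n))"
      unfolding b_def using nxt_funpow_mono[OF l(1) monoD[OF g(1), of n "Suc n"] g(2)] by simp
    also have "\<dots> \<le> b (Suc n)"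
      using nxt_greater[OF nxt_funpow_less[OF l(1) g(2)], of n "Suc n"] by (simp add: b_def)
    finally show ?thesis .
  qed
  have le: "\<beta> \<le> l" if "\<beta> < l" for \<beta> using that by simp
  have "epic C (cmp c i)" for i
  proof -
    note cA = invseq_Hom_cmp[OF c, of i]
    define W where "W = ob L i"
    have pA: "cmp (p \<beta>) i \<in> Hom C W (ob (tgt (Q \<beta>)) i)" if "\<beta> < l" for \<beta>
      unfolding W_def by (rule invseq_Hom_cmp[OF p[OF that]])
    have pcA: "cmp (p \<beta>) i \<cdot> cmp c i = cmp (Q \<beta>) i" if "\<beta> < l" for \<beta>
      using arg_cong[OF pc[OF that], of "\<lambda>x. cmp x i"] by simp
    have W: "W \<in> Obj C" using pA[OF g(2)] Hom_Obj by blast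
    define t where "t = (\<lambda>\<beta> \<gamma>. cmp (factor_over V (Q \<gamma>) (Q \<beta>)) i)"
    have tA: "t \<beta> \<gamma> \<in> Hom C (ob (tgt (Q \<gamma>)) i) (ob (tgt (Q \<beta>)) i)" if "\<beta> \<le> \<gamma>" "\<gamma> < l" for \<beta> \<gamma>
      unfolding t_def using that by (intro invseq_Hom_cmp Q_transition(1)) auto
    have tQ: "t \<beta> \<gamma> \<cdot> cmp (Q \<gamma>) i = cmp (Q \<beta>) i" if "\<beta> \<le> \<gamma>" "\<gamma> < l" for \<beta> \<gamma>
      using arg_cong[OF Q_transition(2)[OF that(1) le[OF that(2)]], of "\<lambda>x. cmp x i"] by (simp add: t_def)
    have tp: "t \<beta> \<gamma> \<cdot> cmp (p \<gamma>) i = cmp (p \<beta>) i" if "\<beta> \<le> \<gamma>" "\<gamma> < l" for \<beta> \<gamma>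
    proof -
      have "\<beta> < l" using that by simp
      then show ?thesis using lim[of i] that by (auto simp: t_def is_limit_def is_cone_def)
    qed

    \<comment> \<open>Lifts of the projections over one cover\<close>
    have "\<exists>T e s. epic C e \<and> e \<in> Hom C T W \<and> s \<in> Hom C T (ob S i) \<and>
        cmp (Q (b n)) i \<cdot> s = cmp (p (b n)) i \<cdot> e" for n
      by (rule epic_pullback[OF Q_epic[OF le[OF b_less[of n]]] Q_cmp[OF le[OF b_less[of n]]] pA[OF b_less[of n]]])
        blast
    then obtain T e s where e: "\<And>n. epic C (e n)" "\<And>n. e n \<in> Hom C (T n) W"
      and s: "\<And>n. s n \<in> Hom C (T n) (ob S i)" "\<And>n. cmp (Q (b n)) i \<cdot> s n = cmp (p (b n)) i \<cdot> e n"
      by metis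
    \<comment> \<open>The covers \<open>e n\<close> vary with n; exactness of countable products
      replaces them by the single cover \<open>d\<close>.\<close>
    obtain X d a where d: "epic C d" "d \<in> Hom C X W" and "\<And>n. a n \<in> Hom C X (Dom C (e n))"
      and ea: "\<And>n. e n \<cdot> a n = d"
      by (rule ex_countable_common_cover[OF universe exact_products W, of e]) (use e in \<open>auto simp: Hom_iff\<close>)
    then have a: "a n \<in> Hom C X (T n)" for n using e(2) by (simp add: Hom_iff)
    define \<sigma> where "\<sigma> = (\<lambda>n. s n \<cdot> a n)"
    have \<sigma>: "\<sigma> n \<in> Hom C X (ob S i)" for n unfolding \<sigma>_def using Comp_Hom[OF a s(1)] .
    \<comment> \<open>The equation that defines \<open>s n\<close> at stage \<open>b n\<close> is
      pushed down to stage \<beta> by the transition map \<open>t \<beta> (b n)\<close>.\<close>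
    have Q\<sigma>: "cmp (Q \<beta>) i \<cdot> \<sigma> n = cmp (p \<beta>) i \<cdot> d" if "\<beta> \<le> b n" for \<beta> n
    proof -
      have \<beta>: "\<beta> < l" using that b_less[of n] by simp
      note H = a[of n] s(1)[of n] e(2)[of n] Q_cmp[OF le[OF b_less[of n]], of i] pA[OF b_less[of n]]
        tA[OF that b_less] pA[OF \<beta>] Q_cmp[OF le[OF \<beta>], of i]
      have "cmp (Q \<beta>) i \<cdot> \<sigma> n = t \<beta> (b n) \<cdot> ((cmp (Q (b n)) i \<cdot> s n) \<cdot> a n)"
        using H by (subst tQ[OF that b_less, symmetric]) (simp add: \<sigma>_def Hom_iff assoc)
      also have "\<dots> = (t \<beta> (b n) \<cdot> cmp (p (b n)) i) \<cdot> (e n \<cdot> a n)"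
        unfolding s(2) using H by (simp add: Hom_iff assoc)
      finally show ?thesis unfolding tp[OF that b_less] ea .
    qed
    define x where "x = (\<lambda>n. \<sigma> n \<boxminus> \<sigma> (Suc n))"
    have x: "x n \<in> Hom C X (ob S i)" for n unfolding x_def by (rule diff_Hom[OF \<sigma> \<sigma>])
    \<comment> \<open>In the quotient at stage \<open>b n\<close>, both \<open>\<sigma> n\<close>
      and \<open>\<sigma> (Suc n)\<close> become \<open>cmp (p (b n)) i \<cdot> d\<close>.\<close>
    have x_in: "lies_in (b n) i (x n)" for n
    proof -
      have q: "cmp (Q (b n)) i \<in> Hom C (ob S i) (ob (tgt (Q (b n))) i)" by (rule Q_cmp[OF le[OF b_less]])
      have "cmp (Q (b n)) i \<cdot> x n = Zero C X (ob (tgt (Q (b n))) i)"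
        using Comp_diff[OF \<sigma> \<sigma> q] Q\<sigma>[of "b n" n] Q\<sigma>[of "b n" "Suc n"] b_Suc
          Hom_group_laws(4)[OF Comp_Hom[OF d(2) pA] Comp_Hom[OF d(2) pA]] b_less by (simp add: x_def)
      then show ?thesis using lies_in_iff[OF le[OF b_less] x] by simp
    qed

    \<comment> \<open>Lifting the differences to index i + n\<close>
    have "\<exists>T e z. epic C e \<and> e \<in> Hom C T X \<and> z \<in> Hom C T (ob S (i + n)) \<and>
        lies_in (g n) (i + n) z \<and> bonds i n \<cdot> z = x n \<cdot> e" for n
      by (rule lies_in_nxt_funpow[OF l(1) g(2) x x_in[unfolded b_def]]) blast
    then obtain T' e' z' where e': "\<And>n. epic C (e' n)" "\<And>n. e' n \<in> Hom C (T' n) X"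
      and z': "\<And>n. z' n \<in> Hom C (T' n) (ob S (i + n))" "\<And>n. lies_in (g n) (i + n) (z' n)"
        "\<And>n. bonds i n \<cdot> z' n = x n \<cdot> e' n"
      by metis
    have XO: "X \<in> Obj C" using d(2) by (rule Hom_Obj)
    \<comment> \<open>As before, one cover is made to serve all n.\<close>
    obtain X' d' a' where d': "epic C d'" "d' \<in> Hom C X' X" and "\<And>n. a' n \<in> Hom C X' (Dom C (e' n))"
      and ea': "\<And>n. e' n \<cdot> a' n = d'"
      by (rule ex_countable_common_cover[OF universe exact_products XO, of e']) (use e' in \<open>auto simp: Hom_iff\<close>)
    then have a': "a' n \<in> Hom C X' (T' n)" for n using e'(2) by (simp add: Hom_iff)
    define z where "z = (\<lambda>n. z' n \<cdot> a' n)"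
    have z: "z n \<in> Hom C X' (ob S (i + n))" for n unfolding z_def by (rule Comp_Hom[OF a' z'(1)])
    have z_in: "lies_in (g n) (i + n) (z n)" for n
      unfolding z_def by (rule lies_in_Comp[OF z'(2) le[OF g(2)] z'(1) a'])
    have bz: "bonds i n \<cdot> z n = x n \<cdot> d'" for n
    proof -
      note H = a'[of n] z'(1)[of n] e'(2)[of n] x[of n] bonds_Hom[of i n]
      have "bonds i n \<cdot> z n = (bonds i n \<cdot> z' n) \<cdot> a' n" using H by (simp add: z_def Hom_iff assoc)
      also have "\<dots> = x n \<cdot> (e' n \<cdot> a' n)" unfolding z'(3) using H by (simp add: Hom_iff assoc)
      finally show ?thesis unfolding ea' .
    qed

    \<comment> \<open>Solving for the corrections\<close>
    have X'O: "X' \<in> Obj C" using d'(2) by (rule Hom_Obj)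
    \<comment> \<open>The equations start at index 0, while \<open>z n\<close> sits at index i + n;
      below i the family is filled up with zero.\<close>
    define \<zeta> where "\<zeta> = (\<lambda>m. if m < i then Zero C X' (ob S m) else z (m - i))"
    have \<zeta>: "\<zeta> m \<in> Hom C X' (ob S m)" for m
      using z[of "m - i"] Zero_Hom[OF X'O inverse_sequence_ob[OF S], of m]
      by (cases "m < i") (simp_all add: \<zeta>_def)
    \<comment> \<open>The element at index m lies in stage \<open>g (m - i)\<close>, which is at
      least \<open>g n\<close> from m = i + n on because \<open>g\<close> is monotone.\<close>
    have \<zeta>_in: "lies_in (g n) m (\<zeta> m)" if "i + n \<le> m" for m n
    proof -
      have "lies_in (g (m - i)) m (\<zeta> m)" using z_in[of "m - i"] that by (simp add: \<zeta>_def)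
      then show ?thesis by (rule lies_in_antimono) (use that g(2) le monoD[OF g(1)] in auto)
    qed
    obtain Y h y where h: "epic C h" "h \<in> Hom C Y X'" and y: "\<And>m. y m \<in> Hom C Y (ob S m)"
      and yh: "\<And>m. y m \<boxminus> bond S m \<cdot> y (Suc m) = \<zeta> m \<cdot> h"
      by (rule lim1_zero_solve[OF lim1, of \<zeta> X']) (use \<zeta> in auto)
    \<comment> \<open>The differences are known to lie in stage \<open>g n\<close> from index i + n
      on, hence the starting point \<open>i + n\<close>.\<close>
    have y_in: "lies_in (g n) (i + n) (y (i + n))" for n
    proof (rule lies_in_of_differences[OF le[OF g(2)], of "i + n" y Y])
      show "lies_in (g n) m (y m \<boxminus> bond S m \<cdot> y (Suc m))" if "i + n \<le> m" for m
        unfolding yh by (rule lies_in_Comp[OF \<zeta>_in[OF that] le[OF g(2)] \<zeta> h(2)])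
    qed (use y in auto)

    \<comment> \<open>The corrected lift\<close>
    define D where "D = d' \<cdot> h"
    have D: "D \<in> Hom C Y X" unfolding D_def by (rule Comp_Hom[OF h(2) d'(2)])
    \<comment> \<open>The lift \<open>\<sigma> n\<close> matches the projections only up to stage
      \<open>b n\<close>. The correction makes it independent of n, at the cost of a term that is
      negligible up to stage \<open>g n\<close>.\<close>
    define r where "r = (\<lambda>n. \<sigma> n \<cdot> D \<boxminus> bonds i n \<cdot> y (i + n))"
    have \<sigma>D: "\<sigma> n \<cdot> D \<in> Hom C Y (ob S i)" and xD: "x n \<cdot> D \<in> Hom C Y (ob S i)"
      and By: "bonds i n \<cdot> y (i + n) \<in> Hom C Y (ob S i)" for n
      using Comp_Hom[OF D \<sigma>] Comp_Hom[OF D x] Comp_Hom[OF y bonds_Hom] by auto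
    have r: "r n \<in> Hom C Y (ob S i)" for n unfolding r_def by (rule diff_Hom[OF \<sigma>D By])
    have "r n = r (Suc n)" for n
    proof -
      have "\<sigma> n = x n \<boxplus> \<sigma> (Suc n)" using Hom_group_laws(5)[OF \<sigma> \<sigma>] by (simp add: x_def)
      then have 1: "\<sigma> n \<cdot> D = x n \<cdot> D \<boxplus> \<sigma> (Suc n) \<cdot> D" using Comp_Add_left[OF D x \<sigma>] by simp
      note by' = Comp_Hom[OF y[of "Suc (i + n)"] inverse_sequence_bond[OF S, of "i + n"]]
      have zh: "z n \<cdot> h \<in> Hom C Y (ob S (i + n))" by (rule Comp_Hom[OF h(2) z])
      have "y (i + n) = z n \<cdot> h \<boxplus> bond S (i + n) \<cdot> y (Suc (i + n))"
        using Hom_group_laws(5)[OF y[of "i + n"] by'] yh[of "i + n"] by (simp add: \<zeta>_def)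
      then have "bonds i n \<cdot> y (i + n) =
          bonds i n \<cdot> (z n \<cdot> h) \<boxplus> bonds i n \<cdot> (bond S (i + n) \<cdot> y (Suc (i + n)))"
        using Comp_Add_right[OF zh by' bonds_Hom] by simp
      moreover have "bonds i n \<cdot> (z n \<cdot> h) = x n \<cdot> D"
      proof -
        have "bonds i n \<cdot> (z n \<cdot> h) = (bonds i n \<cdot> z n) \<cdot> h"
          using bonds_Hom[of i n] z[of n] h(2) by (simp add: Hom_iff assoc)
        also have "\<dots> = x n \<cdot> D"
          unfolding bz D_def using x[of n] d'(2) h(2) by (simp add: Hom_iff assoc)
        finally show ?thesis .
      qed
      moreover have "bonds i n \<cdot> (bond S (i + n) \<cdot> y (Suc (i + n))) = bonds i (Suc n) \<cdot> y (i + Suc n)"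
        using bonds_Hom[of i n] inverse_sequence_bond[OF S, of "i + n"] y[of "Suc (i + n)"]
        by (simp add: Hom_iff assoc)
      ultimately have 2: "bonds i n \<cdot> y (i + n) = x n \<cdot> D \<boxplus> bonds i (Suc n) \<cdot> y (i + Suc n)" by simp
      \<comment> \<open>By \<open>1\<close> and \<open>2\<close> both terms of \<open>r n\<close>
        contain the summand \<open>x n \<cdot> D\<close>, which cancels and leaves
        \<open>r (Suc n)\<close>.\<close>
      show ?thesis
        unfolding r_def 1 2 by (rule Add_diff_Add[OF xD \<sigma>D By])
    qed
    then have r_const: "r 0 = r n" for n by (induction n) auto
    have Qr: "cmp (Q \<beta>) i \<cdot> r 0 = cmp (p \<beta>) i \<cdot> (d \<cdot> D)" if \<beta>: "\<beta> < l" for \<beta>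
    proof -
      \<comment> \<open>For this n the correction vanishes modulo stage \<beta>, so
        \<open>r 0\<close>, being equal to \<open>r n\<close>, has the same image as
        \<open>\<sigma> n \<cdot> D\<close>.\<close>
      obtain n where n: "\<beta> \<le> g n" using g(3)[OF \<beta>] by blast
      note q = Q_cmp[OF le[OF \<beta>], of i]
      have "lies_in \<beta> i (bonds i n \<cdot> y (i + n))"
        by (rule lies_in_antimono[OF lies_in_bonds[OF _ y_in] n]) (use le[OF g(2)] in auto)
      then have 0: "cmp (Q \<beta>) i \<cdot> (bonds i n \<cdot> y (i + n)) = Zero C Y (ob (tgt (Q \<beta>)) i)"
        using lies_in_iff[OF le[OF \<beta>] By] by simp
      have "cmp (Q \<beta>) i \<cdot> (\<sigma> n \<cdot> D \<boxminus> r n) = Zero C Y (ob (tgt (Q \<beta>)) i)"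
      proof -
        have "\<sigma> n \<cdot> D = bonds i n \<cdot> y (i + n) \<boxplus> r n"
          using Hom_group_laws(5)[OF \<sigma>D[of n] By[of n]] Hom_group_laws(3)[OF r[of n] By[of n]]
          unfolding r_def by (rule trans[OF sym])
        then have "\<sigma> n \<cdot> D \<boxminus> r n = bonds i n \<cdot> y (i + n)"
          using Hom_group_laws(8)[OF \<sigma>D[of n] r[of n], THEN iffD2] By by blast
        then show ?thesis using 0 by simp
      qed
      then have "cmp (Q \<beta>) i \<cdot> (\<sigma> n \<cdot> D) = cmp (Q \<beta>) i \<cdot> r n"
        using Comp_diff[OF \<sigma>D r q] Hom_group_laws(7)[OF Comp_Hom[OF \<sigma>D q] Comp_Hom[OF r q]] by simp
      moreover have "cmp (Q \<beta>) i \<cdot> (\<sigma> n \<cdot> D) = (cmp (Q \<beta>) i \<cdot> \<sigma> n) \<cdot> D"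
        using q \<sigma>[of n] D by (simp add: Hom_iff assoc)
      moreover have "(cmp (p \<beta>) i \<cdot> d) \<cdot> D = cmp (p \<beta>) i \<cdot> (d \<cdot> D)"
        using pA[OF \<beta>] d(2) D by (simp add: Hom_iff assoc)
      ultimately show ?thesis using Q\<sigma>[of \<beta> n] order_trans[OF n g_le_b] r_const[of n] by simp
    qed
    have cA': "cmp c i \<in> Hom C (ob S i) W" using cA by (simp add: W_def)
    have dD: "d \<cdot> D \<in> Hom C Y W" by (rule Comp_Hom[OF D d(2)])
    \<comment> \<open>By \<open>Qr\<close> both sides have the same projections. The cover
      \<open>d \<cdot> D\<close> of \<open>W\<close> thus factors through \<open>cmp c i\<close>,
      which is therefore epic.\<close>
    have "cmp c i \<cdot> r 0 = d \<cdot> D"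
    proof (rule limit_unique[OF lim[of i]])
      show "cmp c i \<cdot> r 0 \<in> Hom C Y (ob L i)" "d \<cdot> D \<in> Hom C Y (ob L i)"
        using Comp_Hom[OF r cA'] dD by (auto simp: W_def)
      show "cmp (p \<beta>) i \<cdot> (cmp c i \<cdot> r 0) = cmp (p \<beta>) i \<cdot> (d \<cdot> D)" if "\<beta> \<in> {..<l}" for \<beta>
      proof -
        have \<beta>: "\<beta> < l" using that by simp
        have "cmp (p \<beta>) i \<cdot> (cmp c i \<cdot> r 0) = (cmp (p \<beta>) i \<cdot> cmp c i) \<cdot> r 0"
          using pA[OF \<beta>] cA' r[of 0] by (simp add: Hom_iff assoc)
        then show ?thesis unfolding pcA[OF \<beta>] Qr[OF \<beta>] .
      qed
    qed (use tA[unfolded t_def] in auto)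
    moreover have "epic C (d \<cdot> D)"
      using epic_Comp[OF epic_Comp[OF h(1) d'(1)] d(1)] h(2) d'(2) d(2) by (simp add: D_def Hom_iff)
    ultimately show ?thesis
      using epic_of_Comp[of "cmp c i" "r 0"] r[of 0] cA' by (simp add: Hom_iff)
  qed
  then show ?thesis using invseq_epic c unfolding c_def by blast
qed

end

theorem corollary3p4:
  fixes A :: "('o, 'm) precat"
    and S :: "('o, 'm) invseq"
    and l :: "'w::wellorder"
  assumes "grothendieck_universe TYPE('u)"
    and "abelian_category A"
    and "locally_small TYPE('u) A"
    and "\<exists>G. generator A G"
    and "has_small_direct_sums TYPE('u) A"
    and "has_exact_small_products TYPE('u) A"
    and "inverse_sequence A S"
    and "zero_object A (lim1 A S)"
    and "small TYPE('u) {..<l}"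
    and "limit_ordinal l"
    and "countable_cofinality l"
  shows "complete A S l"
proof -
  interpret iterated_images A S l "TYPE('u)"
    using assms by (intro iterated_images.intro iterated_images_axioms.intro)
  show ?thesis unfolding complete_def by (rule completion_map_epic) fact+
qed

end
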